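(* Let $m>3$ be an integer and assume that $\eta_0\in H^m(\mathbb{T})$. Then for any $T>0$ there exists a unique classical solution $\eta$ on $[0,T]\times\mathbb{T}$ to $$\partial_t\eta+L\eta=0,\qquad \partial_\theta v=H\eta,\qquad \eta(0,\theta)=\eta_0(\theta),\qquad v(t,0)=0,$$ satisfying $$\eta\in C([0,T];H^m(\mathbb{T}))\cap C^2([0,T];H^{m-2}(\mathbb{T})).$$
   Context: $\mathbb{T}=[-\pi,\pi]$ is the torus (functions are $2\pi$-periodic); $H^m(\mathbb{T})$ is the periodic Sobolev space. $H$ is the periodic Hilbert transform, $Hf(\theta)=\frac{1}{2\pi}\,\mathrm{P.V.}\int_{-\pi}^{\pi}\cot\frac{\theta-\phi}{2}f(\phi)\,d\phi$, so $H\sin k\theta=-\cos k\theta$ and $H\cos k\theta=\sin k\theta$ for $k\ge1$. Given $\eta$, the function $v$ is determined by $\partial_\theta v=H\eta$ and $v(t,0)=0$, and $$L\eta=\tfrac12\sin2\theta\,\partial_\theta\eta-\cos2\theta\,\eta+\sin2\theta\,H\eta-2\cos2\theta\,v.$$ *)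

theory Defs
  imports "HOL-Analysis.Analysis"
begin

text \<open>
  Functions on the torus are represented by \<open>2\<pi>\<close>-periodic functions on the real line.
\<close>

definition periodic :: "(real \<Rightarrow> real) \<Rightarrow> bool" where
  "periodic f \<longleftrightarrow> (\<forall>x. f (x + 2 * pi) = f x)"

definition fourier_coeff :: "(real \<Rightarrow> real) \<Rightarrow> int \<Rightarrow> complex" where
  "fourier_coeff f k =
     (LBINT x:{-pi..pi}. complex_of_real (f x) * cis (- (of_int k * x))) / (2 * pi)"

text \<open>
  The members of \<open>sobolev m\<close> are functions, not classes modulo equality almost everywhere;
  \<open>sobolev_norm m\<close> is a seminorm on them that vanishes exactly on the null functions.
  It is meaningful only on \<open>sobolev m\<close>, since \<open>infsum\<close> is \<open>0\<close> for divergent families.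
\<close>

definition sobolev :: "nat \<Rightarrow> (real \<Rightarrow> real) set" where
  "sobolev m = {f. periodic f \<and> f \<in> borel_measurable borel \<and>
     set_integrable lborel {-pi..pi} (\<lambda>x. (f x)\<^sup>2) \<and>
     (\<lambda>k::int. (1 + (of_int k)\<^sup>2) ^ m * (cmod (fourier_coeff f k))\<^sup>2) summable_on UNIV}"

definition sobolev_norm :: "nat \<Rightarrow> (real \<Rightarrow> real) \<Rightarrow> real" where
  "sobolev_norm m f =
     sqrt (\<Sum>\<^sub>\<infinity>k::int. (1 + (of_int k)\<^sup>2) ^ m * (cmod (fourier_coeff f k))\<^sup>2)"

text \<open>
  \<open>C_sobolev j T m\<close> is \<open>C\<^sup>j([0,T]; H\<^sup>m)\<close>: continuity and differentiability in time are
  with respect to the norm of \<open>H\<^sup>m\<close>, one-sided at the end points.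
\<close>

primrec C_sobolev :: "nat \<Rightarrow> real \<Rightarrow> nat \<Rightarrow> (real \<Rightarrow> real \<Rightarrow> real) set" where
  "C_sobolev 0 T m = {u. \<forall>t\<in>{0..T}. u t \<in> sobolev m \<and>
     ((\<lambda>s. sobolev_norm m (\<lambda>x. u s x - u t x)) \<longlongrightarrow> 0) (at t within {0..T})}"
| "C_sobolev (Suc j) T m = {u. \<exists>u'\<in>C_sobolev j T m. \<forall>t\<in>{0..T}. u t \<in> sobolev m \<and>
     ((\<lambda>s. sobolev_norm m (\<lambda>x. (u s x - u t x) / (s - t) - u' t x)) \<longlongrightarrow> 0)
       (at t within {0..T})}"

text \<open>
  Principal value: a symmetric neighbourhood of the singularity, which on the real line sits at
  all points \<open>x + 2\<pi>k\<close>, is removed (for \<open>x = \<plusminus>\<pi>\<close> both end points of the interval are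
  singular). The limit exists at every \<open>x\<close> if \<open>f\<close> is periodic and continuously differentiable.
\<close>

definition hilbert :: "(real \<Rightarrow> real) \<Rightarrow> real \<Rightarrow> real" where
  "hilbert f x = Lim (at_right 0) (\<lambda>\<epsilon>.
     1 / (2 * pi) *
       (LBINT y:{y \<in> {-pi..pi}. \<forall>k::int. \<epsilon> \<le> \<bar>x - y - 2 * pi * of_int k\<bar>}.
          cot ((x - y) / 2) * f y))"

definition L_op :: "(real \<Rightarrow> real) \<Rightarrow> (real \<Rightarrow> real) \<Rightarrow> real \<Rightarrow> real" where
  "L_op f v x = 1 / 2 * sin (2 * x) * deriv f x - cos (2 * x) * f x
     + sin (2 * x) * hilbert f x - 2 * cos (2 * x) * v x"

text \<open>
  The solution is of class \<open>C\<^sup>1\<close> on \<open>[0,T]\<close> times the torus (one-sided time derivatives at the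
  end points) and the equations hold at every point. The initial value is an element of a Sobolev
  space, hence a function up to null sets, so it is attained almost everywhere; if it is
  continuous, then it is attained everywhere, because \<open>\<eta> 0\<close> is continuous.
\<close>

definition classical_solution ::
    "real \<Rightarrow> (real \<Rightarrow> real) \<Rightarrow> (real \<Rightarrow> real \<Rightarrow> real) \<Rightarrow> bool" where
  "classical_solution T \<eta>\<^sub>0 \<eta> \<longleftrightarrow>
     (\<forall>t\<in>{0..T}. periodic (\<eta> t) \<and> (\<forall>x. \<eta> t differentiable at x)) \<and>
     continuous_on ({0..T} \<times> UNIV) (\<lambda>(t, x). \<eta> t x) \<and>
     continuous_on ({0..T} \<times> UNIV) (\<lambda>(t, x). deriv (\<eta> t) x) \<and>
     (\<exists>\<eta>' v.
        continuous_on ({0..T} \<times> UNIV) (\<lambda>(t, x). \<eta>' t x) \<and>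
        (\<forall>t\<in>{0..T}. \<forall>x.
           ((\<lambda>s. \<eta> s x) has_real_derivative \<eta>' t x) (at t within {0..T}) \<and>
           \<eta>' t x + L_op (\<eta> t) (v t) x = 0 \<and>
           (v t has_real_derivative hilbert (\<eta> t) x) (at x)) \<and>
        (\<forall>t\<in>{0..T}. v t 0 = 0)) \<and>
     (AE x in lborel. \<eta> 0 x = \<eta>\<^sub>0 x)"

end

theory Submission imports Defs begin

text \<open>
  The problem is linear, and it becomes transparent in Fourier variables. Write \<open>c n\<close> for the
  coefficients of \<open>\<eta>\<close>. The Hilbert transform is the multiplier \<open>- \<i> sgn n\<close>; hence \<open>v\<close> has the
  coefficients \<open>- c n / \<bar>n\<bar>\<close> for \<open>n \<noteq> 0\<close>, and the condition \<open>v 0 = 0\<close> fixes its mean to be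
  \<open>\<Sum>k. c k / \<bar>k\<bar>\<close>. Multiplication by \<open>sin 2\<theta>\<close> and \<open>cos 2\<theta>\<close> shifts indices by two. So \<open>L\<close> turns into an
  explicit infinite matrix \<open>Lseq\<close> that couples \<open>n\<close> only with \<open>n - 2\<close> and \<open>n + 2\<close>, up to one bounded
  functional that feeds the modes \<open>2\<close> and \<open>-2\<close>.

  The entries of this matrix grow like \<open>\<bar>n\<bar> / 4\<close>, so \<open>L\<close> loses a derivative, but the growing part is
  skew-symmetric up to bounded terms, and this remains true in every weighted space because
  the weights \<open>(1 + n\<^sup>2) ^ s\<close> vary by a relative amount of order \<open>1 / \<bar>n\<bar>\<close> between neighbours. Therefore
  \<open>Re \<langle>c, L c\<rangle>\<close>, taken in the scalar product of the Sobolev space, is bounded by a constant times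
  the squared norm (\<open>Lseq_energy\<close>). Together with Gronwall's inequality this gives estimates for all
  truncations of the matrix that do not depend on the truncation (\<open>energy_estimate\<close>).

  Existence (\<open>coeff_solution_exists\<close>): cut the data off at frequency \<open>K\<close> and the matrix at the much
  higher frequency \<open>N = (1 + K\<^sup>2)\<^sup>2\<close>. The resulting finite systems are solved by power series. Apart
  from the difference of their data, two of these solutions differ by the effect of the cut-off of the matrix, which is of size
  \<open>(1 + N\<^sup>2) powr (-1/2)\<close> times a norm with two more derivatives; for data cut off at \<open>K\<close> these two
  derivatives cost only a factor \<open>1 + K\<^sup>2\<close>. So the approximations form a Cauchy sequence, uniformly in time,
  in the very space to which the data belong, and the limit is continuous in time with values in this
  space. Differentiability in time then follows from the equation and a mean value inequality
  (\<open>hcont_derivative\<close>), each time derivative costing one space derivative.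

  Uniqueness (\<open>coeff_solution_unique\<close>): the truncation of the difference of two solutions solves
  the truncated system with an error that tends to \<open>0\<close>, and the energy estimate applies again.

  The translation between functions and coefficients rests on three facts: functions in \<open>sobolev m\<close>
  with \<open>m \<ge> 1\<close> agree almost everywhere with their absolutely convergent Fourier series
  (\<open>sobolev_expansion\<close>, from the completeness of the trigonometric system); the principal value
  integral acts on such series, if \<open>\<Sum>n. \<bar>n\<bar> * \<bar>c n\<bar>\<close> is finite, as the multiplier (\<open>hilbert_fseries\<close>); and consequently
  \<open>L_op\<close> acts on them as \<open>Lseq\<close> (\<open>L_op_fseries\<close>).
\<close>

section \<open>Weighted square-summable coefficient families\<close>

definition wt :: "nat \<Rightarrow> int \<Rightarrow> real" where
  "wt s n = (1 + (of_int n)\<^sup>2) ^ s"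

definition hseq :: "nat \<Rightarrow> (int \<Rightarrow> complex) set" where
  "hseq s = {c. (\<lambda>n. wt s n * (cmod (c n))\<^sup>2) summable_on UNIV}"

text \<open>
  The squared norm. All limit arguments below get by with the inequality
  \<open>hsq s (c + d) \<le> 2 * hsq s c + 2 * hsq s d\<close> in place of the triangle inequality for its root.
\<close>

definition hsq :: "nat \<Rightarrow> (int \<Rightarrow> complex) \<Rightarrow> real" where
  "hsq s c = (\<Sum>\<^sub>\<infinity>n. wt s n * (cmod (c n))\<^sup>2)"

definition trunc :: "nat \<Rightarrow> (int \<Rightarrow> complex) \<Rightarrow> int \<Rightarrow> complex" where
  "trunc N c n = (if \<bar>n\<bar> \<le> int N then c n else 0)"

lemma wt_pos [simp]: "wt s n > 0"
  unfolding wt_def by (intro zero_less_power) (simp add: add_pos_nonneg)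

lemma wt_nonneg [simp]: "wt s n \<ge> 0"
  using wt_pos[of s n] by linarith

lemma wt_ge_1: "wt s n \<ge> 1"
  unfolding wt_def by (intro one_le_power) simp

lemma wt_0 [simp]: "wt 0 n = 1"
  by (simp add: wt_def)

lemma wt_Suc: "wt (Suc s) n = (1 + (of_int n)\<^sup>2) * wt s n"
  by (simp add: wt_def)

lemma wt_add: "wt (s + r) n = wt s n * wt r n"
  by (simp add: wt_def power_add)

lemma wt_mono: "s \<le> r \<Longrightarrow> wt s n \<le> wt r n"
  unfolding wt_def by (intro power_increasing) auto

text \<open>
  With \<open>n = k + j\<close> and \<open>\<bar>j\<bar> \<le> 2\<close>, this is \<open>1 + (k + j)\<^sup>2 \<le> 1 + 2 * k\<^sup>2 + 2 * j\<^sup>2 \<le> 9 * (1 + k\<^sup>2)\<close>, raised to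
  the power \<open>s\<close>.
\<close>

lemma wt_shift:
  assumes "\<bar>n - k\<bar> \<le> 2"
  shows "wt s n \<le> 9 ^ s * wt s k"
proof -
  have "(n - k)\<^sup>2 \<le> 4" using assms abs_le_square_iff[of "n - k" 2] by simp
  moreover have "n\<^sup>2 \<le> 2 * (n - k)\<^sup>2 + 2 * k\<^sup>2"
    using zero_le_square[of "n - 2 * k"] by (simp add: power2_eq_square algebra_simps)
  moreover have "0 \<le> k\<^sup>2" by simp
  ultimately have "1 + n\<^sup>2 \<le> 9 * (1 + k\<^sup>2)" by (smt (verit))
  hence "real_of_int (1 + n\<^sup>2) \<le> real_of_int (9 * (1 + k\<^sup>2))" by (simp only: of_int_le_iff)
  hence "(1 + (real_of_int n)\<^sup>2) ^ s \<le> (9 * (1 + (real_of_int k)\<^sup>2)) ^ s"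
    by (intro power_mono) auto
  thus ?thesis unfolding wt_def power_mult_distrib .
qed

text \<open>
  Families with nonnegative terms are summable as soon as their finite partial sums are bounded, so
  norm bounds reduce to bounds for finite sums, for which limits and derivatives are elementary.
\<close>

lemma hseqI:
  assumes "\<And>F. finite F \<Longrightarrow> (\<Sum>n\<in>F. wt s n * (cmod (c n))\<^sup>2) \<le> B"
  shows "c \<in> hseq s" "hsq s c \<le> B"
proof -
  show "c \<in> hseq s" unfolding hseq_def mem_Collect_eq
    by (rule nonneg_bdd_above_summable_on) (auto intro!: bdd_aboveI2 assms)
  thus "hsq s c \<le> B" unfolding hsq_def hseq_def mem_Collect_eq
    by (rule infsum_le_finite_sums) (auto intro: assms)
qed

lemma hsq_ge_sum:
  assumes "c \<in> hseq s" "finite F"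
  shows "(\<Sum>n\<in>F. wt s n * (cmod (c n))\<^sup>2) \<le> hsq s c"
  using assms unfolding hsq_def hseq_def by (intro finite_sum_le_infsum) auto

lemma hsq_nonneg [simp]: "hsq s c \<ge> 0"
  unfolding hsq_def by (intro infsum_nonneg) simp

lemma hsq_ge_term: "c \<in> hseq s \<Longrightarrow> (cmod (c n))\<^sup>2 \<le> hsq s c"
  using hsq_ge_sum[of c s "{n}"] mult_right_mono[OF wt_ge_1[of s n], of "(cmod (c n))\<^sup>2"] by simp

lemma hseq_dominated:
  assumes "c \<in> hseq r" and "B \<ge> 0"
    and "\<And>n. wt s n * (cmod (d n))\<^sup>2 \<le> B * (wt r n * (cmod (c n))\<^sup>2)"
  shows "d \<in> hseq s" "hsq s d \<le> B * hsq r c"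
proof -
  have "(\<Sum>n\<in>F. wt s n * (cmod (d n))\<^sup>2) \<le> B * hsq r c" if "finite F" for F
  proof -
    have "(\<Sum>n\<in>F. wt s n * (cmod (d n))\<^sup>2) \<le> (\<Sum>n\<in>F. B * (wt r n * (cmod (c n))\<^sup>2))"
      by (intro sum_mono assms)
    also have "\<dots> \<le> B * hsq r c"
      unfolding sum_distrib_left [symmetric] by (intro mult_left_mono hsq_ge_sum that assms)
    finally show ?thesis .
  qed
  from hseqI[OF this] show "d \<in> hseq s" "hsq s d \<le> B * hsq r c" by blast+
qed

lemma hseq_mono: "c \<in> hseq r \<Longrightarrow> s \<le> r \<Longrightarrow> c \<in> hseq s"
  and hsq_mono: "c \<in> hseq r \<Longrightarrow> s \<le> r \<Longrightarrow> hsq s c \<le> hsq r c"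
proof -
  have *: "s \<le> r \<Longrightarrow> wt s n * (cmod (c n))\<^sup>2 \<le> 1 * (wt r n * (cmod (c n))\<^sup>2)" for n
    by (simp add: mult_right_mono wt_mono)
  show "c \<in> hseq r \<Longrightarrow> s \<le> r \<Longrightarrow> c \<in> hseq s" "c \<in> hseq r \<Longrightarrow> s \<le> r \<Longrightarrow> hsq s c \<le> hsq r c"
    using hseq_dominated[of c r 1 s c] * by auto
qed

lemma hseq_scale: "c \<in> hseq s \<Longrightarrow> (\<lambda>n. z * c n) \<in> hseq s"
  and hsq_scale_le: "c \<in> hseq s \<Longrightarrow> hsq s (\<lambda>n. z * c n) \<le> (cmod z)\<^sup>2 * hsq s c"
  using hseq_dominated[of c s "(cmod z)\<^sup>2" s "\<lambda>n. z * c n"]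
  by (auto simp: norm_mult power_mult_distrib algebra_simps)

lemma hseq_cnj_reflect:
  assumes "c \<in> hseq s"
  shows "(\<lambda>n. cnj (c (- n))) \<in> hseq s"
proof -
  have "(\<Sum>n\<in>F. wt s n * (cmod (cnj (c (- n))))\<^sup>2) \<le> hsq s c" if "finite F" for F
  proof -
    have "(\<Sum>n\<in>F. wt s n * (cmod (cnj (c (- n))))\<^sup>2)
        = (\<Sum>n\<in>uminus ` F. wt s n * (cmod (c n))\<^sup>2)"
      by (subst sum.reindex) (auto simp: wt_def inj_on_def)
    also have "\<dots> \<le> hsq s c" using assms that by (intro hsq_ge_sum) auto
    finally show ?thesis .
  qed
  thus ?thesis by (rule hseqI)
qed

lemma cmod_add_sq: "(cmod (a + b))\<^sup>2 \<le> 2 * (cmod a)\<^sup>2 + 2 * (cmod b)\<^sup>2"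
proof -
  have "(cmod (a + b))\<^sup>2 \<le> (cmod a + cmod b)\<^sup>2" by (intro power_mono norm_triangle_ineq) auto
  also have "\<dots> \<le> 2 * (cmod a)\<^sup>2 + 2 * (cmod b)\<^sup>2"
    using zero_le_square[of "cmod a - cmod b"] by (simp add: power2_eq_square algebra_simps)
  finally show ?thesis .
qed

lemma hseq_add: "c \<in> hseq s \<Longrightarrow> d \<in> hseq s \<Longrightarrow> (\<lambda>n. c n + d n) \<in> hseq s"
  and hsq_add_le: "c \<in> hseq s \<Longrightarrow> d \<in> hseq s \<Longrightarrow>
     hsq s (\<lambda>n. c n + d n) \<le> 2 * hsq s c + 2 * hsq s d"
proof -
  have *: "(\<Sum>n\<in>F. wt s n * (cmod (c n + d n))\<^sup>2) \<le> 2 * hsq s c + 2 * hsq s d"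
    if c: "c \<in> hseq s" and d: "d \<in> hseq s" and "finite F" for F
  proof -
    have "(\<Sum>n\<in>F. wt s n * (cmod (c n + d n))\<^sup>2)
        \<le> (\<Sum>n\<in>F. 2 * (wt s n * (cmod (c n))\<^sup>2) + 2 * (wt s n * (cmod (d n))\<^sup>2))"
      using mult_left_mono[OF cmod_add_sq wt_nonneg, of s]
      by (intro sum_mono) (simp add: algebra_simps)
    also have "\<dots> \<le> 2 * hsq s c + 2 * hsq s d"
      unfolding sum.distrib sum_distrib_left [symmetric]
      by (intro add_mono mult_left_mono hsq_ge_sum that) auto
    finally show ?thesis .
  qed
  show "c \<in> hseq s \<Longrightarrow> d \<in> hseq s \<Longrightarrow> (\<lambda>n. c n + d n) \<in> hseq s"
    using hseqI(1)[OF *] by blast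
  show "c \<in> hseq s \<Longrightarrow> d \<in> hseq s \<Longrightarrow>
     hsq s (\<lambda>n. c n + d n) \<le> 2 * hsq s c + 2 * hsq s d"
    using hseqI(2)[OF *] by blast
qed

lemma hseq_diff: "c \<in> hseq s \<Longrightarrow> d \<in> hseq s \<Longrightarrow> (\<lambda>n. c n - d n) \<in> hseq s"
  and hsq_diff_le: "c \<in> hseq s \<Longrightarrow> d \<in> hseq s \<Longrightarrow>
     hsq s (\<lambda>n. c n - d n) \<le> 2 * hsq s c + 2 * hsq s d"
proof -
  have m: "d \<in> hseq s \<Longrightarrow> (\<lambda>n. - d n) \<in> hseq s" and h: "hsq s (\<lambda>n. - d n) = hsq s d"
    by (auto simp: hseq_def hsq_def)
  show "c \<in> hseq s \<Longrightarrow> d \<in> hseq s \<Longrightarrow> (\<lambda>n. c n - d n) \<in> hseq s"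
    using hseq_add[of c s "\<lambda>n. - d n"] m by simp
  show "c \<in> hseq s \<Longrightarrow> d \<in> hseq s \<Longrightarrow>
     hsq s (\<lambda>n. c n - d n) \<le> 2 * hsq s c + 2 * hsq s d"
    using hsq_add_le[of c s "\<lambda>n. - d n"] m h by simp
qed

lemma hsq_finite_support:
  assumes "\<And>n. \<bar>n\<bar> > int N \<Longrightarrow> c n = 0"
  shows "c \<in> hseq s" "hsq s c = (\<Sum>n\<in>{- int N..int N}. wt s n * (cmod (c n))\<^sup>2)"
proof -
  have "((\<lambda>n. wt s n * (cmod (c n))\<^sup>2) has_sum
      (\<Sum>n\<in>{- int N..int N}. wt s n * (cmod (c n))\<^sup>2)) UNIV"
    by (rule has_sum_finite_neutralI) (use assms in \<open>auto simp: not_le\<close>)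
  thus "c \<in> hseq s" "hsq s c = (\<Sum>n\<in>{- int N..int N}. wt s n * (cmod (c n))\<^sup>2)"
    unfolding hseq_def hsq_def by (auto simp: has_sum_iff)
qed

lemma hseq_trunc [simp]: "trunc N c \<in> hseq s"
  by (rule hsq_finite_support(1)[of N]) (simp add: trunc_def)

lemma hsq_trunc: "hsq s (trunc N c) = (\<Sum>n\<in>{- int N..int N}. wt s n * (cmod (c n))\<^sup>2)"
  by (subst hsq_finite_support(2)[of N]) (auto simp: trunc_def intro!: sum.cong)

lemma hsq_trunc_le: "c \<in> hseq s \<Longrightarrow> hsq s (trunc N c) \<le> hsq s c"
  by (simp add: hsq_trunc hsq_ge_sum)

text \<open>
  On frequencies up to \<open>N\<close>, each derivative costs at most a factor \<open>1 + N\<^sup>2\<close> in the squared norm. This is the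
  price that the existence proof pays for using rough data.
\<close>

lemma hsq_trunc_inverse:
  assumes "c \<in> hseq s"
  shows "hsq (s + r) (trunc N c) \<le> (1 + (real N)\<^sup>2) ^ r * hsq s c"
proof (rule hseq_dominated[OF assms])
  fix n
  show "wt (s + r) n * (cmod (trunc N c n))\<^sup>2 \<le> (1 + (real N)\<^sup>2) ^ r * (wt s n * (cmod (c n))\<^sup>2)"
  proof (cases "\<bar>n\<bar> \<le> int N")
    case True
    hence "(1 + (real_of_int n)\<^sup>2) ^ r \<le> (1 + (real N)\<^sup>2) ^ r"
      using abs_le_square_iff[of "real_of_int n" "real N"] by (intro power_mono) auto
    (* the factor r of the weight is the one that is estimated *)
    from mult_right_mono[OF this, of "wt s n * (cmod (c n))\<^sup>2"] True show ?thesis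
      by (simp add: wt_add trunc_def mult_ac) (simp add: wt_def mult_ac)
  qed (simp add: trunc_def)
qed simp

text \<open>
  Conversely, beyond the frequency \<open>N\<close> each additional derivative gains a factor \<open>1 / (1 + N\<^sup>2)\<close>.
\<close>

lemma hseq_tail:
  assumes "c \<in> hseq (Suc s)"
  shows "hsq s (\<lambda>n. c n - trunc N c n) \<le> hsq (Suc s) c / (1 + (real N)\<^sup>2)"
proof -
  have pos: "1 + (real N)\<^sup>2 > 0" by (simp add: add_pos_nonneg)
  have "hsq s (\<lambda>n. c n - trunc N c n) \<le> (1 / (1 + (real N)\<^sup>2)) * hsq (Suc s) c"
  proof (rule hseq_dominated[OF assms])
    fix n
    show "wt s n * (cmod (c n - trunc N c n))\<^sup>2
        \<le> 1 / (1 + (real N)\<^sup>2) * (wt (Suc s) n * (cmod (c n))\<^sup>2)"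
    proof (cases "\<bar>n\<bar> \<le> int N")
      case False
      hence "(1 + (real N)\<^sup>2) \<le> (1 + (real_of_int n)\<^sup>2)"
        using abs_le_square_iff[of "real N" "real_of_int n"] by (intro add_left_mono) auto
      from mult_right_mono[OF this, of "wt s n * (cmod (c n))\<^sup>2"] False pos show ?thesis
        by (simp add: wt_Suc trunc_def field_simps)
    qed (simp add: trunc_def)
  qed simp
  thus ?thesis by simp
qed

lemma hsq_tail_tendsto_0:
  assumes "c \<in> hseq s"
  shows "(\<lambda>N. hsq s (\<lambda>n. c n - trunc N c n)) \<longlonglongrightarrow> 0"
proof (rule LIMSEQ_I)
  fix e :: real assume "e > 0"
  let ?f = "\<lambda>n. wt s n * (cmod (c n))\<^sup>2"
  have sm: "?f summable_on UNIV" using assms by (simp add: hseq_def)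
  obtain F where F: "finite F" and lt: "hsq s c - e / 2 < sum ?f F"
  proof -
    have "\<not> (\<forall>F. finite F \<and> F \<subseteq> UNIV \<longrightarrow> sum ?f F \<le> hsq s c - e / 2)"
      using infsum_le_finite_sums[OF sm, of "hsq s c - e / 2"] \<open>e > 0\<close> unfolding hsq_def by fastforce
    thus ?thesis using that by (auto simp: not_le)
  qed
  obtain N0 where N0: "\<forall>n\<in>F. \<bar>n\<bar> \<le> int N0"
  proof
    show "\<forall>n\<in>F. \<bar>n\<bar> \<le> int (\<Sum>n\<in>F. nat \<bar>n\<bar>)"
    proof
      fix n assume "n \<in> F"
      hence "nat \<bar>n\<bar> \<le> (\<Sum>n\<in>F. nat \<bar>n\<bar>)" using F by (intro member_le_sum) auto
      thus "\<bar>n\<bar> \<le> int (\<Sum>n\<in>F. nat \<bar>n\<bar>)" by linarith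
    qed
  qed
  have "hsq s (\<lambda>n. c n - trunc N c n) < e" if "N \<ge> N0" for N
  proof -
    have "hsq s (\<lambda>n. c n - trunc N c n) \<le> e / 2"
    proof (rule hseqI(2))
      fix G :: "int set" assume "finite G"
      have z: "wt s n * (cmod (c n - trunc N c n))\<^sup>2 = 0" if "n \<in> F" for n
        using N0 that \<open>N \<ge> N0\<close> by (fastforce simp: trunc_def)
      have "(\<Sum>n\<in>G. wt s n * (cmod (c n - trunc N c n))\<^sup>2)
          = (\<Sum>n\<in>G - F. wt s n * (cmod (c n - trunc N c n))\<^sup>2)"
        using \<open>finite G\<close> z by (intro sum.mono_neutral_right) auto
      also have "\<dots> \<le> (\<Sum>n\<in>G - F. ?f n)"
        by (intro sum_mono) (simp add: trunc_def)
      also have "\<dots> = (\<Sum>n\<in>G \<union> F. ?f n) - sum ?f F"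
        using F \<open>finite G\<close> sum.union_disjoint[of "G - F" F ?f]
        by (simp add: Un_Diff_cancel2 Diff_disjoint Int_commute)
      also have "\<dots> \<le> e / 2"
        using hsq_ge_sum[OF assms, of "G \<union> F"] F \<open>finite G\<close> lt by simp
      finally show "(\<Sum>n\<in>G. wt s n * (cmod (c n - trunc N c n))\<^sup>2) \<le> e / 2" .
    qed
    thus ?thesis using \<open>e > 0\<close> by linarith
  qed
  thus "\<exists>N0. \<forall>N\<ge>N0. norm (hsq s (\<lambda>n. c n - trunc N c n) - 0) < e" by auto
qed

definition inv_sq_sum :: real where
  "inv_sq_sum = (\<Sum>\<^sub>\<infinity>n::int. 1 / (1 + (of_int n)\<^sup>2))"

lemma inv_sq_summable: "(\<lambda>n::int. 1 / (1 + (real_of_int n)\<^sup>2)) summable_on UNIV"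
proof -
  let ?f = "\<lambda>n::int. 1 / (1 + (real_of_int n)\<^sup>2)"
  have nat: "(\<lambda>n. 1 / (1 + (real n)\<^sup>2)) summable_on UNIV"
  proof (rule norm_summable_imp_summable_on, rule summable_comparison_test_ev)
    show "\<forall>\<^sub>F n in sequentially. norm (norm (1 / (1 + (real n)\<^sup>2))) \<le> inverse (real n ^ 2)"
      by (intro eventually_sequentiallyI[of 1]) (auto simp: field_simps add_pos_nonneg)
    show "summable (\<lambda>n. inverse (real n ^ 2))" by (rule inverse_power_summable) simp
  qed
  have "?f summable_on range int"
    by (subst summable_on_reindex) (use nat in \<open>auto simp: o_def\<close>)
  moreover have "?f summable_on range (\<lambda>n. - int n)"
    by (subst summable_on_reindex) (use nat in \<open>auto simp: o_def inj_on_def\<close>)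
  ultimately have "?f summable_on (range int \<union> range (\<lambda>n. - int n))"
    by (rule summable_on_union)
  moreover have "range int \<union> range (\<lambda>n. - int n) = UNIV"
    by (auto, metis int_cases2 rangeI)
  ultimately show ?thesis by simp
qed

lemma inv_sq_sum_nonneg: "inv_sq_sum \<ge> 0"
  unfolding inv_sq_sum_def by (intro infsum_nonneg) (simp add: add_nonneg_nonneg)

text \<open>
  Cauchy-Schwarz against the summable family \<open>1 / (1 + n\<^sup>2)\<close>. The three instances used are \<open>r n = 1\<close>
  (absolute convergence of the series), \<open>r n = \<bar>n\<bar>\<close> (of its derivative) and
  \<open>r n = 1 / \<bar>n\<bar>\<close> (the mean value of the velocity).
\<close>

lemma weighted_l1:
  assumes c: "c \<in> hseq s" and R: "R \<ge> 0"
    and r: "\<And>n. (r n)\<^sup>2 * (1 + (of_int n)\<^sup>2) \<le> R * wt s n"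
  shows "(\<lambda>n. cmod (r n * c n)) summable_on UNIV"
    and "(\<Sum>\<^sub>\<infinity>n. cmod (r n * c n))\<^sup>2 \<le> R * inv_sq_sum * hsq s c"
proof -
  let ?B = "R * inv_sq_sum * hsq s c"
  have B: "?B \<ge> 0" using R inv_sq_sum_nonneg by simp
  have *: "(\<Sum>n\<in>F. cmod (r n * c n)) \<le> sqrt ?B" if F: "finite F" for F
  proof (rule real_le_rsqrt)
    let ?q = "\<lambda>n::int. sqrt (1 + (real_of_int n)\<^sup>2)"
    have q: "?q n > 0" for n by (simp add: add_pos_nonneg)
    have q2: "(?q n)\<^sup>2 = 1 + (real_of_int n)\<^sup>2" for n by simp
    have "(\<Sum>n\<in>F. cmod (r n * c n)) = (\<Sum>n\<in>F. (1 / ?q n) * (?q n * cmod (r n * c n)))"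
      by (intro sum.cong refl) (use q in \<open>simp add: less_imp_neq[THEN not_sym]\<close>)
    hence "(\<Sum>n\<in>F. cmod (r n * c n))\<^sup>2 \<le>
        (\<Sum>n\<in>F. (1 / ?q n)\<^sup>2) * (\<Sum>n\<in>F. (?q n * cmod (r n * c n))\<^sup>2)"
      by (simp only: Cauchy_Schwarz_ineq_sum)
    also have "\<dots> \<le> inv_sq_sum * (R * hsq s c)"
    proof (intro mult_mono inv_sq_sum_nonneg sum_nonneg zero_le_power2)
      show "(\<Sum>n\<in>F. (1 / ?q n)\<^sup>2) \<le> inv_sq_sum"
        unfolding inv_sq_sum_def power_divide q2 using F
        by (simp, intro finite_sum_le_infsum inv_sq_summable) (auto simp: add_nonneg_nonneg)
      have "(\<Sum>n\<in>F. (?q n * cmod (r n * c n))\<^sup>2) \<le> (\<Sum>n\<in>F. R * (wt s n * (cmod (c n))\<^sup>2))"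
      proof (rule sum_mono)
        fix n
        have "(?q n * cmod (r n * c n))\<^sup>2 = ((r n)\<^sup>2 * (1 + (of_int n)\<^sup>2)) * (cmod (c n))\<^sup>2"
          unfolding power_mult_distrib q2 norm_mult by simp
        also have "\<dots> \<le> (R * wt s n) * (cmod (c n))\<^sup>2" by (intro mult_right_mono r) simp
        finally show "(?q n * cmod (r n * c n))\<^sup>2 \<le> R * (wt s n * (cmod (c n))\<^sup>2)" by simp
      qed
      also have "\<dots> \<le> R * hsq s c"
        unfolding sum_distrib_left [symmetric] by (intro mult_left_mono hsq_ge_sum c F R)
      finally show "(\<Sum>n\<in>F. (?q n * cmod (r n * c n))\<^sup>2) \<le> R * hsq s c" .
    qed
    finally show "(\<Sum>n\<in>F. cmod (r n * c n))\<^sup>2 \<le> ?B" by (simp add: mult_ac)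
  qed
  show sm: "(\<lambda>n. cmod (r n * c n)) summable_on UNIV"
    by (rule nonneg_bdd_above_summable_on) (auto intro!: bdd_aboveI2[of _ _ "sqrt ?B"] *)
  have "(\<Sum>\<^sub>\<infinity>n. cmod (r n * c n)) \<le> sqrt ?B"
    by (rule infsum_le_finite_sums[OF sm]) (use * in auto)
  hence "(\<Sum>\<^sub>\<infinity>n. cmod (r n * c n))\<^sup>2 \<le> (sqrt ?B)\<^sup>2"
    by (intro power_mono infsum_nonneg) auto
  thus "(\<Sum>\<^sub>\<infinity>n. cmod (r n * c n))\<^sup>2 \<le> ?B" using B by simp
qed

lemma hseq_1_l1:
  assumes "c \<in> hseq 1"
  shows "(\<lambda>n. cmod (c n)) summable_on UNIV" "(\<Sum>\<^sub>\<infinity>n. cmod (c n))\<^sup>2 \<le> inv_sq_sum * hsq 1 c"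
  using weighted_l1[OF assms, of 1 "\<lambda>_. 1"] by (auto simp: wt_def)

lemma hseq_2_l1:
  assumes "c \<in> hseq 2"
  shows "(\<lambda>n. cmod (of_int n * c n)) summable_on UNIV"
proof -
  have "(\<lambda>n. cmod (complex_of_real (of_int n) * c n)) summable_on UNIV"
  proof (rule weighted_l1[OF assms, of 1])
    fix n
    show "(of_int n)\<^sup>2 * (1 + (real_of_int n)\<^sup>2) \<le> 1 * wt 2 n"
      by (simp add: wt_def power2_eq_square[of "1 + _"] mult_right_mono)
  qed simp
  thus ?thesis by simp
qed

section \<open>The operator on Fourier coefficients\<close>

text \<open>
  The operator \<open>L\<close> sends the mode \<open>k\<close> to the modes \<open>k + 2\<close> and \<open>k - 2\<close> with the coefficients \<open>shift_coeff k\<close>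
  and \<open>shift_coeff (- k)\<close>. The four terms come from \<open>1/2 sin 2\<theta> \<partial>\<^sub>\<theta>\<eta>\<close>, \<open>- cos 2\<theta> \<eta>\<close>,
  \<open>sin 2\<theta> H\<eta>\<close> and \<open>- 2 cos 2\<theta> v\<close>. At \<open>k = 0\<close> the last one is \<open>1 / 0 = 0\<close>, as it should be, since
  the mean of \<open>v\<close> is not determined by the mean of \<open>\<eta>\<close>.
\<close>

definition shift_coeff :: "int \<Rightarrow> real" where
  "shift_coeff k = of_int k / 4 - 1 / 2 - of_int (sgn k) / 2 + 1 / of_int \<bar>k\<bar>"

text \<open>
  The mean of \<open>v\<close>: the other coefficients of \<open>v\<close> are \<open>- c k / \<bar>k\<bar>\<close>, and \<open>v 0\<close>, the sum of all
  coefficients, vanishes.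
\<close>

definition vsum :: "(int \<Rightarrow> complex) \<Rightarrow> complex" where
  "vsum c = (\<Sum>\<^sub>\<infinity>k. c k / of_int \<bar>k\<bar>)"

definition Lseq :: "(int \<Rightarrow> complex) \<Rightarrow> int \<Rightarrow> complex" where
  "Lseq c n = of_real (shift_coeff (n - 2)) * c (n - 2) + of_real (shift_coeff (- n - 2)) * c (n + 2) - (if \<bar>n\<bar> = 2 then vsum c else 0)"

lemma shift_coeff_split: "\<bar>shift_coeff k - of_int k / 4\<bar> \<le> 2"
proof (cases "k = 0")
  case False
  hence "\<bar>k\<bar> \<ge> 1" by simp
  hence "real_of_int \<bar>k\<bar> \<ge> 1" by linarith
  hence "1 / real_of_int \<bar>k\<bar> \<le> 1" "1 / real_of_int \<bar>k\<bar> \<ge> 0" by simp_all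
  moreover have "\<bar>real_of_int (sgn k)\<bar> \<le> 1" by (simp add: sgn_if)
  ultimately show ?thesis unfolding shift_coeff_def by linarith
qed (simp add: shift_coeff_def)

lemma shift_coeff_sq_le: "(shift_coeff k)\<^sup>2 \<le> 8 * (1 + (of_int k)\<^sup>2)"
proof -
  have "\<bar>shift_coeff k\<bar> \<le> \<bar>of_int k\<bar> / 4 + 2" using shift_coeff_split[of k] by linarith
  hence "(shift_coeff k)\<^sup>2 \<le> (\<bar>of_int k\<bar> / 4 + 2)\<^sup>2" by (metis abs_ge_zero power2_abs power_mono)
  also have "\<dots> \<le> 2 * (\<bar>of_int k\<bar> / 4)\<^sup>2 + 2 * 2\<^sup>2"
    using zero_le_square[of "\<bar>of_int k\<bar> / 4 - (2::real)"] by (simp add: power2_eq_square algebra_simps)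
  also have "\<dots> \<le> 8 * (1 + (of_int k)\<^sup>2)" by (simp add: power_divide)
  finally show ?thesis .
qed

lemma vsum_summable:
  assumes "c \<in> hseq 0"
  shows "(\<lambda>k. cmod (c k / of_int \<bar>k\<bar>)) summable_on UNIV"
    and "(\<lambda>k. c k / of_int \<bar>k\<bar>) summable_on UNIV"
    and vsum_bound: "(cmod (vsum c))\<^sup>2 \<le> 2 * inv_sq_sum * hsq 0 c"
proof -
  have r: "(1 / of_int \<bar>n\<bar>)\<^sup>2 * (1 + (real_of_int n)\<^sup>2) \<le> 2 * wt 0 n" for n
  proof (cases "n = 0")
    case False
    hence "1 \<le> n\<^sup>2" by (metis int_one_le_iff_zero_less zero_less_power2)
    hence "1 \<le> (real_of_int n)\<^sup>2" by (metis of_int_1_le_iff of_int_power)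
    thus ?thesis using False by (simp add: power_divide field_simps)
  qed simp
  have eq: "complex_of_real (1 / of_int \<bar>n\<bar>) * c n = c n / of_int \<bar>n\<bar>" for n
    by (simp del: of_int_abs)
  note w = weighted_l1[OF assms, of 2 "\<lambda>n. 1 / of_int \<bar>n\<bar>", OF _ r, unfolded eq, simplified]
  show a: "(\<lambda>k. cmod (c k / of_int \<bar>k\<bar>)) summable_on UNIV" using w(1) by (simp add: norm_divide)
  show "(\<lambda>k. c k / of_int \<bar>k\<bar>) summable_on UNIV"
    by (rule abs_summable_summable) (rule a)
  have "cmod (vsum c) \<le> (\<Sum>\<^sub>\<infinity>k. cmod (c k / of_int \<bar>k\<bar>))"
    unfolding vsum_def by (rule norm_infsum_bound) (rule a)
  hence "(cmod (vsum c))\<^sup>2 \<le> (\<Sum>\<^sub>\<infinity>k. cmod (c k / of_int \<bar>k\<bar>))\<^sup>2" by (rule power_mono) simp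
  also have "\<dots> \<le> 2 * inv_sq_sum * hsq 0 c" using w(2) by (simp add: norm_divide)
  finally show "(cmod (vsum c))\<^sup>2 \<le> 2 * inv_sq_sum * hsq 0 c" .
qed

lemma vsum_diff:
  assumes "c \<in> hseq 0" "d \<in> hseq 0"
  shows "vsum (\<lambda>n. c n - d n) = vsum c - vsum d"
proof -
  have "((\<lambda>k. c k / of_int \<bar>k\<bar> + - (d k / of_int \<bar>k\<bar>)) has_sum (vsum c + - vsum d)) UNIV"
    unfolding vsum_def
    by (intro has_sum_add has_sum_uminusI has_sum_infsum vsum_summable assms)
  thus ?thesis unfolding vsum_def[of "\<lambda>n. c n - d n"]
    by (intro infsumI) (simp add: diff_divide_distrib)
qed

lemma Lseq_diff:
  assumes "c \<in> hseq 0" "d \<in> hseq 0"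
  shows "Lseq (\<lambda>n. c n - d n) n = Lseq c n - Lseq d n"
  unfolding Lseq_def vsum_diff[OF assms] by (simp add: algebra_simps)

text \<open>
  Single entries of \<open>Lseq c\<close> depend continuously on \<open>c\<close> even without weights. This allows passing to the
  limit in the equation entry by entry.
\<close>

lemma Lseq_coord_bound:
  obtains B where "B \<ge> 0" "\<And>d. d \<in> hseq 0 \<Longrightarrow> cmod (Lseq d n) \<le> B * sqrt (hsq 0 d)"
proof -
  define B where "B = \<bar>shift_coeff (n - 2)\<bar> + \<bar>shift_coeff (- n - 2)\<bar> + sqrt (2 * inv_sq_sum)"
  have "cmod (Lseq d n) \<le> B * sqrt (hsq 0 d)" if d: "d \<in> hseq 0" for d
  proof -
    have t: "cmod (d k) \<le> sqrt (hsq 0 d)" for k by (rule real_le_rsqrt) (rule hsq_ge_term[OF d])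
    have v: "cmod (vsum d) \<le> sqrt (2 * inv_sq_sum) * sqrt (hsq 0 d)"
      unfolding real_sqrt_mult [symmetric] by (rule real_le_rsqrt) (use vsum_bound[OF d] in simp)
    have "cmod (Lseq d n) \<le> cmod (of_real (shift_coeff (n - 2)) * d (n - 2)) + cmod (of_real (shift_coeff (- n - 2)) * d (n + 2))
        + cmod (if \<bar>n\<bar> = 2 then vsum d else 0)"
      unfolding Lseq_def by (intro order_trans[OF norm_triangle_ineq4] add_mono norm_triangle_ineq order_refl)
    also have "\<dots> \<le> \<bar>shift_coeff (n - 2)\<bar> * sqrt (hsq 0 d) + \<bar>shift_coeff (- n - 2)\<bar> * sqrt (hsq 0 d)
        + sqrt (2 * inv_sq_sum) * sqrt (hsq 0 d)"
      unfolding norm_mult norm_of_real using v inv_sq_sum_nonneg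
      by (intro add_mono mult_left_mono t) auto
    finally show ?thesis by (simp add: B_def algebra_simps)
  qed
  moreover have "B \<ge> 0" using inv_sq_sum_nonneg by (simp add: B_def)
  ultimately show thesis using that by blast
qed

lemma Lseq_scale: "Lseq (\<lambda>n. z * c n) n = z * Lseq c n"
proof -
  have "vsum (\<lambda>n. z * c n) = z * vsum c"
    unfolding vsum_def times_divide_eq_right [symmetric] by (rule infsum_cmult_right')
  thus ?thesis by (simp add: Lseq_def algebra_simps)
qed

lemma Lseq_add:
  assumes "c \<in> hseq 0" "d \<in> hseq 0"
  shows "Lseq (\<lambda>n. c n + d n) n = Lseq c n + Lseq d n"
  using Lseq_diff[OF assms(1) hseq_scale[OF assms(2), of "- 1"], of n] Lseq_scale[of "- 1" d n] by simp

lemma Lseq_sum: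
  assumes "finite F" "\<And>k. k \<in> F \<Longrightarrow> d k \<in> hseq 0"
  shows "(\<lambda>n. \<Sum>k\<in>F. d k n) \<in> hseq 0 \<and> Lseq (\<lambda>n. \<Sum>k\<in>F. d k n) n = (\<Sum>k\<in>F. Lseq (d k) n)"
  using assms
proof (induction F rule: finite_induct)
  case empty
  show ?case using Lseq_scale[of 0 "\<lambda>_. 0" n] by (simp add: hseq_def)
next
  case (insert k F)
  thus ?case using hseq_add[of "d k" 0] Lseq_add[of "d k" _ n] by simp
qed

lemma Lseq_trunc:
  "Lseq (trunc N c) n = (\<Sum>k\<in>{- int N..int N}. Lseq (\<lambda>j. if j = k then 1 else 0) n * c k)"
proof -
  let ?\<delta> = "\<lambda>k j. if j = k then (1::complex) else 0"
  have \<delta>: "?\<delta> k \<in> hseq 0" for k by (rule hsq_finite_support(1)[of "nat \<bar>k\<bar>"]) auto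
  have "trunc N c = (\<lambda>j. \<Sum>k\<in>{- int N..int N}. c k * ?\<delta> k j)"
    by (rule ext) (auto simp: trunc_def if_distrib cong: if_cong)
  hence "Lseq (trunc N c) n = (\<Sum>k\<in>{- int N..int N}. Lseq (\<lambda>j. c k * ?\<delta> k j) n)"
    using Lseq_sum[of "{- int N..int N}" "\<lambda>k j. c k * ?\<delta> k j" n] hseq_scale[OF \<delta>] by simp
  thus ?thesis by (simp add: Lseq_scale mult.commute)
qed

text \<open>
  The matrix is real and symmetric under \<open>n \<mapsto> - n\<close>, so \<open>L\<close> commutes with the involution whose fixed points
  are the coefficients of real functions.
\<close>

lemma Lseq_cnj_reflect: "Lseq (\<lambda>n. cnj (c (- n))) n = cnj (Lseq c (- n))"
proof -
  have "vsum (\<lambda>n. cnj (c (- n))) = (\<Sum>\<^sub>\<infinity>k. cnj (c (- k) / of_int \<bar>- k\<bar>))"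
    by (simp add: vsum_def)
  also have "\<dots> = cnj (\<Sum>\<^sub>\<infinity>k. c (- k) / of_int \<bar>- k\<bar>)" by (rule infsum_cnj)
  also have "(\<Sum>\<^sub>\<infinity>k. c (- k) / of_int \<bar>- k\<bar>) = vsum c" unfolding vsum_def
    by (rule infsum_reindex_bij_betw[of uminus UNIV UNIV "\<lambda>k. c k / of_int \<bar>k\<bar>"])
       (auto intro: bij_uminus)
  finally have "vsum (\<lambda>n. cnj (c (- n))) = cnj (vsum c)" .
  moreover have "- (n - 2) = - n + 2" "- (n + 2) = - n - 2" "- (- n) - 2 = n - 2" by simp_all
  ultimately show ?thesis unfolding Lseq_def by (simp add: algebra_simps)
qed

lemma hseq_shift:
  assumes c: "c \<in> hseq s" and j: "\<bar>j\<bar> \<le> 2"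
  shows "(\<lambda>n. c (n + j)) \<in> hseq s" "hsq s (\<lambda>n. c (n + j)) \<le> 9 ^ s * hsq s c"
proof -
  have "(\<Sum>n\<in>F. wt s n * (cmod (c (n + j)))\<^sup>2) \<le> 9 ^ s * hsq s c" if F: "finite F" for F
  proof -
    have "(\<Sum>n\<in>F. wt s n * (cmod (c (n + j)))\<^sup>2) \<le> (\<Sum>n\<in>F. 9 ^ s * (wt s (n + j) * (cmod (c (n + j)))\<^sup>2))"
      using j by (intro sum_mono) (simp add: mult.assoc [symmetric] mult_right_mono wt_shift)
    also have "\<dots> = 9 ^ s * (\<Sum>n\<in>(\<lambda>n. n + j) ` F. wt s n * (cmod (c n))\<^sup>2)"
      by (subst sum.reindex) (auto simp: sum_distrib_left)
    also have "\<dots> \<le> 9 ^ s * hsq s c" using c F by (intro mult_left_mono hsq_ge_sum) auto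
    finally show ?thesis .
  qed
  from hseqI[OF this] show "(\<lambda>n. c (n + j)) \<in> hseq s" "hsq s (\<lambda>n. c (n + j)) \<le> 9 ^ s * hsq s c"
    by blast+
qed

text \<open>
  \<open>L\<close> loses one derivative, because its entries grow linearly.
\<close>

lemma Lseq_bound:
  obtains C where "C \<ge> 0" and "\<And>c. c \<in> hseq (Suc s) \<Longrightarrow> Lseq c \<in> hseq s"
    and "\<And>c. c \<in> hseq (Suc s) \<Longrightarrow> hsq s (Lseq c) \<le> C * hsq (Suc s) c"
proof -
  define C where "C = 64 * 9 ^ s + 8 * 5 ^ s * inv_sq_sum"
  have "Lseq c \<in> hseq s \<and> hsq s (Lseq c) \<le> C * hsq (Suc s) c" if c: "c \<in> hseq (Suc s)" for c
  proof -
    let ?V = "2 * inv_sq_sum * hsq 0 c"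
    have c0: "c \<in> hseq 0" using c by (rule hseq_mono) simp
    have mul: "(\<lambda>n. of_real (shift_coeff (m n)) * c n) \<in> hseq s \<and> hsq s (\<lambda>n. of_real (shift_coeff (m n)) * c n) \<le> 8 * hsq (Suc s) c"
      if m: "\<And>n. \<bar>m n\<bar> = \<bar>n\<bar>" for m
    proof -
      have "wt s n * (cmod (of_real (shift_coeff (m n)) * c n))\<^sup>2 \<le> 8 * (wt (Suc s) n * (cmod (c n))\<^sup>2)" for n
      proof -
        have "(real_of_int (m n))\<^sup>2 = (real_of_int n)\<^sup>2"
          using m[of n] by (metis of_int_abs power2_abs)
        hence "(shift_coeff (m n))\<^sup>2 \<le> 8 * (1 + (of_int n)\<^sup>2)" using shift_coeff_sq_le[of "m n"] by simp
        from mult_right_mono[OF this, of "wt s n * (cmod (c n))\<^sup>2"] show ?thesis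
          by (simp add: norm_mult power_mult_distrib wt_Suc algebra_simps)
      qed
      thus ?thesis using hseq_dominated[OF c, of 8 s] by simp
    qed
    have p1: "(\<lambda>n. of_real (shift_coeff (n - 2)) * c (n - 2)) \<in> hseq s"
      "hsq s (\<lambda>n. of_real (shift_coeff (n - 2)) * c (n - 2)) \<le> 9 ^ s * (8 * hsq (Suc s) c)"
    proof -
      from mul[of "\<lambda>n. n"] have m: "(\<lambda>n. of_real (shift_coeff n) * c n) \<in> hseq s" "hsq s (\<lambda>n. of_real (shift_coeff n) * c n) \<le> 8 * hsq (Suc s) c"
        by auto
      show "(\<lambda>n. of_real (shift_coeff (n - 2)) * c (n - 2)) \<in> hseq s" using hseq_shift(1)[OF m(1), of "- 2"] by simp
      have "hsq s (\<lambda>n. of_real (shift_coeff (n - 2)) * c (n - 2)) \<le> 9 ^ s * hsq s (\<lambda>n. of_real (shift_coeff n) * c n)"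
        using hseq_shift(2)[OF m(1), of "- 2"] by simp
      also have "\<dots> \<le> 9 ^ s * (8 * hsq (Suc s) c)" by (intro mult_left_mono m) simp
      finally show "hsq s (\<lambda>n. of_real (shift_coeff (n - 2)) * c (n - 2)) \<le> 9 ^ s * (8 * hsq (Suc s) c)" .
    qed
    have p2: "(\<lambda>n. of_real (shift_coeff (- n - 2)) * c (n + 2)) \<in> hseq s"
      "hsq s (\<lambda>n. of_real (shift_coeff (- n - 2)) * c (n + 2)) \<le> 9 ^ s * (8 * hsq (Suc s) c)"
    proof -
      from mul[of "\<lambda>n. - n"] have m: "(\<lambda>n. of_real (shift_coeff (- n)) * c n) \<in> hseq s" "hsq s (\<lambda>n. of_real (shift_coeff (- n)) * c n) \<le> 8 * hsq (Suc s) c"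
        by auto
      show "(\<lambda>n. of_real (shift_coeff (- n - 2)) * c (n + 2)) \<in> hseq s" using hseq_shift(1)[OF m(1), of 2] by simp
      have "hsq s (\<lambda>n. of_real (shift_coeff (- n - 2)) * c (n + 2)) \<le> 9 ^ s * hsq s (\<lambda>n. of_real (shift_coeff (- n)) * c n)"
        using hseq_shift(2)[OF m(1), of 2] by simp
      also have "\<dots> \<le> 9 ^ s * (8 * hsq (Suc s) c)" by (intro mult_left_mono m) simp
      finally show "hsq s (\<lambda>n. of_real (shift_coeff (- n - 2)) * c (n + 2)) \<le> 9 ^ s * (8 * hsq (Suc s) c)" .
    qed
    let ?d = "\<lambda>n::int. if \<bar>n\<bar> = 2 then vsum c else 0"
    have p3: "?d \<in> hseq s" "hsq s ?d \<le> 2 * 5 ^ s * ?V"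
    proof -
      have *: "?d \<in> hseq s \<and> hsq s ?d = (\<Sum>n\<in>{- int 2..int 2}. wt s n * (cmod (?d n))\<^sup>2)"
        by (intro conjI hsq_finite_support) auto
      have "{- int 2..int 2} = {-2,-1,0,1,2}" by auto
      hence "hsq s ?d = 2 * 5 ^ s * (cmod (vsum c))\<^sup>2" using * by (simp add: wt_def)
      also have "\<dots> \<le> 2 * 5 ^ s * ?V" by (intro mult_left_mono vsum_bound c0) simp
      finally show "hsq s ?d \<le> 2 * 5 ^ s * ?V" .
      show "?d \<in> hseq s" using * by blast
    qed
    let ?e = "\<lambda>n. of_real (shift_coeff (n - 2)) * c (n - 2) + of_real (shift_coeff (- n - 2)) * c (n + 2)"
    have e: "?e \<in> hseq s" by (rule hseq_add[OF p1(1) p2(1)])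
    have L: "Lseq c = (\<lambda>n. ?e n - ?d n)" by (simp add: Lseq_def fun_eq_iff)
    have arith: "x \<le> 2 * (2 * A + 2 * A) + 2 * W"
      if "x \<le> 2 * y + 2 * w" "y \<le> 2 * a + 2 * b" "a \<le> A" "b \<le> A" "w \<le> W" for x y w a b A W :: real
      using that by (simp add: algebra_simps)
    have "hsq s (Lseq c) \<le> 2 * (2 * (9 ^ s * (8 * hsq (Suc s) c)) + 2 * (9 ^ s * (8 * hsq (Suc s) c)))
        + 2 * (2 * 5 ^ s * ?V)"
      unfolding L
      by (rule arith[OF hsq_diff_le[OF e p3(1)] hsq_add_le[OF p1(1) p2(1)] p1(2) p2(2) p3(2)])
    also have "\<dots> = 64 * 9 ^ s * hsq (Suc s) c + 8 * 5 ^ s * inv_sq_sum * hsq 0 c" by simp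
    also have "\<dots> \<le> 64 * 9 ^ s * hsq (Suc s) c + 8 * 5 ^ s * inv_sq_sum * hsq (Suc s) c"
      using hsq_mono[OF c, of 0] inv_sq_sum_nonneg by (intro add_left_mono mult_left_mono) auto
    also have "\<dots> = C * hsq (Suc s) c" by (simp add: C_def algebra_simps)
    finally show ?thesis using hseq_diff[OF e p3(1)] unfolding L by blast
  qed
  moreover have "C \<ge> 0" unfolding C_def using inv_sq_sum_nonneg by simp
  ultimately show thesis using that by blast
qed

lemma hseq_Lseq: "c \<in> hseq (Suc s) \<Longrightarrow> Lseq c \<in> hseq s"
  by (rule Lseq_bound[of s]) auto

section \<open>Energy estimates\<close>

text \<open>
  Neighbouring weights differ by a relative amount \<open>O(1 / \<bar>n\<bar>)\<close>; by induction on \<open>s\<close> from the identity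
  \<open>(1 + n\<^sup>2) - (1 + (n - 2)\<^sup>2) = 4 * n - 4\<close>.
\<close>

lemma wt_difference:
  obtains C where "C \<ge> 0" and "\<And>n. \<bar>wt s n - wt s (n - 2)\<bar> * \<bar>of_int n\<bar> \<le> C * wt s n"
proof -
  have "\<exists>C\<ge>0. \<forall>n. \<bar>wt s n - wt s (n - 2)\<bar> * \<bar>of_int n\<bar> \<le> C * wt s n"
  proof (induction s)
    case 0
    show ?case by (intro exI[of _ 0]) simp
  next
    case (Suc s)
    then obtain C where C: "C \<ge> 0" "\<And>n. \<bar>wt s n - wt s (n - 2)\<bar> * \<bar>of_int n\<bar> \<le> C * wt s n" by auto
    have "\<bar>wt (Suc s) n - wt (Suc s) (n - 2)\<bar> * \<bar>of_int n\<bar> \<le> (8 + 9 * C) * wt (Suc s) n" for n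
    proof -
      let ?q = "\<lambda>n::int. 1 + (real_of_int n)\<^sup>2"
      have d: "?q n - ?q (n - 2) = 4 * of_int n - 4" by (simp add: power2_eq_square algebra_simps)
      have "wt (Suc s) n - wt (Suc s) (n - 2)
          = (?q n - ?q (n - 2)) * wt s n + ?q (n - 2) * (wt s n - wt s (n - 2))"
        by (simp only: wt_Suc) (simp add: algebra_simps)
      hence "\<bar>wt (Suc s) n - wt (Suc s) (n - 2)\<bar>
          \<le> \<bar>4 * real_of_int n - 4\<bar> * wt s n + ?q (n - 2) * \<bar>wt s n - wt s (n - 2)\<bar>"
        unfolding d using abs_triangle_ineq[of "(4 * of_int n - 4) * wt s n" "?q (n - 2) * (wt s n - wt s (n - 2))"]
        by (simp add: abs_mult add_nonneg_nonneg)
      hence "\<bar>wt (Suc s) n - wt (Suc s) (n - 2)\<bar> * \<bar>of_int n\<bar>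
          \<le> (\<bar>4 * real_of_int n - 4\<bar> * wt s n + ?q (n - 2) * \<bar>wt s n - wt s (n - 2)\<bar>) * \<bar>of_int n\<bar>"
        by (rule mult_right_mono) simp
      also have "\<dots> = (\<bar>4 * real_of_int n - 4\<bar> * \<bar>of_int n\<bar>) * wt s n
          + ?q (n - 2) * (\<bar>wt s n - wt s (n - 2)\<bar> * \<bar>of_int n\<bar>)"
        by (simp add: algebra_simps)
      also have "\<dots> \<le> (8 * ?q n) * wt s n + (9 * ?q n) * (C * wt s n)"
      proof -
        have "\<bar>4 * real_of_int n - 4\<bar> * \<bar>of_int n\<bar> \<le> (4 * \<bar>real_of_int n\<bar> + 4) * \<bar>of_int n\<bar>"
          by (intro mult_right_mono) auto
        also have "\<dots> \<le> 8 * ?q n"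
          using zero_le_square[of "\<bar>real_of_int n\<bar> - 1"] zero_le_square[of "real_of_int n"]
          by (simp add: power2_eq_square algebra_simps)
        finally have 1: "\<bar>4 * real_of_int n - 4\<bar> * \<bar>of_int n\<bar> \<le> 8 * ?q n" .
        have 2: "?q (n - 2) \<le> 9 * ?q n" using wt_shift[of "n - 2" n 1] by (simp add: wt_def)
        show ?thesis
          by (intro add_mono mult_right_mono[OF 1] mult_mono[OF 2 C(2)]) (auto simp: add_nonneg_nonneg)
      qed
      also have "\<dots> = (8 + 9 * C) * wt (Suc s) n" by (simp add: wt_Suc algebra_simps)
      finally show ?thesis .
    qed
    thus ?case using C(1) by (intro exI[of _ "8 + 9 * C"]) auto
  qed
  thus thesis using that by blast
qed

text \<open>
  The entries \<open>(n, n - 2)\<close> and \<open>(n - 2, n)\<close> of the weighted matrix are about \<open>n / 4\<close> and \<open>- n / 4\<close> times a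
  weight. In their sum the growing parts cancel, up to the difference of the two weights.
\<close>

lemma skew_commutator:
  obtains D where "D \<ge> 0"
    and "\<And>n. \<bar>wt s n * shift_coeff (n - 2) + wt s (n - 2) * shift_coeff (- n)\<bar> \<le> D * wt s n"
proof -
  obtain C where C: "C \<ge> 0" "\<And>n. \<bar>wt s n - wt s (n - 2)\<bar> * \<bar>of_int n\<bar> \<le> C * wt s n"
    using wt_difference by metis
  have "\<bar>wt s n * shift_coeff (n - 2) + wt s (n - 2) * shift_coeff (- n)\<bar> \<le> (C / 4 + 5 / 2 + 2 * 9 ^ s) * wt s n" for n
  proof -
    define x where "x = shift_coeff (n - 2) - of_int (n - 2) / 4"
    define y where "y = shift_coeff (- n) - of_int (- n) / 4"
    have "wt s n * shift_coeff (n - 2) + wt s (n - 2) * shift_coeff (- n)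
        = ((wt s n - wt s (n - 2)) * of_int n) / 4 - wt s n / 2 + wt s n * x + wt s (n - 2) * y"
      by (simp add: x_def y_def field_simps)
    moreover have "\<bar>((wt s n - wt s (n - 2)) * of_int n) / 4\<bar> \<le> C * wt s n / 4"
      using C(2)[of n] by (simp add: abs_mult)
    moreover have "\<bar>wt s n * x\<bar> \<le> wt s n * 2"
      unfolding abs_mult using shift_coeff_split[of "n - 2"] by (intro mult_mono) (auto simp: x_def)
    moreover have "\<bar>wt s (n - 2) * y\<bar> \<le> (9 ^ s * wt s n) * 2"
      unfolding abs_mult using shift_coeff_split[of "- n"] wt_shift[of "n - 2" n s]
      by (intro mult_mono) (auto simp: y_def)
    ultimately have "\<bar>wt s n * shift_coeff (n - 2) + wt s (n - 2) * shift_coeff (- n)\<bar>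
        \<le> C * wt s n / 4 + wt s n / 2 + wt s n * 2 + (9 ^ s * wt s n) * 2"
      using wt_nonneg[of s n] by linarith
    thus ?thesis by (simp add: algebra_simps)
  qed
  thus thesis using that[of "C / 4 + 5 / 2 + 2 * 9 ^ s"] C(1) by simp
qed

lemma Re_cnj_mult_le: "\<bar>Re (cnj a * b)\<bar> \<le> ((cmod a)\<^sup>2 + (cmod b)\<^sup>2) / 2"
proof -
  have "\<bar>Re (cnj a * b)\<bar> \<le> cmod a * cmod b"
    using abs_Re_le_cmod[of "cnj a * b"] by (simp add: norm_mult)
  also have "\<dots> \<le> ((cmod a)\<^sup>2 + (cmod b)\<^sup>2) / 2"
    using zero_le_square[of "cmod a - cmod b"] by (simp add: power2_eq_square algebra_simps)
  finally show ?thesis .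
qed

text \<open>
  The key estimate: although \<open>L\<close> is of first order, its quadratic form has order zero. After shifting
  the index in the second sum, the pairs \<open>(n, n - 2)\<close> carry the coefficient bounded in \<open>skew_commutator\<close>. Finite
  support makes all sums finite; the constant is the same for all supports.
\<close>

lemma Lseq_energy:
  obtains C where "C \<ge> 0"
    and "\<And>N c. (\<And>n. \<bar>n\<bar> > int N \<Longrightarrow> c n = 0) \<Longrightarrow>
       \<bar>\<Sum>n\<in>{- int N..int N}. wt s n * Re (cnj (c n) * Lseq c n)\<bar> \<le> C * hsq s c"
proof -
  obtain D where D: "D \<ge> 0"
    "\<And>n. \<bar>wt s n * shift_coeff (n - 2) + wt s (n - 2) * shift_coeff (- n)\<bar> \<le> D * wt s n"
    using skew_commutator by metis
  define C where "C = D * (1 + 9 ^ s) / 2 + (1 + 5 ^ s * (2 * inv_sq_sum))"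
  have "\<bar>\<Sum>n\<in>{- int N..int N}. wt s n * Re (cnj (c n) * Lseq c n)\<bar> \<le> C * hsq s c"
    if supp: "\<And>n. \<bar>n\<bar> > int N \<Longrightarrow> c n = 0" for N c
  proof -
    let ?I = "{- int N..int N}" and ?J = "{- int N + 2..int N}"
    define p where "p n = Re (cnj (c n) * c (n - 2))" for n
    have cs: "c \<in> hseq r" for r using hsq_finite_support(1)[of N c] supp by blast
    (* both sums are brought to the indices n for which n and n - 2 lie in the support *)
    have T1: "(\<Sum>n\<in>?I. wt s n * shift_coeff (n - 2) * p n) = (\<Sum>n\<in>?J. wt s n * shift_coeff (n - 2) * p n)"
      by (rule sum.mono_neutral_right) (auto simp: p_def supp)
    have "(\<Sum>n\<in>?I. wt s n * shift_coeff (- n - 2) * p (n + 2))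
        = (\<Sum>n\<in>(\<lambda>n. n + 2) ` ?I. wt s (n - 2) * shift_coeff (- n) * p n)"
      by (subst sum.reindex) (auto simp: algebra_simps intro!: sum.cong)
    also have "\<dots> = (\<Sum>n\<in>?J. wt s (n - 2) * shift_coeff (- n) * p n)"
      by (rule sum.mono_neutral_right) (auto simp: p_def supp)
    finally have T2: "(\<Sum>n\<in>?I. wt s n * shift_coeff (- n - 2) * p (n + 2))
        = (\<Sum>n\<in>?J. wt s (n - 2) * shift_coeff (- n) * p n)" .
    have "(\<Sum>n\<in>?I. wt s n * Re (cnj (c n) * Lseq c n))
      = (\<Sum>n\<in>?I. wt s n * shift_coeff (n - 2) * p n) + (\<Sum>n\<in>?I. wt s n * shift_coeff (- n - 2) * p (n + 2))
        - (\<Sum>n\<in>?I. wt s n * Re (cnj (c n) * (if \<bar>n\<bar> = 2 then vsum c else 0)))"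
      unfolding sum.distrib [symmetric] sum_subtractf [symmetric]
      by (rule sum.cong) (simp_all add: Lseq_def p_def algebra_simps)
    also have "(\<Sum>n\<in>?I. wt s n * shift_coeff (n - 2) * p n) + (\<Sum>n\<in>?I. wt s n * shift_coeff (- n - 2) * p (n + 2))
      = (\<Sum>n\<in>?J. (wt s n * shift_coeff (n - 2) + wt s (n - 2) * shift_coeff (- n)) * p n)"
      unfolding T1 T2 sum.distrib [symmetric] by (simp add: algebra_simps)
    finally have eq: "(\<Sum>n\<in>?I. wt s n * Re (cnj (c n) * Lseq c n))
      = (\<Sum>n\<in>?J. (wt s n * shift_coeff (n - 2) + wt s (n - 2) * shift_coeff (- n)) * p n)
        - (\<Sum>n\<in>?I. wt s n * Re (cnj (c n) * (if \<bar>n\<bar> = 2 then vsum c else 0)))" .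
    have "\<bar>\<Sum>n\<in>?J. (wt s n * shift_coeff (n - 2) + wt s (n - 2) * shift_coeff (- n)) * p n\<bar>
        \<le> (\<Sum>n\<in>?J. D / 2 * (wt s n * (cmod (c n))\<^sup>2) + D / 2 * (wt s n * (cmod (c (n - 2)))\<^sup>2))"
    proof (rule order_trans[OF sum_abs sum_mono])
      fix n
      have "\<bar>(wt s n * shift_coeff (n - 2) + wt s (n - 2) * shift_coeff (- n)) * p n\<bar>
          \<le> (D * wt s n) * (((cmod (c n))\<^sup>2 + (cmod (c (n - 2)))\<^sup>2) / 2)"
        unfolding abs_mult p_def using D by (intro mult_mono Re_cnj_mult_le) auto
      thus "\<bar>(wt s n * shift_coeff (n - 2) + wt s (n - 2) * shift_coeff (- n)) * p n\<bar>
          \<le> D / 2 * (wt s n * (cmod (c n))\<^sup>2) + D / 2 * (wt s n * (cmod (c (n - 2)))\<^sup>2)"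
        by (simp add: algebra_simps)
    qed
    also have "\<dots> \<le> D / 2 * hsq s c + D / 2 * (9 ^ s * hsq s c)"
    proof -
      have "(\<Sum>n\<in>?J. wt s n * (cmod (c (n - 2)))\<^sup>2) \<le> 9 ^ s * hsq s c"
        using hsq_ge_sum[OF hseq_shift(1)[OF cs, of "- 2"], of ?J s] hseq_shift(2)[OF cs, of "- 2" s] by simp
      thus ?thesis unfolding sum.distrib sum_distrib_left [symmetric] using D(1)
        by (intro add_mono mult_left_mono hsq_ge_sum cs) auto
    qed
    finally have A: "\<bar>\<Sum>n\<in>?J. (wt s n * shift_coeff (n - 2) + wt s (n - 2) * shift_coeff (- n)) * p n\<bar>
        \<le> D / 2 * hsq s c + D / 2 * (9 ^ s * hsq s c)" .
    have "\<bar>\<Sum>n\<in>?I. wt s n * Re (cnj (c n) * (if \<bar>n\<bar> = 2 then vsum c else 0))\<bar>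
        \<le> (\<Sum>n\<in>?I. wt s n * (cmod (c n))\<^sup>2 + (if n \<in> {-2, 2} then 5 ^ s * ((cmod (vsum c))\<^sup>2 / 2) else 0))"
    proof (rule order_trans[OF sum_abs sum_mono])
      fix n :: int
      show "\<bar>wt s n * Re (cnj (c n) * (if \<bar>n\<bar> = 2 then vsum c else 0))\<bar>
        \<le> wt s n * (cmod (c n))\<^sup>2 + (if n \<in> {-2, 2} then 5 ^ s * ((cmod (vsum c))\<^sup>2 / 2) else 0)"
      proof (cases "\<bar>n\<bar> = 2")
        case True
        have "\<bar>wt s n * Re (cnj (c n) * vsum c)\<bar> \<le> wt s n * (((cmod (c n))\<^sup>2 + (cmod (vsum c))\<^sup>2) / 2)"
          unfolding abs_mult by (intro mult_mono Re_cnj_mult_le) auto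
        also have "\<dots> = wt s n * (cmod (c n))\<^sup>2 / 2 + wt s n * ((cmod (vsum c))\<^sup>2 / 2)"
          by (simp add: algebra_simps)
        also have "\<dots> \<le> wt s n * (cmod (c n))\<^sup>2 + wt s n * ((cmod (vsum c))\<^sup>2 / 2)" by simp
        finally have "\<bar>wt s n * Re (cnj (c n) * vsum c)\<bar>
            \<le> wt s n * (cmod (c n))\<^sup>2 + wt s n * ((cmod (vsum c))\<^sup>2 / 2)" .
        moreover from True have n: "n = 2 \<or> n = -2" by linarith
        moreover from n have "wt s n = 5 ^ s" by (elim disjE) (simp_all add: wt_def)
        ultimately show ?thesis using True by auto
      qed auto
    qed
    also have "\<dots> = hsq s c + (\<Sum>n\<in>?I \<inter> {-2, 2}. 5 ^ s * ((cmod (vsum c))\<^sup>2 / 2))"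
      using hsq_finite_support(2)[of N c s] supp
      by (simp only: sum.distrib sum.inter_restrict finite_atLeastAtMost_int)
    also have "(\<Sum>n\<in>?I \<inter> {-2, 2}. 5 ^ s * ((cmod (vsum c))\<^sup>2 / 2))
        \<le> (\<Sum>n\<in>{-2, 2::int}. 5 ^ s * ((cmod (vsum c))\<^sup>2 / 2))"
      by (intro sum_mono2) auto
    also have "\<dots> = 5 ^ s * (cmod (vsum c))\<^sup>2" by simp
    also have "\<dots> \<le> 5 ^ s * (2 * inv_sq_sum * hsq s c)"
      using inv_sq_sum_nonneg
      by (intro mult_left_mono order_trans[OF vsum_bound[OF cs]] hsq_mono[OF cs]) auto
    finally have B: "\<bar>\<Sum>n\<in>?I. wt s n * Re (cnj (c n) * (if \<bar>n\<bar> = 2 then vsum c else 0))\<bar>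
        \<le> hsq s c + 5 ^ s * (2 * inv_sq_sum * hsq s c)" by simp
    have "C * hsq s c = (D / 2 * hsq s c + D / 2 * (9 ^ s * hsq s c))
        + (hsq s c + 5 ^ s * (2 * inv_sq_sum * hsq s c))"
      by (simp add: C_def field_simps)
    thus ?thesis unfolding eq using order_trans[OF abs_triangle_ineq4 add_mono[OF A B]] by simp
  qed
  moreover have "C \<ge> 0" using D(1) inv_sq_sum_nonneg by (simp add: C_def)
  ultimately show thesis using that by blast
qed

section \<open>The evolution of the coefficients\<close>

text \<open>
  Continuity of \<open>c\<close> on \<open>[0,T]\<close> with values in \<open>hseq s\<close>, with respect to its norm.
\<close>

definition hcont :: "real \<Rightarrow> nat \<Rightarrow> (real \<Rightarrow> int \<Rightarrow> complex) \<Rightarrow> bool" where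
  "hcont T s c \<longleftrightarrow> (\<forall>t\<in>{0..T}. c t \<in> hseq s \<and>
     ((\<lambda>r. hsq s (\<lambda>n. c r n - c t n)) \<longlongrightarrow> 0) (at t within {0..T}))"

text \<open>
  The equation is required entry by entry; norm continuity comes from \<open>hcont\<close>.
\<close>

definition coeff_solution :: "real \<Rightarrow> (real \<Rightarrow> int \<Rightarrow> complex) \<Rightarrow> bool" where
  "coeff_solution T c \<longleftrightarrow> (\<forall>t\<in>{0..T}. \<forall>n.
     ((\<lambda>r. c r n) has_vector_derivative - Lseq (c t) n) (at t within {0..T}))"

text \<open>
  The function \<open>exp (- C * t) * E t - G * t\<close> is nonincreasing.
\<close>

lemma gronwall_le:
  fixes E E' :: "real \<Rightarrow> real"
  assumes der: "\<And>t. t \<in> {0..T} \<Longrightarrow> (E has_real_derivative E' t) (at t within {0..T})"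
    and le: "\<And>t. t \<in> {0..T} \<Longrightarrow> E' t \<le> C * E t + G" and "C \<ge> 0" "G \<ge> 0" and t: "t \<in> {0..T}"
  shows "E t \<le> exp (C * t) * (E 0 + G * t)"
proof -
  define F where "F r = exp (- C * r) * E r - G * r" for r
  have der_F: "(F has_real_derivative exp (- C * r) * (E' r - C * E r) - G) (at r within {0..T})"
    if "r \<in> {0..T}" for r
    unfolding F_def by (auto intro!: derivative_eq_intros der[OF that] simp: algebra_simps)
  have "F t \<le> F 0"
  proof (rule DERIV_nonpos_imp_decreasing_open[of 0 t F])
    show "continuous_on {0..t} F"
    proof (rule DERIV_continuous_on)
      fix r assume "r \<in> {0..t}"
      hence "r \<in> {0..T}" "{0..t} \<subseteq> {0..T}" using t by auto
      thus "(F has_real_derivative exp (- C * r) * (E' r - C * E r) - G) (at r within {0..t})"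
        by (intro has_field_derivative_subset[OF der_F])
    qed
    fix r assume r: "0 < r" "r < t"
    have "at r within {0..T} = at r" using r t by (intro at_within_Icc_at) auto
    hence "DERIV F r :> exp (- C * r) * (E' r - C * E r) - G" using der_F[of r] r t by simp
    moreover have "exp (- C * r) * (E' r - C * E r) \<le> 1 * G"
      using le[of r] r t \<open>C \<ge> 0\<close> \<open>G \<ge> 0\<close>
      by (intro order_trans[OF mult_left_mono[of _ G] mult_right_mono]) auto
    ultimately show "\<exists>y. DERIV F r :> y \<and> y \<le> 0" by force
  qed (use t in auto)
  hence "exp (C * t) * (F t + G * t) \<le> exp (C * t) * (E 0 + G * t)"
    by (intro mult_left_mono) (auto simp: F_def)
  moreover have "exp (C * t) * (F t + G * t) = E t" by (simp add: F_def exp_minus field_simps)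
  ultimately show ?thesis by simp
qed

lemma has_real_derivative_cmod_sq:
  assumes "(z has_vector_derivative z') (at t within S)"
  shows "((\<lambda>t. (cmod (z t))\<^sup>2) has_real_derivative 2 * Re (cnj (z t) * z')) (at t within S)"
proof -
  from assms have "((\<lambda>t. Re (z t)) has_real_derivative Re z') (at t within S)"
    and "((\<lambda>t. Im (z t)) has_real_derivative Im z') (at t within S)"
    unfolding has_vector_derivative_complex_iff by auto
  from DERIV_add[OF DERIV_power[OF this(1), of 2] DERIV_power[OF this(2), of 2]]
  show ?thesis unfolding cmod_power2 by (simp add: algebra_simps)
qed

text \<open>
  An estimate for the truncated system with a forcing term \<open>g\<close>, with a constant \<open>C\<close> that depends neither
  on the truncation nor on \<open>g\<close>; this is what makes limits of truncations possible. In its three applications \<open>g\<close> is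
  zero, the discrepancy of two truncations, or the truncation error of an exact solution.
\<close>

definition energy_bound :: "nat \<Rightarrow> real \<Rightarrow> bool" where
  "energy_bound s C \<longleftrightarrow> (\<forall>T N c g G. (\<forall>t\<in>{0..T}. \<forall>n. \<bar>n\<bar> \<le> int N \<longrightarrow>
        ((\<lambda>r. c r n) has_vector_derivative (g t n - Lseq (trunc N (c t)) n)) (at t within {0..T})) \<longrightarrow>
       (\<forall>t\<in>{0..T}. hsq s (trunc N (g t)) \<le> G) \<longrightarrow>
       (\<forall>t\<in>{0..T}. hsq s (trunc N (c t)) \<le> exp (C * t) * (hsq s (trunc N (c 0)) + G * t)))"

text \<open>
  Gronwall's inequality for the squared norm: its derivative is controlled by \<open>Lseq_energy\<close> and
  \<open>2 * Re \<langle>c, g\<rangle> \<le> \<parallel>c\<parallel>\<^sup>2 + \<parallel>g\<parallel>\<^sup>2\<close>.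
\<close>

lemma energy_estimate: "\<exists>C\<ge>0. energy_bound s C"
proof -
  obtain C where C: "C \<ge> 0" "\<And>N c. (\<And>n. \<bar>n\<bar> > int N \<Longrightarrow> c n = 0) \<Longrightarrow>
       \<bar>\<Sum>n\<in>{- int N..int N}. wt s n * Re (cnj (c n) * Lseq c n)\<bar> \<le> C * hsq s c"
    using Lseq_energy[of s] by metis
  have est: "hsq s (trunc N (c t)) \<le> exp ((2 * C + 1) * t) * (hsq s (trunc N (c 0)) + G * t)"
    if der: "\<And>t n. t \<in> {0..T} \<Longrightarrow> \<bar>n\<bar> \<le> int N \<Longrightarrow>
        ((\<lambda>r. c r n) has_vector_derivative (g t n - Lseq (trunc N (c t)) n)) (at t within {0..T})"
      and g: "\<And>t. t \<in> {0..T} \<Longrightarrow> hsq s (trunc N (g t)) \<le> G" and t: "t \<in> {0..T}" for T N c g G t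
  proof (rule gronwall_le[where T = T])
    let ?I = "{- int N..int N}"
    let ?E' = "\<lambda>t. \<Sum>n\<in>?I. wt s n * (2 * Re (cnj (c t n) * (g t n - Lseq (trunc N (c t)) n)))"
    show "((\<lambda>t. hsq s (trunc N (c t))) has_real_derivative ?E' t) (at t within {0..T})"
      if "t \<in> {0..T}" for t
      unfolding hsq_trunc
      by (intro DERIV_sum DERIV_cmult has_real_derivative_cmod_sq der) (use that in auto)
    show "?E' t \<le> (2 * C + 1) * hsq s (trunc N (c t)) + G" if t: "t \<in> {0..T}" for t
    proof -
      have "?E' t = (\<Sum>n\<in>?I. wt s n * (2 * Re (cnj (c t n) * g t n)))
          - 2 * (\<Sum>n\<in>?I. wt s n * Re (cnj (trunc N (c t) n) * Lseq (trunc N (c t)) n))"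
        unfolding sum_distrib_left sum_subtractf [symmetric]
        by (rule sum.cong) (auto simp: trunc_def algebra_simps)
      also have "(\<Sum>n\<in>?I. wt s n * (2 * Re (cnj (c t n) * g t n)))
          \<le> (\<Sum>n\<in>?I. wt s n * (cmod (c t n))\<^sup>2 + wt s n * (cmod (g t n))\<^sup>2)"
      proof (rule sum_mono)
        fix n
        have "2 * Re (cnj (c t n) * g t n) \<le> (cmod (c t n))\<^sup>2 + (cmod (g t n))\<^sup>2"
          using abs_le_D1[OF Re_cnj_mult_le[of "c t n" "g t n"]]
          unfolding le_divide_eq_numeral1 by (simp only: mult.commute)
        from mult_left_mono[OF this wt_nonneg, of s n]
        show "wt s n * (2 * Re (cnj (c t n) * g t n)) \<le> wt s n * (cmod (c t n))\<^sup>2 + wt s n * (cmod (g t n))\<^sup>2"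
          by (simp add: distrib_left)
      qed
      also have "\<dots> = hsq s (trunc N (c t)) + hsq s (trunc N (g t))"
        unfolding hsq_trunc sum.distrib ..
      finally have "?E' t \<le> hsq s (trunc N (c t)) + hsq s (trunc N (g t))
          - 2 * (\<Sum>n\<in>?I. wt s n * Re (cnj (trunc N (c t) n) * Lseq (trunc N (c t)) n))" by simp
      moreover have "\<bar>\<Sum>n\<in>?I. wt s n * Re (cnj (trunc N (c t) n) * Lseq (trunc N (c t)) n)\<bar>
          \<le> C * hsq s (trunc N (c t))"
        by (rule C(2)) (simp add: trunc_def)
      moreover have "(2 * C + 1) * hsq s (trunc N (c t)) = 2 * (C * hsq s (trunc N (c t))) + hsq s (trunc N (c t))"
        by (simp add: algebra_simps)
      ultimately show ?thesis using g[OF t] by linarith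
    qed
    show "0 \<le> G" using g[OF t] hsq_nonneg[of s "trunc N (g t)"] by linarith
  qed (use C t in auto)
  show ?thesis unfolding energy_bound_def
  proof (intro exI[of _ "2 * C + 1"] conjI allI impI ballI)
    show "0 \<le> 2 * C + 1" using C(1) by simp
  qed (rule est, blast+)
qed

text \<open>
  The solution is the exponential series \<open>\<Sum>j. t ^ j / j! * M ^ j c0\<close>, written out in coordinates so that it can be
  differentiated as a power series.
\<close>

lemma linear_ode_finite:
  fixes M :: "'i \<Rightarrow> 'i \<Rightarrow> complex"
  assumes F: "finite F"
  obtains c where "c 0 = c0"
    and "\<And>t n. n \<in> F \<Longrightarrow> ((\<lambda>r::real. c r n) has_vector_derivative (\<Sum>k\<in>F. M n k * c t k)) (at t)"
proof -
  define p where "p j = ((\<lambda>u n. \<Sum>k\<in>F. M n k * u k) ^^ j) c0" for j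
  have p_0: "p 0 = c0" and p_Suc: "p (Suc j) n = (\<Sum>k\<in>F. M n k * p j k)" for j n
    by (simp_all add: p_def)
  define B where "B = (\<Sum>n\<in>F. \<Sum>k\<in>F. cmod (M n k))"
  define R where "R = (\<Sum>k\<in>F. cmod (c0 k))"
  have B: "B \<ge> 0" unfolding B_def by (intro sum_nonneg) auto
  have bound: "cmod (p j n) \<le> B ^ j * R" if "n \<in> F" for j n
    using that
  proof (induction j arbitrary: n)
    case 0
    thus ?case using member_le_sum[of n F "\<lambda>k. cmod (c0 k)"] F by (simp add: p_0 R_def)
  next
    case (Suc j)
    have R: "R \<ge> 0" unfolding R_def by (intro sum_nonneg) auto
    have "cmod (p (Suc j) n) \<le> (\<Sum>k\<in>F. cmod (M n k) * (B ^ j * R))"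
      unfolding p_Suc by (intro sum_norm_le) (simp add: norm_mult mult_left_mono Suc.IH)
    also have "\<dots> = (\<Sum>k\<in>F. cmod (M n k)) * (B ^ j * R)" by (simp add: sum_distrib_right)
    also have "\<dots> \<le> B * (B ^ j * R)"
      using Suc.prems F B R member_le_sum[of n F "\<lambda>n. \<Sum>k\<in>F. cmod (M n k)"]
      by (intro mult_right_mono) (auto simp: B_def sum_nonneg)
    finally show ?case by simp
  qed
  have sm: "summable (\<lambda>j. p j n / fact j * z ^ j)" if "n \<in> F" for n and z :: complex
  proof (rule summable_comparison_test')
    show "summable (\<lambda>j. R * (inverse (fact j) * (B * cmod z) ^ j))"
      by (intro summable_mult summable_exp)
    show "norm (p j n / fact j * z ^ j) \<le> R * (inverse (fact j) * (B * cmod z) ^ j)" for j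
      using mult_right_mono[OF bound[OF that, of j], of "cmod z ^ j / fact j"]
      by (simp add: norm_mult norm_divide norm_power power_mult_distrib field_simps)
  qed
  define f where "f n z = (if n \<in> F then \<Sum>j. p j n / fact j * z ^ j else c0 n)" for n and z :: complex
  have "(f n has_field_derivative (\<Sum>k\<in>F. M n k * f k z)) (at z)" if n: "n \<in> F" for n z
  proof -
    have "f n = (\<lambda>z. \<Sum>j. p j n / fact j * z ^ j)" using n by (simp add: f_def fun_eq_iff)
    moreover have "((\<lambda>z. \<Sum>j. p j n / fact j * z ^ j) has_field_derivative
        (\<Sum>j. diffs (\<lambda>j. p j n / fact j) j * z ^ j)) (at z)"
      by (rule termdiffs_strong_converges_everywhere) (rule sm[OF n])
    moreover have "(\<Sum>j. diffs (\<lambda>j. p j n / fact j) j * z ^ j) = (\<Sum>k\<in>F. M n k * f k z)"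
    proof -
      have "diffs (\<lambda>j. p j n / fact j) j * z ^ j = (\<Sum>k\<in>F. M n k * (p j k / fact j * z ^ j))" for j
      proof -
        have "diffs (\<lambda>j. p j n / fact j) j = p (Suc j) n / fact j"
          by (simp add: diffs_def del: of_nat_Suc)
        thus ?thesis by (simp add: p_Suc sum_distrib_left sum_distrib_right sum_divide_distrib algebra_simps)
      qed
      hence "(\<Sum>j. diffs (\<lambda>j. p j n / fact j) j * z ^ j) = (\<Sum>j. \<Sum>k\<in>F. M n k * (p j k / fact j * z ^ j))"
        by simp
      also have "\<dots> = (\<Sum>k\<in>F. \<Sum>j. M n k * (p j k / fact j * z ^ j))"
        by (intro suminf_sum summable_mult sm)
      also have "\<dots> = (\<Sum>k\<in>F. M n k * f k z)"
      proof (rule sum.cong)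
        fix k assume "k \<in> F"
        thus "(\<Sum>j. M n k * (p j k / fact j * z ^ j)) = M n k * f k z"
          unfolding f_def by (simp only: if_True suminf_mult[OF sm])
      qed simp
      finally show ?thesis .
    qed
    ultimately show ?thesis by simp
  qed
  hence "((\<lambda>r. f n (of_real r)) has_vector_derivative (\<Sum>k\<in>F. M n k * f k (of_real t))) (at t)"
    if "n \<in> F" for n t
    using that by (intro has_vector_derivative_real_field) auto
  moreover have "(\<lambda>n. f n (of_real 0)) = c0"
  proof
    fix n
    show "f n (of_real 0) = c0 n" unfolding f_def of_real_0
      by (simp only: powser_zero) (simp add: p_0)
  qed
  ultimately show thesis using that[of "\<lambda>r n. f n (of_real r)"] by blast
qed

lemma truncated_solution:
  obtains u where "u 0 = trunc N c0" and "\<And>t n. \<bar>n\<bar> > int N \<Longrightarrow> u t n = 0"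
    and "\<And>t n. \<bar>n\<bar> \<le> int N \<Longrightarrow> ((\<lambda>r. u r n) has_vector_derivative - Lseq (u t) n) (at t)"
proof -
  obtain c where c0: "c 0 = c0"
    and c: "\<And>t n. n \<in> {- int N..int N} \<Longrightarrow> ((\<lambda>r. c r n) has_vector_derivative
      (\<Sum>k\<in>{- int N..int N}. - Lseq (\<lambda>j. if j = k then 1 else 0) n * c t k)) (at t)"
    using linear_ode_finite[of "{- int N..int N}" c0 "\<lambda>n k. - Lseq (\<lambda>j. if j = k then 1 else 0) n"] by auto
  show thesis
  proof (rule that[of "\<lambda>r. trunc N (c r)"])
    fix t and n :: int assume n: "\<bar>n\<bar> \<le> int N"
    hence "(\<lambda>r. trunc N (c r) n) = (\<lambda>r. c r n)" by (simp add: trunc_def)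
    thus "((\<lambda>r. trunc N (c r) n) has_vector_derivative - Lseq (trunc N (c t)) n) (at t)"
      using c[of n t] n by (simp add: Lseq_trunc sum_negf abs_le_iff)
  qed (auto simp: c0 trunc_def)
qed

lemma trunc_id: "(\<And>n. \<bar>n\<bar> > int N \<Longrightarrow> c n = 0) \<Longrightarrow> trunc N c = c"
  by (force simp: trunc_def fun_eq_iff)

text \<open>
  The data are cut off at \<open>K\<close>, the matrix at \<open>Q K = (1 + K\<^sup>2)\<^sup>2\<close>. For \<open>K \<le> J\<close>, the solution \<open>u K\<close> fails to solve
  the system for \<open>u J\<close> only by the part of \<open>Lseq (u K t)\<close> beyond the frequency \<open>Q K\<close>. Its squared norm of order \<open>s\<close> is at most
  \<open>1 / (1 + (Q K)\<^sup>2)\<close> times that of \<open>u K t\<close> of order \<open>s + 2\<close>, up to a constant; the latter is at most a constant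
  times \<open>(1 + K\<^sup>2)\<^sup>2\<close>, by the energy estimate of order \<open>s + 2\<close>. So the error is \<open>O(1 / (1 + K\<^sup>2))\<close>.
\<close>

lemma approximate_solutions:
  assumes c0: "c0 \<in> hseq s" and T: "T \<ge> 0"
  shows "\<exists>(u :: nat \<Rightarrow> real \<Rightarrow> int \<Rightarrow> complex) (\<epsilon> :: nat \<Rightarrow> real).
    (\<forall>K. u K 0 = trunc K c0) \<and> (\<forall>K t r. u K t \<in> hseq r) \<and>
    (\<forall>K t n. \<bar>n\<bar> \<le> int K \<longrightarrow> ((\<lambda>r. u K r n) has_vector_derivative - Lseq (u K t) n) (at t)) \<and>
    (\<forall>K n. continuous_on UNIV (\<lambda>r. u K r n)) \<and>
    (\<forall>K. \<exists>N. \<forall>t n. \<bar>n\<bar> > int N \<longrightarrow> u K t n = 0) \<and>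
    (\<forall>K J. \<forall>t\<in>{0..T}. K \<le> J \<longrightarrow> hsq s (\<lambda>n. u J t n - u K t n) \<le> \<epsilon> K) \<and>
    \<epsilon> \<longlonglongrightarrow> 0"
proof -
  (* 1 + (Q K)^2 must outgrow the square of the factor (1 + K^2) that two derivatives of u K cost *)
  define Q :: "nat \<Rightarrow> nat" where "Q K = (1 + K\<^sup>2)\<^sup>2" for K
  have KQ: "K \<le> Q K" for K
  proof -
    have "K \<le> 1 + K\<^sup>2" by (cases K) (auto simp: power2_eq_square)
    also have "\<dots> \<le> Q K" by (simp add: Q_def power2_eq_square)
    finally show ?thesis .
  qed
  have Qmono: "Q K \<le> Q J" if "K \<le> J" for K J
    unfolding Q_def using that by (intro power_mono add_left_mono) auto
  have "\<exists>u. u 0 = trunc (Q K) (trunc K c0) \<and> (\<forall>t n. \<bar>n\<bar> > int (Q K) \<longrightarrow> u t n = 0) \<and>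
    (\<forall>t n. \<bar>n\<bar> \<le> int (Q K) \<longrightarrow> ((\<lambda>r. u r n) has_vector_derivative - Lseq (u t) n) (at t))" for K
    using truncated_solution[of "Q K" "trunc K c0"] by metis
  then obtain u where u0': "\<And>K. u K 0 = trunc (Q K) (trunc K c0)"
    and usupp: "\<And>K t n. \<bar>n\<bar> > int (Q K) \<Longrightarrow> u K t n = 0"
    and uder: "\<And>K t n. \<bar>n\<bar> \<le> int (Q K) \<Longrightarrow>
      ((\<lambda>r. u K r n) has_vector_derivative - Lseq (u K t) n) (at t)"
    by metis
  have u0: "u K 0 = trunc K c0" for K
    unfolding u0' by (rule trunc_id) (use KQ[of K] in \<open>auto simp: trunc_def\<close>)
  have useq: "u K t \<in> hseq r" for K t r
    using hsq_finite_support(1)[of "Q K" "u K t"] usupp by blast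
  obtain C2 where C2_0: "C2 \<ge> 0" and C2: "energy_bound (s + 2) C2"
    using energy_estimate[of "s + 2"] by blast
  obtain C where C_0: "C \<ge> 0" and C: "energy_bound s C"
    using energy_estimate[of s] by blast
  obtain CL where CL: "CL \<ge> 0" "\<And>c. c \<in> hseq (Suc (Suc s)) \<Longrightarrow> hsq (Suc s) (Lseq c) \<le> CL * hsq (Suc (Suc s)) c"
    using Lseq_bound[of "Suc s"] by metis
  define D where "D = exp (C2 * T) * hsq s c0"
  define \<epsilon> where "\<epsilon> K = exp (C * T) *
    (hsq s (\<lambda>n. c0 n - trunc K c0 n) + CL * D / (1 + (real K)\<^sup>2) * T)" for K
  have trunc_u: "trunc (Q K) (u K t) = u K t" for K t by (rule trunc_id) (rule usupp)
  have high: "hsq (Suc (Suc s)) (u K t) \<le> (1 + (real K)\<^sup>2)\<^sup>2 * D" if t: "t \<in> {0..T}" for K t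
  proof -
    have "hsq (s + 2) (trunc (Q K) (u K t)) \<le> exp (C2 * t) * (hsq (s + 2) (trunc (Q K) (u K 0)) + 0 * t)"
    proof (rule C2[unfolded energy_bound_def, rule_format, where g = "\<lambda>_ _. 0"])
      fix t n assume "\<bar>n\<bar> \<le> int (Q K)"
      from uder[OF this] show "((\<lambda>r. u K r n) has_vector_derivative
          0 - Lseq (trunc (Q K) (u K t)) n) (at t within {0..T})"
        by (simp add: trunc_u has_vector_derivative_at_within)
    qed (use t in \<open>auto simp: hsq_trunc\<close>)
    also have "\<dots> \<le> exp (C2 * T) * ((1 + (real K)\<^sup>2) ^ 2 * hsq s c0)"
    proof (rule mult_mono)
      show "hsq (s + 2) (trunc (Q K) (u K 0)) + 0 * t \<le> (1 + (real K)\<^sup>2) ^ 2 * hsq s c0"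
        unfolding trunc_u unfolding u0 using hsq_trunc_inverse[OF c0, of 2 K] by simp
    qed (use t C2_0 in \<open>auto intro: mult_left_mono\<close>)
    finally show ?thesis by (simp add: trunc_u D_def mult_ac)
  qed
  have cauchy: "hsq s (\<lambda>n. u J t n - u K t n) \<le> \<epsilon> K" if KJ: "K \<le> J" and t: "t \<in> {0..T}" for K J t
  proof -
    define d where "d t n = u J t n - u K t n" for t n
    define g where "g t n = - (Lseq (u K t) n - trunc (Q K) (Lseq (u K t)) n)" for t n
    have dsupp: "trunc (Q J) (d t) = d t" for t
      by (rule trunc_id) (use usupp Qmono[OF KJ] in \<open>force simp: d_def\<close>)
    have "hsq s (trunc (Q J) (d t)) \<le> exp (C * t) *
      (hsq s (trunc (Q J) (d 0)) + CL * D / (1 + (real K)\<^sup>2) * t)"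
    proof (rule C[unfolded energy_bound_def, rule_format, where g = g])
      fix t n assume n: "\<bar>n\<bar> \<le> int (Q J)"
      (* u K solves its own system, in which the entries beyond Q K vanish *)
      have "((\<lambda>r. u K r n) has_vector_derivative - trunc (Q K) (Lseq (u K t)) n) (at t)"
      proof (cases "\<bar>n\<bar> \<le> int (Q K)")
        case True
        thus ?thesis using uder[of n K t] by (simp add: trunc_def)
      next
        case False
        hence "(\<lambda>r. u K r n) = (\<lambda>r. 0)" using usupp by auto
        thus ?thesis using False by (simp add: trunc_def)
      qed
      hence "((\<lambda>r. d r n) has_vector_derivative
          - Lseq (u J t) n - - trunc (Q K) (Lseq (u K t)) n) (at t)"
        unfolding d_def by (intro has_vector_derivative_diff uder n)
      also have "- Lseq (u J t) n - - trunc (Q K) (Lseq (u K t)) n = g t n - Lseq (trunc (Q J) (d t)) n"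
        unfolding dsupp g_def using Lseq_diff[OF useq useq, of J t K t n] by (simp add: d_def[abs_def])
      finally show "((\<lambda>r. d r n) has_vector_derivative
          g t n - Lseq (trunc (Q J) (d t)) n) (at t within {0..T})"
        by (rule has_vector_derivative_at_within)
    next
      fix t assume t: "t \<in> {0..T}"
      let ?q = "1 + (real K)\<^sup>2"
      have q: "?q \<ge> 1" by simp
      have LK: "Lseq (u K t) \<in> hseq (Suc s)" by (rule hseq_Lseq) (rule useq)
      have g_seq: "g t \<in> hseq s" "hsq s (g t) = hsq s (\<lambda>n. Lseq (u K t) n - trunc (Q K) (Lseq (u K t)) n)"
        using hseq_diff[OF hseq_mono[OF LK, of s] hseq_trunc[of "Q K" "Lseq (u K t)"]]
        unfolding g_def hseq_def hsq_def by (simp_all add: norm_minus_commute)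
      have "hsq s (trunc (Q J) (g t)) \<le> hsq s (\<lambda>n. Lseq (u K t) n - trunc (Q K) (Lseq (u K t)) n)"
        using hsq_trunc_le[OF g_seq(1)] g_seq(2) by simp
      also have "\<dots> \<le> hsq (Suc s) (Lseq (u K t)) / (1 + (real (Q K))\<^sup>2)" by (rule hseq_tail[OF LK])
      also have "\<dots> \<le> (CL * (?q\<^sup>2 * D)) / (?q\<^sup>2 * ?q)"
      proof (rule frac_le)
        show "hsq (Suc s) (Lseq (u K t)) \<le> CL * (?q\<^sup>2 * D)"
          by (rule order_trans[OF CL(2)[OF useq] mult_left_mono[OF high[OF t] CL(1)]])
        have "real (Q K) = ?q ^ 2" by (simp add: Q_def)
        hence "(real (Q K))\<^sup>2 = ?q ^ 4" by (simp add: power_mult [symmetric])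
        moreover have "?q ^ 3 \<le> ?q ^ 4" using q by (intro power_increasing) auto
        ultimately show "?q\<^sup>2 * ?q \<le> 1 + (real (Q K))\<^sup>2" by (simp add: power3_eq_cube power2_eq_square mult_ac)
        show "0 < ?q\<^sup>2 * ?q" using q by (intro mult_pos_pos zero_less_power) linarith+
        show "0 \<le> CL * (?q\<^sup>2 * D)" using CL(1) by (simp add: D_def)
      qed
      also have "\<dots> = CL * D / ?q" using q by (simp add: field_simps add_nonneg_eq_0_iff)
      finally show "hsq s (trunc (Q J) (g t)) \<le> CL * D / ?q" .
    qed (rule t)
    also have "\<dots> \<le> \<epsilon> K" unfolding \<epsilon>_def
    proof (rule mult_mono)
      show "exp (C * t) \<le> exp (C * T)" using t C_0 by (simp add: mult_left_mono)
      have "d 0 = trunc J (\<lambda>n. c0 n - trunc K c0 n)"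
        unfolding d_def[abs_def] u0 using KJ by (auto simp: trunc_def fun_eq_iff)
      hence "hsq s (trunc (Q J) (d 0)) \<le> hsq s (\<lambda>n. c0 n - trunc K c0 n)"
        unfolding dsupp using hsq_trunc_le[OF hseq_diff[OF c0 hseq_trunc[of K c0]], of J] by simp
      moreover have "CL * D / (1 + (real K)\<^sup>2) * t \<le> CL * D / (1 + (real K)\<^sup>2) * T"
        using t CL(1) by (intro mult_left_mono) (auto simp: D_def add_nonneg_nonneg)
      ultimately show "hsq s (trunc (Q J) (d 0)) + CL * D / (1 + (real K)\<^sup>2) * t
        \<le> hsq s (\<lambda>n. c0 n - trunc K c0 n) + CL * D / (1 + (real K)\<^sup>2) * T" by (rule add_mono)
      show "0 \<le> hsq s (trunc (Q J) (d 0)) + CL * D / (1 + (real K)\<^sup>2) * t"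
        using t CL(1) by (intro add_nonneg_nonneg mult_nonneg_nonneg divide_nonneg_nonneg) (auto simp: D_def)
    qed simp
    finally show ?thesis unfolding dsupp by (simp add: d_def[abs_def])
  qed
  have "\<epsilon> \<longlonglongrightarrow> exp (C * T) * (0 + 0 * T)" unfolding \<epsilon>_def
  proof (intro tendsto_mult tendsto_add tendsto_const hsq_tail_tendsto_0 c0)
    have "filterlim (\<lambda>K. 1 + (real K)\<^sup>2) at_top sequentially"
      by (intro filterlim_tendsto_add_at_top[OF tendsto_const] filterlim_pow_at_top filterlim_real_sequentially) simp
    thus "(\<lambda>K. CL * D / (1 + (real K)\<^sup>2)) \<longlonglongrightarrow> 0"
      by (intro tendsto_divide_0[OF tendsto_const] filterlim_at_top_imp_at_infinity)
  qed
  hence lim: "\<epsilon> \<longlonglongrightarrow> 0" by simp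
  show ?thesis
  proof (rule exI[of _ u], rule exI[of _ \<epsilon>], intro conjI allI ballI impI)
    fix K n
    show "continuous_on UNIV (\<lambda>r. u K r n)"
    proof (cases "\<bar>n\<bar> \<le> int (Q K)")
      case True
      show ?thesis
        by (intro continuous_at_imp_continuous_on ballI)
           (rule has_vector_derivative_continuous[OF uder[OF True]])
    next
      case False
      hence eq: "(\<lambda>r. u K r n) = (\<lambda>r. 0)" using usupp by auto
      show ?thesis unfolding eq by (rule continuous_on_const)
    qed
  next
    fix K
    show "\<exists>N. \<forall>t n. \<bar>n\<bar> > int N \<longrightarrow> u K t n = 0" using usupp by blast
  next
    fix K t n assume "\<bar>n\<bar> \<le> int K"
    hence "\<bar>n\<bar> \<le> int (Q K)" using KQ[of K] by linarith
    thus "((\<lambda>r. u K r n) has_vector_derivative - Lseq (u K t) n) (at t)" by (rule uder)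
  qed (use u0 useq cauchy lim in auto)
qed

text \<open>
  The approximations converge uniformly in time in the norm of order \<open>s\<close>, so continuity is inherited by
  the limit; entry by entry the derivatives converge uniformly as well, which gives the equation.
\<close>

theorem coeff_solution_exists:
  assumes c0: "c0 \<in> hseq s" and T: "T \<ge> 0"
  obtains c where "c 0 = c0" "hcont T s c" "coeff_solution T c"
proof -
  from approximate_solutions[OF assms]
  obtain u :: "nat \<Rightarrow> real \<Rightarrow> int \<Rightarrow> complex" and \<epsilon> :: "nat \<Rightarrow> real" where
    u0: "\<forall>K. u K 0 = trunc K c0" and useq0: "\<forall>K t r. u K t \<in> hseq r"
    and uder0: "\<forall>K t n. \<bar>n\<bar> \<le> int K \<longrightarrow> ((\<lambda>r. u K r n) has_vector_derivative - Lseq (u K t) n) (at t)"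
    and ucont0: "\<forall>K n. continuous_on UNIV (\<lambda>r. u K r n)"
    and usupp: "\<forall>K. \<exists>N. \<forall>t n. \<bar>n\<bar> > int N \<longrightarrow> u K t n = 0"
    and cauchy0: "\<forall>K J. \<forall>t\<in>{0..T}. K \<le> J \<longrightarrow> hsq s (\<lambda>n. u J t n - u K t n) \<le> \<epsilon> K"
    and lim: "\<epsilon> \<longlonglongrightarrow> 0"
    by (elim exE conjE) (rule that)
  note useq = useq0[rule_format] and uder = uder0[rule_format] and ucont = ucont0[rule_format]
  have cauchy: "hsq s (\<lambda>n. u J t n - u K t n) \<le> \<epsilon> K" if "K \<le> J" "t \<in> {0..T}" for J K t
    using cauchy0 that by blast
  have conv: "convergent (\<lambda>K. u K t n)" if t: "t \<in> {0..T}" for t n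
  proof (rule Cauchy_convergent, rule metric_CauchyI)
    fix e :: real assume "e > 0"
    hence "\<forall>\<^sub>F K in sequentially. \<epsilon> K < (e / 2)\<^sup>2" by (intro order_tendstoD(2)[OF lim]) simp
    then obtain K where K: "\<epsilon> K < (e / 2)\<^sup>2" using eventually_happens'[OF sequentially_bot] by blast
    have near: "dist (u J t n) (u K t n) < e / 2" if "J \<ge> K" for J
    proof -
      have "(cmod (u J t n - u K t n))\<^sup>2 \<le> hsq s (\<lambda>n. u J t n - u K t n)"
        by (rule hsq_ge_term[of "\<lambda>n. u J t n - u K t n"]) (intro hseq_diff useq)
      also have "\<dots> \<le> \<epsilon> K" by (rule cauchy[OF that t])
      also note K
      finally have "(cmod (u J t n - u K t n))\<^sup>2 < (e / 2)\<^sup>2" .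
      from power_less_imp_less_base[OF this] \<open>e > 0\<close> show ?thesis by (simp add: dist_norm)
    qed
    have "dist (u J t n) (u J' t n) < e" if "J \<ge> K" "J' \<ge> K" for J J'
      by (rule dist_triangle_half_l[OF near[OF that(1)] near[OF that(2)]])
    thus "\<exists>K. \<forall>J\<ge>K. \<forall>J'\<ge>K. dist (u J t n) (u J' t n) < e" by blast
  qed
  define c where "c t n = lim (\<lambda>K. u K t n)" for t n
  have clim: "(\<lambda>K. u K t n) \<longlonglongrightarrow> c t n" if "t \<in> {0..T}" for t n
    using conv[OF that, of n] unfolding c_def convergent_LIMSEQ_iff .
  have close: "(\<lambda>n. c t n - u K t n) \<in> hseq s \<and> hsq s (\<lambda>n. c t n - u K t n) \<le> \<epsilon> K"
    if t: "t \<in> {0..T}" for t K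
  proof -
    have "(\<Sum>n\<in>F. wt s n * (cmod (c t n - u K t n))\<^sup>2) \<le> \<epsilon> K" if F: "finite F" for F
    proof (rule tendsto_upperbound)
      show "(\<lambda>J. \<Sum>n\<in>F. wt s n * (cmod (u J t n - u K t n))\<^sup>2)
          \<longlonglongrightarrow> (\<Sum>n\<in>F. wt s n * (cmod (c t n - u K t n))\<^sup>2)"
        by (intro tendsto_intros clim t)
      show "\<forall>\<^sub>F J in sequentially. (\<Sum>n\<in>F. wt s n * (cmod (u J t n - u K t n))\<^sup>2) \<le> \<epsilon> K"
        by (intro eventually_sequentiallyI[of K])
           (rule order_trans[OF hsq_ge_sum[OF hseq_diff[OF useq useq] F] cauchy[OF _ t]])
    qed simp
    from hseqI[OF this] show ?thesis by blast
  qed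
  have cseq: "c t \<in> hseq s" if t: "t \<in> {0..T}" for t
    using hseq_add[OF conjunct1[OF close[OF t, of 0]] useq[of 0 t s]] by simp
  have "c 0 n = c0 n" for n
  proof (rule LIMSEQ_unique[OF clim])
    show "0 \<in> {0..T}" using T by simp
    show "(\<lambda>K. u K 0 n) \<longlonglongrightarrow> c0 n" unfolding u0[rule_format]
      by (rule tendsto_eventually, rule eventually_sequentiallyI[of "nat \<bar>n\<bar>"]) (auto simp: trunc_def)
  qed
  hence 1: "c 0 = c0" by (rule ext)
  have 2: "hcont T s c" unfolding hcont_def
  proof (intro ballI conjI cseq)
    fix t assume t: "t \<in> {0..T}"
    show "((\<lambda>r. hsq s (\<lambda>n. c r n - c t n)) \<longlongrightarrow> 0) (at t within {0..T})"
    proof (rule tendstoI)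
      fix e :: real assume "e > 0"
      hence "\<forall>\<^sub>F K in sequentially. \<epsilon> K < e / 12" by (intro order_tendstoD(2)[OF lim]) simp
      then obtain K where K: "\<epsilon> K < e / 12" using eventually_happens'[OF sequentially_bot] by blast
      obtain N where N: "\<And>t n. \<bar>n\<bar> > int N \<Longrightarrow> u K t n = 0" using usupp by metis
      have "hsq s (\<lambda>n. u K r n - u K t n) = (\<Sum>n\<in>{- int N..int N}. wt s n * (cmod (u K r n - u K t n))\<^sup>2)" for r
        by (rule hsq_finite_support(2)) (simp add: N)
      moreover have "((\<lambda>r. \<Sum>n\<in>{- int N..int N}. wt s n * (cmod (u K r n - u K t n))\<^sup>2)
          \<longlongrightarrow> (\<Sum>n\<in>{- int N..int N}. wt s n * (cmod (u K t n - u K t n))\<^sup>2)) (at t within {0..T})"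
        using ucont[of K] continuous_on_subset[OF ucont, of "{0..T}" K] t
        by (intro tendsto_intros) (auto simp: continuous_on_def)
      ultimately have "((\<lambda>r. hsq s (\<lambda>n. u K r n - u K t n)) \<longlongrightarrow> 0) (at t within {0..T})" by simp
      hence ev: "\<forall>\<^sub>F r in at t within {0..T}. hsq s (\<lambda>n. u K r n - u K t n) < e / 8"
        using \<open>e > 0\<close> by (intro order_tendstoD(2)) auto
      have "\<forall>\<^sub>F r in at t within {0..T}. r \<in> {0..T}" by (simp add: eventually_at_filter)
      have arith: "a < e" if "a \<le> 2 * b + 2 * d" "b \<le> 2 * x + 2 * y" "x \<le> k" "y \<le> k" "k < e / 12" "d < e / 8"
        for a b d x y k :: real using that \<open>e > 0\<close> by linarith
      from ev \<open>\<forall>\<^sub>F r in at t within {0..T}. r \<in> {0..T}\<close> show "\<forall>\<^sub>F r in at t within {0..T}. dist (hsq s (\<lambda>n. c r n - c t n)) 0 < e"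
      proof eventually_elim
        case (elim r)
        note r = close[OF elim(2), of K] and tt = close[OF t, of K]
        have m: "(\<lambda>n. u K r n - u K t n) \<in> hseq s" by (intro hseq_diff useq)
        have eq: "(\<lambda>n. c r n - c t n)
            = (\<lambda>n. ((c r n - u K r n) - (c t n - u K t n)) + (u K r n - u K t n))" by auto
        have "hsq s (\<lambda>n. c r n - c t n) \<le>
            2 * hsq s (\<lambda>n. (c r n - u K r n) - (c t n - u K t n)) + 2 * hsq s (\<lambda>n. u K r n - u K t n)"
          unfolding eq by (rule hsq_add_le[OF hseq_diff[OF conjunct1[OF r] conjunct1[OF tt]] m])
        moreover have "hsq s (\<lambda>n. (c r n - u K r n) - (c t n - u K t n))
            \<le> 2 * hsq s (\<lambda>n. c r n - u K r n) + 2 * hsq s (\<lambda>n. c t n - u K t n)"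
          using r tt by (intro hsq_diff_le) auto
        ultimately have "hsq s (\<lambda>n. c r n - c t n) < e" using conjunct2[OF r] conjunct2[OF tt] K elim(1) by (rule arith)
        thus ?case by simp
      qed
    qed
  qed
  have 3: "coeff_solution T c" unfolding coeff_solution_def
  proof (intro ballI allI)
    fix t n assume t: "t \<in> {0..T}"
    obtain B where B: "B \<ge> 0" "\<And>d. d \<in> hseq 0 \<Longrightarrow> cmod (Lseq d n) \<le> B * sqrt (hsq 0 d)"
      using Lseq_coord_bound by metis
    (* entry n satisfies its equation only from the index m of the sequence on *)
    define m where "m = nat \<bar>n\<bar>"
    have "\<exists>g. \<forall>x\<in>{0..T}. (\<lambda>K. u (K + m) x n) \<longlonglongrightarrow> g x \<and>
        (g has_derivative (\<lambda>h. h *\<^sub>R - Lseq (c x) n)) (at x within {0..T})"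
    proof (rule has_derivative_sequence[where f = "\<lambda>K x. u (K + m) x n" and ?x0.0 = t and l = "c t n" and f' = "\<lambda>K x h. h *\<^sub>R - Lseq (u (K + m) x) n"])
      show "((\<lambda>x. u (K + m) x n) has_derivative (\<lambda>h. h *\<^sub>R - Lseq (u (K + m) x) n)) (at x within {0..T})" for K x
        using has_vector_derivative_at_within[OF uder[of n "K + m" x]]
        by (simp add: has_vector_derivative_def m_def)
      fix e :: real assume e: "e > 0"
      have "((\<lambda>K. B * sqrt (\<epsilon> (K + m))) \<longlonglongrightarrow> B * sqrt 0)"
        by (intro tendsto_intros LIMSEQ_ignore_initial_segment lim)
      hence "\<forall>\<^sub>F K in sequentially. B * sqrt (\<epsilon> (K + m)) < e" using e by (intro order_tendstoD(2)) auto
      thus "\<forall>\<^sub>F K in sequentially. \<forall>x\<in>{0..T}. \<forall>h. norm (h *\<^sub>R - Lseq (u (K + m) x) n - h *\<^sub>R - Lseq (c x) n) \<le> e * norm h"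
      proof eventually_elim
        case (elim K)
        show ?case
        proof (intro ballI allI)
          fix x h assume x: "x \<in> {0..T}"
          have "norm (h *\<^sub>R - Lseq (u (K + m) x) n - h *\<^sub>R - Lseq (c x) n)
              = \<bar>h\<bar> * cmod (Lseq (c x) n - Lseq (u (K + m) x) n)"
            unfolding scaleR_diff_right [symmetric] norm_scaleR by (simp add: norm_minus_commute)
          also have "Lseq (c x) n - Lseq (u (K + m) x) n = Lseq (\<lambda>n. c x n - u (K + m) x n) n"
            by (rule Lseq_diff [symmetric]) (use hseq_mono[OF cseq[OF x], of 0] useq in auto)
          also have "cmod \<dots> \<le> B * sqrt (hsq 0 (\<lambda>n. c x n - u (K + m) x n))"
            using close[OF x] hseq_mono by (intro B) blast
          also have "hsq 0 (\<lambda>n. c x n - u (K + m) x n) \<le> \<epsilon> (K + m)"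
            using close[OF x, of "K + m"] hsq_mono[of "\<lambda>n. c x n - u (K + m) x n" s 0] by linarith
          finally have "norm (h *\<^sub>R - Lseq (u (K + m) x) n - h *\<^sub>R - Lseq (c x) n) \<le> \<bar>h\<bar> * (B * sqrt (\<epsilon> (K + m)))"
            using B(1) by (simp add: mult_left_mono)
          also have "\<dots> \<le> \<bar>h\<bar> * e" using elim by (intro mult_left_mono) auto
          finally show "norm (h *\<^sub>R - Lseq (u (K + m) x) n - h *\<^sub>R - Lseq (c x) n) \<le> e * norm h"
            by (simp add: mult.commute)
        qed
      qed
    next
      show "(\<lambda>K. u (K + m) t n) \<longlonglongrightarrow> c t n" by (rule LIMSEQ_ignore_initial_segment) (rule clim[OF t])
    qed (use t in auto)
    then obtain g where g: "\<And>x. x \<in> {0..T} \<Longrightarrow> (\<lambda>K. u (K + m) x n) \<longlonglongrightarrow> g x"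
      "\<And>x. x \<in> {0..T} \<Longrightarrow> (g has_derivative (\<lambda>h. h *\<^sub>R - Lseq (c x) n)) (at x within {0..T})" by blast
    have gc: "g x = c x n" if "x \<in> {0..T}" for x :: real
      by (rule LIMSEQ_unique[OF g(1)[OF that] LIMSEQ_ignore_initial_segment[OF clim[OF that]]])
    have "(g has_vector_derivative - Lseq (c t) n) (at t within {0..T})"
      using g(2)[OF t] by (simp add: has_vector_derivative_def)
    thus "((\<lambda>r. c r n) has_vector_derivative - Lseq (c t) n) (at t within {0..T})"
      by (rule has_vector_derivative_transform[where f = g, rotated 2]) (use t gc in auto)
  qed
  from 1 2 3 show thesis by (rule that)
qed

section \<open>Curves of coefficient families\<close>

lemma hcont_seq: "hcont T s c \<Longrightarrow> t \<in> {0..T} \<Longrightarrow> c t \<in> hseq s"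
  by (simp add: hcont_def)

lemma hcont_tendsto:
  "hcont T s c \<Longrightarrow> t \<in> {0..T} \<Longrightarrow> ((\<lambda>r. hsq s (\<lambda>n. c r n - c t n)) \<longlongrightarrow> 0) (at t within {0..T})"
  by (simp add: hcont_def)

lemma eventually_in_interval: "\<forall>\<^sub>F r in at t within S. r \<in> S"
  by (simp add: eventually_at_filter)

text \<open>
  Bounded linear maps preserve continuity in time.
\<close>

lemma hcont_contraction:
  assumes c: "hcont T s c" and "B \<ge> 0"
    and A: "\<And>x. x \<in> hseq s \<Longrightarrow> A x \<in> hseq r" "\<And>x. x \<in> hseq s \<Longrightarrow> hsq r (A x) \<le> B * hsq s x"
    and lin: "\<And>x y. x \<in> hseq s \<Longrightarrow> y \<in> hseq s \<Longrightarrow> A (\<lambda>n. x n - y n) = (\<lambda>n. A x n - A y n)"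
  shows "hcont T r (\<lambda>t. A (c t))"
  unfolding hcont_def
proof (intro ballI conjI)
  fix t assume t: "t \<in> {0..T}"
  show "A (c t) \<in> hseq r" by (intro A hcont_seq[OF c t])
  have "((\<lambda>u. B * hsq s (\<lambda>n. c u n - c t n)) \<longlongrightarrow> B * 0) (at t within {0..T})"
    by (intro tendsto_intros hcont_tendsto[OF c t])
  hence lim: "((\<lambda>u. B * hsq s (\<lambda>n. c u n - c t n)) \<longlongrightarrow> 0) (at t within {0..T})" by simp
  show "((\<lambda>u. hsq r (\<lambda>n. A (c u) n - A (c t) n)) \<longlongrightarrow> 0) (at t within {0..T})"
  proof (rule tendsto_sandwich[OF _ _ tendsto_const lim])
    show "\<forall>\<^sub>F u in at t within {0..T}. 0 \<le> hsq r (\<lambda>n. A (c u) n - A (c t) n)" by simp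
    show "\<forall>\<^sub>F u in at t within {0..T}. hsq r (\<lambda>n. A (c u) n - A (c t) n) \<le> B * hsq s (\<lambda>n. c u n - c t n)"
      using eventually_in_interval
    proof eventually_elim
      case (elim u)
      note seq = hcont_seq[OF c elim] hcont_seq[OF c t]
      show ?case using A(2)[OF hseq_diff[OF seq]] by (simp add: lin[OF seq])
    qed
  qed
qed

lemma hcont_mono: "hcont T s c \<Longrightarrow> r \<le> s \<Longrightarrow> hcont T r c"
  using hcont_contraction[of T s c 1 "\<lambda>x. x" r] hseq_mono hsq_mono by auto

lemma hcont_Lseq:
  assumes "hcont T (Suc s) c"
  shows "hcont T s (\<lambda>t. Lseq (c t))"
proof -
  obtain C where C: "C \<ge> 0" "\<And>c. c \<in> hseq (Suc s) \<Longrightarrow> Lseq c \<in> hseq s"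
    "\<And>c. c \<in> hseq (Suc s) \<Longrightarrow> hsq s (Lseq c) \<le> C * hsq (Suc s) c"
    using Lseq_bound[of s] by metis
  show ?thesis
    by (rule hcont_contraction[OF assms C])
       (auto simp: fun_eq_iff intro!: Lseq_diff intro: hseq_mono)
qed

lemma hcont_scale: "hcont T s c \<Longrightarrow> hcont T s (\<lambda>t n. z * c t n)"
  by (rule hcont_contraction[of T s c "(cmod z)\<^sup>2"])
     (simp_all add: hseq_scale hsq_scale_le right_diff_distrib)

lemma hsq_cnj_reflect: "hsq s (\<lambda>n. cnj (c (- n))) = hsq s c"
  unfolding hsq_def
  by (subst infsum_reindex_bij_betw[of uminus UNIV UNIV "\<lambda>n. wt s n * (cmod (c n))\<^sup>2", symmetric])
     (auto intro: bij_uminus simp: wt_def)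

lemma hcont_cnj_reflect: "hcont T s c \<Longrightarrow> hcont T s (\<lambda>t n. cnj (c t (- n)))"
  by (rule hcont_contraction[of T s c 1]) (auto intro: hseq_cnj_reflect simp: hsq_cnj_reflect)

text \<open>
  Norm continuity gives local bounds, and compactness of \<open>[0,T]\<close> makes them uniform.
\<close>

lemma hcont_bounded:
  assumes c: "hcont T s c"
  obtains B where "B \<ge> 0" "\<And>t. t \<in> {0..T} \<Longrightarrow> hsq s (c t) \<le> B"
proof -
  have "\<exists>B. \<forall>t\<in>{0..T}. hsq s (c t) \<le> B"
  proof (rule ccontr)
    assume "\<not> ?thesis"
    hence "\<forall>j::nat. \<exists>t\<in>{0..T}. hsq s (c t) > real j" by (auto simp: not_le)
    then obtain \<tau> where \<tau>: "\<And>j::nat. \<tau> j \<in> {0..T}" "\<And>j. hsq s (c (\<tau> j)) > real j" by metis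
    have "seq_compact {0..T}" by (simp add: compact_imp_seq_compact)
    then obtain t \<rho> where t: "t \<in> {0..T}" and \<rho>: "strict_mono (\<rho> :: nat \<Rightarrow> nat)" "(\<tau> \<circ> \<rho>) \<longlonglongrightarrow> t"
      using \<tau>(1) by (metis seq_compactE)
    have "\<forall>\<^sub>F r in at t within {0..T}. hsq s (\<lambda>n. c r n - c t n) < 1"
      by (rule order_tendstoD(2)[OF hcont_tendsto[OF c t]]) simp
    then obtain d where d: "d > 0"
      "\<And>r. r \<in> {0..T} \<Longrightarrow> r \<noteq> t \<Longrightarrow> dist r t < d \<Longrightarrow> hsq s (\<lambda>n. c r n - c t n) < 1"
      unfolding eventually_at by blast
    have "\<forall>\<^sub>F j in sequentially. dist ((\<tau> \<circ> \<rho>) j) t < d" using \<rho>(2) d(1) by (rule tendstoD)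
    hence "\<forall>\<^sub>F j in sequentially. hsq s (c (\<tau> (\<rho> j))) \<le> 2 + 2 * hsq s (c t)"
    proof eventually_elim
      case (elim j)
      let ?r = "\<tau> (\<rho> j)"
      have "hsq s (\<lambda>n. c ?r n - c t n) \<le> 1"
      proof (cases "?r = t")
        case True
        thus ?thesis by (simp add: hsq_def)
      next
        case False
        thus ?thesis using d(2)[of ?r] \<tau>(1) elim by force
      qed
      moreover have "hsq s (c ?r) \<le> 2 * hsq s (\<lambda>n. c ?r n - c t n) + 2 * hsq s (c t)"
        using hsq_add_le[OF hseq_diff[OF hcont_seq[OF c \<tau>(1)] hcont_seq[OF c t]] hcont_seq[OF c t]] by simp
      ultimately show ?case by linarith
    qed
    moreover obtain M :: nat where M: "2 + 2 * hsq s (c t) < real M" using reals_Archimedean2 by blast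
    have "\<forall>\<^sub>F j in sequentially. hsq s (c (\<tau> (\<rho> j))) > real M"
    proof (rule eventually_sequentiallyI[of M])
      fix j assume "M \<le> j"
      hence "real M \<le> real (\<rho> j)" using seq_suble[OF \<rho>(1), of j] by simp
      thus "hsq s (c (\<tau> (\<rho> j))) > real M" using \<tau>(2)[of "\<rho> j"] by linarith
    qed
    ultimately have "\<forall>\<^sub>F j in sequentially. False" by eventually_elim (use M in linarith)
    thus False by simp
  qed
  then obtain B where "\<forall>t\<in>{0..T}. hsq s (c t) \<le> B" by blast
  thus thesis using that[of "max B 0"] by force
qed

text \<open>
  The mean value inequality in a Hilbert space: test \<open>e y - e x\<close> with itself. Only finitely many entries
  are involved, with a bound that does not depend on which ones.
\<close>

lemma weighted_mean_value:
  fixes e :: "real \<Rightarrow> int \<Rightarrow> complex"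
  assumes F: "finite F" and S: "convex S" "x \<in> S" "y \<in> S"
    and der: "\<And>r n. r \<in> S \<Longrightarrow> ((\<lambda>r. e r n) has_vector_derivative e' r n) (at r within S)"
    and bd: "\<And>r. r \<in> S \<Longrightarrow> (\<Sum>n\<in>F. wt s n * (cmod (e' r n))\<^sup>2) \<le> B\<^sup>2" and B: "B \<ge> 0"
  shows "(\<Sum>n\<in>F. wt s n * (cmod (e y n - e x n))\<^sup>2) \<le> (B * \<bar>y - x\<bar>)\<^sup>2"
proof -
  (* psi r is the real scalar product of the fixed vector e y - e x with e r *)
  define D where "D n = e y n - e x n" for n
  define q where "q = (\<Sum>n\<in>F. wt s n * (cmod (D n))\<^sup>2)"
  have q: "q \<ge> 0" unfolding q_def by (intro sum_nonneg) simp
  define \<psi> where "\<psi> r = (\<Sum>n\<in>F. wt s n * (Re (D n) * Re (e r n) + Im (D n) * Im (e r n)))" for r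
  define \<psi>' where "\<psi>' r = (\<Sum>n\<in>F. wt s n * (Re (D n) * Re (e' r n) + Im (D n) * Im (e' r n)))" for r
  have d\<psi>: "(\<psi> has_real_derivative \<psi>' r) (at r within S)" if "r \<in> S" for r
    unfolding \<psi>_def \<psi>'_def
    using der[OF that, unfolded has_vector_derivative_complex_iff]
    by (intro DERIV_sum DERIV_cmult DERIV_add) auto
  have "norm (\<psi> y - \<psi> x) \<le> (sqrt q * B) * norm (y - x)"
  proof (rule field_differentiable_bound[OF S(1) d\<psi> _ S(3) S(2)])
    fix r assume r: "r \<in> S"
    have "\<bar>\<psi>' r\<bar> \<le> (\<Sum>n\<in>F. (sqrt (wt s n) * cmod (D n)) * (sqrt (wt s n) * cmod (e' r n)))"
      unfolding \<psi>'_def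
    proof (rule order_trans[OF sum_abs sum_mono])
      fix n
      have "Re (D n) * Re (e' r n) + Im (D n) * Im (e' r n) = Re (cnj (D n) * e' r n)" by simp
      hence "\<bar>Re (D n) * Re (e' r n) + Im (D n) * Im (e' r n)\<bar> \<le> cmod (D n) * cmod (e' r n)"
        using abs_Re_le_cmod[of "cnj (D n) * e' r n"] by (simp add: norm_mult)
      hence "wt s n * \<bar>Re (D n) * Re (e' r n) + Im (D n) * Im (e' r n)\<bar>
          \<le> (sqrt (wt s n) * sqrt (wt s n)) * (cmod (D n) * cmod (e' r n))"
        by (simp add: mult_left_mono)
      thus "\<bar>wt s n * (Re (D n) * Re (e' r n) + Im (D n) * Im (e' r n))\<bar>
          \<le> (sqrt (wt s n) * cmod (D n)) * (sqrt (wt s n) * cmod (e' r n))"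
        by (simp only: abs_mult mult_ac abs_of_nonneg[OF wt_nonneg])
    qed
    also have "\<dots> \<le> sqrt q * B"
    proof (rule power2_le_imp_le)
      have "(\<Sum>n\<in>F. (sqrt (wt s n) * cmod (D n)) * (sqrt (wt s n) * cmod (e' r n)))\<^sup>2
          \<le> (\<Sum>n\<in>F. (sqrt (wt s n) * cmod (D n))\<^sup>2) * (\<Sum>n\<in>F. (sqrt (wt s n) * cmod (e' r n))\<^sup>2)"
        by (rule Cauchy_Schwarz_ineq_sum)
      also have "\<dots> = q * (\<Sum>n\<in>F. wt s n * (cmod (e' r n))\<^sup>2)"
        by (simp add: q_def power_mult_distrib)
      also have "\<dots> \<le> q * B\<^sup>2" by (intro mult_left_mono bd r q)
      finally show "(\<Sum>n\<in>F. (sqrt (wt s n) * cmod (D n)) * (sqrt (wt s n) * cmod (e' r n)))\<^sup>2 \<le> (sqrt q * B)\<^sup>2"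
        using q by (simp add: power_mult_distrib)
    qed (use q B in simp)
    finally show "norm (\<psi>' r) \<le> sqrt q * B" by simp
  qed
  moreover have "\<psi> y - \<psi> x = q"
    unfolding \<psi>_def q_def sum_subtractf [symmetric] cmod_power2 D_def
    by (rule sum.cong) (simp_all add: power2_eq_square algebra_simps)
  ultimately have "q \<le> (sqrt q * B) * \<bar>y - x\<bar>" using q by simp
  hence "sqrt q * sqrt q \<le> sqrt q * (B * \<bar>y - x\<bar>)" using q by (simp add: mult_ac)
  hence "sqrt q \<le> B * \<bar>y - x\<bar>"
  proof (cases "q = 0")
    case False
    hence "sqrt q > 0" using q by simp
    with \<open>sqrt q * sqrt q \<le> sqrt q * (B * \<bar>y - x\<bar>)\<close> show ?thesis by (rule mult_left_le_imp_le)
  qed (use B in simp)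
  hence "(sqrt q)\<^sup>2 \<le> (B * \<bar>y - x\<bar>)\<^sup>2" by (intro power_mono) (use q in auto)
  thus ?thesis using q by (simp add: q_def D_def)
qed

text \<open>
  If the entries of \<open>c\<close> are differentiable and the family of derivatives is continuous in the norm, then
  \<open>c\<close> is differentiable in the norm. The mean value inequality is applied to \<open>c u - u * c' t\<close>, whose
  derivative \<open>c' u - c' t\<close> is small near \<open>t\<close>.
\<close>

theorem hcont_derivative:
  assumes der: "\<And>t n. t \<in> {0..T} \<Longrightarrow> ((\<lambda>r. c r n) has_vector_derivative c' t n) (at t within {0..T})"
    and c': "hcont T s c'" and t: "t \<in> {0..T}"
  shows "((\<lambda>r. hsq s (\<lambda>n. (c r n - c t n) / of_real (r - t) - c' t n)) \<longlongrightarrow> 0) (at t within {0..T})"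
proof (rule tendstoI)
  fix \<epsilon> :: real assume "\<epsilon> > 0"
  define B where "B = sqrt (\<epsilon> / 2)"
  have B: "B > 0" "B\<^sup>2 = \<epsilon> / 2" using \<open>\<epsilon> > 0\<close> by (auto simp: B_def)
  have "\<forall>\<^sub>F r in at t within {0..T}. hsq s (\<lambda>n. c' r n - c' t n) < B\<^sup>2"
    by (rule order_tendstoD(2)[OF hcont_tendsto[OF c' t]]) (use B in simp)
  then obtain d where d: "d > 0"
    "\<And>r. r \<in> {0..T} \<Longrightarrow> r \<noteq> t \<Longrightarrow> dist r t < d \<Longrightarrow> hsq s (\<lambda>n. c' r n - c' t n) < B\<^sup>2"
    unfolding eventually_at by blast
  show "\<forall>\<^sub>F r in at t within {0..T}.
      dist (hsq s (\<lambda>n. (c r n - c t n) / of_real (r - t) - c' t n)) 0 < \<epsilon>"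
    unfolding eventually_at
  proof (intro exI[of _ d] conjI ballI impI d(1))
    fix r assume r: "r \<in> {0..T}" and rt: "r \<noteq> t \<and> dist r t < d"
    define S where "S = {0..T} \<inter> ball t d"
    have S: "convex S" "t \<in> S" "r \<in> S" "S \<subseteq> {0..T}"
      using t r rt d(1) by (auto simp: S_def dist_commute intro!: convex_Int)
    define e where "e u n = c u n - of_real u * c' t n" for u n
    have "hsq s (\<lambda>n. (c r n - c t n) / of_real (r - t) - c' t n) \<le> B\<^sup>2"
    proof (rule hseqI(2))
      fix F :: "int set" assume F: "finite F"
      have "(\<Sum>n\<in>F. wt s n * (cmod (e r n - e t n))\<^sup>2) \<le> (B * \<bar>r - t\<bar>)\<^sup>2"
      proof (rule weighted_mean_value[OF F S(1) S(2) S(3)])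
        fix u n assume u: "u \<in> S"
        have "((\<lambda>u. c u n) has_vector_derivative c' u n) (at u within S)"
          using has_vector_derivative_within_subset[OF der[of u n] S(4)] u S(4) by blast
        moreover have "((\<lambda>u. of_real u * c' t n) has_vector_derivative c' t n) (at u within S)"
          unfolding has_vector_derivative_complex_iff by (auto intro!: derivative_eq_intros)
        ultimately show "((\<lambda>u. e u n) has_vector_derivative c' u n - c' t n) (at u within S)"
          unfolding e_def by (rule has_vector_derivative_diff)
      next
        fix u assume u: "u \<in> S"
        have "hsq s (\<lambda>n. c' u n - c' t n) \<le> B\<^sup>2"
        proof (cases "u = t")
          case True
          thus ?thesis by (simp add: hsq_def)
        next
          case False
          thus ?thesis using d(2)[of u] u by (force simp: S_def dist_commute)
        qed
        moreover have "(\<Sum>n\<in>F. wt s n * (cmod (c' u n - c' t n))\<^sup>2) \<le> hsq s (\<lambda>n. c' u n - c' t n)"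
          using u S(4) by (intro hsq_ge_sum F hseq_diff hcont_seq[OF c'] t) auto
        ultimately show "(\<Sum>n\<in>F. wt s n * (cmod (c' u n - c' t n))\<^sup>2) \<le> B\<^sup>2" by linarith
      qed (use B in simp)
      moreover have "wt s n * (cmod ((c r n - c t n) / of_real (r - t) - c' t n))\<^sup>2
          = (wt s n * (cmod (e r n - e t n))\<^sup>2) / (r - t)\<^sup>2" for n
      proof -
        have "(c r n - c t n) / of_real (r - t) - c' t n = (e r n - e t n) / of_real (r - t)"
          using rt by (simp add: e_def field_simps)
        thus ?thesis by (simp add: norm_divide power_divide del: of_real_diff)
      qed
      ultimately show "(\<Sum>n\<in>F. wt s n * (cmod ((c r n - c t n) / of_real (r - t) - c' t n))\<^sup>2) \<le> B\<^sup>2"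
        using rt by (simp add: sum_divide_distrib [symmetric] power_mult_distrib divide_le_eq)
    qed
    thus "dist (hsq s (\<lambda>n. (c r n - c t n) / of_real (r - t) - c' t n)) 0 < \<epsilon>"
      using B(2) \<open>\<epsilon> > 0\<close> by simp
  qed
qed

lemma has_vector_derivative_complex_quotient:
  fixes f :: "real \<Rightarrow> complex"
  shows "(f has_vector_derivative f') (at t within S) \<longleftrightarrow>
    ((\<lambda>r. (f r - f t) / of_real (r - t)) \<longlongrightarrow> f') (at t within S)"
  unfolding has_vector_derivative_complex_iff has_field_derivative_iff tendsto_complex_iff
  by (simp add: Re_divide_of_real Im_divide_of_real del: of_real_diff)

text \<open>
  Entries of \<open>Lseq c\<close> involve the infinite sum \<open>vsum c\<close>, so this needs the convergence of the difference quotients in norm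
  and not only entry by entry.
\<close>

lemma Lseq_has_vector_derivative:
  assumes c: "\<And>t. t \<in> {0..T} \<Longrightarrow> c t \<in> hseq 0"
    and der: "\<And>t n. t \<in> {0..T} \<Longrightarrow> ((\<lambda>r. c r n) has_vector_derivative c' t n) (at t within {0..T})"
    and c': "hcont T 0 c'" and t: "t \<in> {0..T}"
  shows "((\<lambda>r. Lseq (c r) n) has_vector_derivative Lseq (c' t) n) (at t within {0..T})"
  unfolding has_vector_derivative_complex_quotient
proof (rule LIM_zero_cancel)
  obtain B where B: "B \<ge> 0" "\<And>d. d \<in> hseq 0 \<Longrightarrow> cmod (Lseq d n) \<le> B * sqrt (hsq 0 d)"
    using Lseq_coord_bound by metis
  let ?q = "\<lambda>r n. (c r n - c t n) / of_real (r - t) - c' t n"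
  have "((\<lambda>r. B * sqrt (hsq 0 (?q r))) \<longlongrightarrow> B * sqrt 0) (at t within {0..T})"
    by (intro tendsto_intros hcont_derivative[OF der c' t])
  hence lim: "((\<lambda>r. B * sqrt (hsq 0 (?q r))) \<longlongrightarrow> 0) (at t within {0..T})" by simp
  show "((\<lambda>r. (Lseq (c r) n - Lseq (c t) n) / of_real (r - t) - Lseq (c' t) n) \<longlongrightarrow> 0) (at t within {0..T})"
  proof (rule Lim_null_comparison[OF _ lim])
    show "\<forall>\<^sub>F r in at t within {0..T}. norm ((Lseq (c r) n - Lseq (c t) n) / of_real (r - t) - Lseq (c' t) n)
        \<le> B * sqrt (hsq 0 (?q r))"
      using eventually_in_interval
    proof eventually_elim
      case (elim r)
      have d: "(\<lambda>n. c r n - c t n) \<in> hseq 0" by (intro hseq_diff c elim t)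
      have d2: "(\<lambda>n. (1 / of_real (r - t)) * (c r n - c t n)) \<in> hseq 0" by (rule hseq_scale[OF d])
      have ct: "c' t \<in> hseq 0" by (rule hcont_seq[OF c' t])
      have "Lseq (\<lambda>n. (1 / of_real (r - t)) * (c r n - c t n) - c' t n) n
          = (1 / of_real (r - t)) * (Lseq (c r) n - Lseq (c t) n) - Lseq (c' t) n"
        unfolding Lseq_diff[OF d2 ct] Lseq_scale Lseq_diff[OF c[OF elim] c[OF t]] ..
      moreover have "cmod (Lseq (\<lambda>n. (1 / of_real (r - t)) * (c r n - c t n) - c' t n) n)
          \<le> B * sqrt (hsq 0 (\<lambda>n. (1 / of_real (r - t)) * (c r n - c t n) - c' t n))"
        by (intro B hseq_diff d2 ct)
      ultimately show ?case by simp
    qed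
  qed
qed

text \<open>
  The truncated difference \<open>trunc N (d t)\<close> solves the truncated system with the forcing
  \<open>- Lseq (d t - trunc N (d t))\<close>. One derivative is lost in \<open>Lseq\<close>, and a second one is traded for the factor
  \<open>1 / (1 + N\<^sup>2)\<close>; hence the order \<open>2\<close> in the hypotheses.
\<close>

theorem coeff_solution_unique:
  assumes c: "hcont T 2 c" "coeff_solution T c" and z: "hcont T 2 z" "coeff_solution T z"
    and init: "c 0 = z 0" and t: "t \<in> {0..T}"
  shows "c t = z t"
proof
  fix k
  obtain Bc where Bc: "\<And>t. t \<in> {0..T} \<Longrightarrow> hsq 2 (c t) \<le> Bc" using hcont_bounded[OF c(1)] by metis
  obtain Bz where Bz: "\<And>t. t \<in> {0..T} \<Longrightarrow> hsq 2 (z t) \<le> Bz" using hcont_bounded[OF z(1)] by metis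
  define d where "d t n = c t n - z t n" for t n
  define B where "B = 2 * Bc + 2 * Bz"
  have dseq: "d t \<in> hseq 2" and dB: "hsq 2 (d t) \<le> B" if t: "t \<in> {0..T}" for t
  proof -
    note ct = hcont_seq[OF c(1) t] and zt = hcont_seq[OF z(1) t]
    show "d t \<in> hseq 2" using hseq_diff[OF ct zt] by (simp add: d_def[abs_def])
    show "hsq 2 (d t) \<le> B"
      using hsq_diff_le[OF ct zt] Bc[OF t] Bz[OF t] by (simp add: d_def[abs_def] B_def)
  qed
  have dder: "((\<lambda>r. d r n) has_vector_derivative - Lseq (d t) n) (at t within {0..T})"
    if t: "t \<in> {0..T}" for t n
  proof -
    have "((\<lambda>r. d r n) has_vector_derivative - Lseq (c t) n - - Lseq (z t) n) (at t within {0..T})"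
      unfolding d_def using c(2) z(2) t by (intro has_vector_derivative_diff) (auto simp: coeff_solution_def)
    moreover have "- Lseq (c t) n - - Lseq (z t) n = - Lseq (d t) n"
      unfolding d_def using hcont_seq[OF c(1) t] hcont_seq[OF z(1) t]
      by (subst Lseq_diff) (auto intro: hseq_mono)
    ultimately show ?thesis by simp
  qed
  obtain C where C_0: "C \<ge> 0" and C: "energy_bound 0 C"
    using energy_estimate[of 0] by blast
  obtain CL where CL: "CL \<ge> 0" "\<And>c. c \<in> hseq (Suc 0) \<Longrightarrow> Lseq c \<in> hseq 0"
    "\<And>c. c \<in> hseq (Suc 0) \<Longrightarrow> hsq 0 (Lseq c) \<le> CL * hsq (Suc 0) c"
    using Lseq_bound[of 0] by metis
  have "(cmod (d t k))\<^sup>2 \<le> exp (C * t) * ((CL * (B / (1 + (real N)\<^sup>2))) * t)" if "N \<ge> nat \<bar>k\<bar>" for N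
  proof -
    define g where "g t = Lseq (\<lambda>n. - 1 * (d t n - trunc N (d t) n))" for t
    have "hsq 0 (trunc N (d t)) \<le> exp (C * t) * (hsq 0 (trunc N (d 0)) + (CL * (B / (1 + (real N)\<^sup>2))) * t)"
    proof (rule C[unfolded energy_bound_def, rule_format, where g = g])
      fix t n assume t: "t \<in> {0..T}"
      have "g t n - Lseq (trunc N (d t)) n = - Lseq (d t) n"
        unfolding g_def Lseq_scale using hseq_mono[OF dseq[OF t], of 0]
        by (subst Lseq_diff) auto
      thus "((\<lambda>r. d r n) has_vector_derivative g t n - Lseq (trunc N (d t)) n) (at t within {0..T})"
        using dder[OF t] by simp
    next
      fix t assume t: "t \<in> {0..T}"
      have d2: "d t \<in> hseq (Suc (Suc 0))" using dseq[OF t] by (simp add: numeral_2_eq_2)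
      have d1: "(\<lambda>n. d t n - trunc N (d t) n) \<in> hseq (Suc 0)"
        by (intro hseq_diff hseq_trunc hseq_mono[OF d2]) simp
      have d1': "(\<lambda>n. - 1 * (d t n - trunc N (d t) n)) \<in> hseq (Suc 0)" by (rule hseq_scale[OF d1])
      have "hsq 0 (trunc N (g t)) \<le> hsq 0 (g t)" unfolding g_def by (intro hsq_trunc_le CL(2) d1')
      also have "\<dots> \<le> CL * hsq (Suc 0) (\<lambda>n. - 1 * (d t n - trunc N (d t) n))"
        unfolding g_def by (intro CL(3) d1')
      also have "\<dots> \<le> CL * hsq (Suc 0) (\<lambda>n. d t n - trunc N (d t) n)"
        using hsq_scale_le[OF d1, of "- 1"] CL(1) by (intro mult_left_mono) auto
      also have "\<dots> \<le> CL * (hsq (Suc (Suc 0)) (d t) / (1 + (real N)\<^sup>2))"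
        by (intro mult_left_mono hseq_tail d2 CL(1))
      also have "\<dots> \<le> CL * (B / (1 + (real N)\<^sup>2))"
        using dB[OF t] CL(1) by (intro mult_left_mono divide_right_mono)
          (auto simp: numeral_2_eq_2[symmetric] add_nonneg_nonneg)
      finally show "hsq 0 (trunc N (g t)) \<le> CL * (B / (1 + (real N)\<^sup>2))" .
    qed (rule t)
    also have "trunc N (d 0) = (\<lambda>_. 0)" using init by (simp add: d_def trunc_def fun_eq_iff)
    finally have "hsq 0 (trunc N (d t)) \<le> exp (C * t) * ((CL * (B / (1 + (real N)\<^sup>2))) * t)"
      by (simp add: hsq_def)
    moreover have "(cmod (trunc N (d t) k))\<^sup>2 \<le> hsq 0 (trunc N (d t))" by (rule hsq_ge_term) simp
    moreover have "trunc N (d t) k = d t k" using that by (simp add: trunc_def)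
    ultimately show ?thesis by simp
  qed
  hence "\<forall>\<^sub>F N in sequentially. (cmod (d t k))\<^sup>2 \<le> exp (C * t) * ((CL * (B / (1 + (real N)\<^sup>2))) * t)"
    by (rule eventually_sequentiallyI)
  moreover have "(\<lambda>N. exp (C * t) * ((CL * (B / (1 + (real N)\<^sup>2))) * t)) \<longlonglongrightarrow> exp (C * t) * ((CL * 0) * t)"
  proof (intro tendsto_mult tendsto_const)
    have "filterlim (\<lambda>K. 1 + (real K)\<^sup>2) at_top sequentially"
      by (intro filterlim_tendsto_add_at_top[OF tendsto_const] filterlim_pow_at_top filterlim_real_sequentially) simp
    thus "(\<lambda>N. B / (1 + (real N)\<^sup>2)) \<longlonglongrightarrow> 0"
      by (intro tendsto_divide_0[OF tendsto_const] filterlim_at_top_imp_at_infinity)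
  qed
  ultimately have "(cmod (d t k))\<^sup>2 \<le> exp (C * t) * ((CL * 0) * t)"
    by (intro tendsto_lowerbound[of _ _ sequentially]) auto
  thus "c t k = z t k" by (simp add: d_def)
qed

section \<open>Completeness of the trigonometric system\<close>

lemma integrable_times_bounded:
  fixes f :: "real \<Rightarrow> complex"
  assumes G: "integrable lborel G" and f: "f \<in> borel_measurable borel" "\<And>x. cmod (f x) \<le> B"
  shows "integrable lborel (\<lambda>x. complex_of_real (G x) * f x)"
proof (rule Bochner_Integration.integrable_bound)
  show "integrable lborel (\<lambda>x. B * G x)" using G by simp
  show "(\<lambda>x. complex_of_real (G x) * f x) \<in> borel_measurable lborel"
    using borel_measurable_integrable[OF G] f(1) by simp
  have "0 \<le> B" using f(2)[of 0] norm_ge_zero order_trans by blast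
  thus "AE x in lborel. norm (complex_of_real (G x) * f x) \<le> norm (B * G x)"
    using mult_right_mono[OF f(2) abs_ge_zero] by (intro AE_I2) (simp add: norm_mult abs_mult mult.commute)
qed

lemma bounded_on_circle:
  fixes p :: "complex \<Rightarrow> real"
  assumes "continuous_on UNIV p"
  obtains B where "\<And>x. \<bar>p (cis x)\<bar> \<le> B"
proof -
  have "compact (p ` sphere 0 1)"
    by (intro compact_continuous_image continuous_on_subset[OF assms]) auto
  then obtain B where "\<forall>y\<in>p ` sphere 0 1. norm y \<le> B"
    using compact_imp_bounded bounded_iff by metis
  hence "\<bar>p (cis x)\<bar> \<le> B" for x by force
  thus thesis by (rule that)
qed

text \<open>
  The set \<open>W\<close> of multipliers \<open>h\<close> for which \<open>G h\<close> is still orthogonal to all exponentials is invariant under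
  multiplication by real polynomials in \<open>cos x\<close> and \<open>sin x\<close>, because multiplication by the coordinate functions of
  \<open>cis x\<close> only shifts frequencies.
\<close>

lemma orthogonal_to_polynomials:
  assumes G: "integrable lborel G"
    and zero: "\<And>k::int. (LINT x|lborel. complex_of_real (G x) * cis (of_int k * x)) = 0"
    and p: "real_polynomial_function (p :: complex \<Rightarrow> real)"
  shows "(LINT x|lborel. G x * p (cis x)) = 0"
proof -
  define W where "W = {h :: real \<Rightarrow> complex. continuous_on UNIV h \<and> (\<exists>B. \<forall>x. cmod (h x) \<le> B) \<and>
    (\<forall>k::int. (LINT x|lborel. complex_of_real (G x) * (h x * cis (of_int k * x))) = 0)}"
  have int: "integrable lborel (\<lambda>x. complex_of_real (G x) * (h x * cis (of_int k * x)))"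
    if "h \<in> W" for h and k :: int
  proof -
    from that obtain B where B: "continuous_on UNIV h" "\<And>x. cmod (h x) \<le> B" by (auto simp: W_def)
    show ?thesis
      by (rule integrable_times_bounded[OF G, of _ B])
         (use B in \<open>auto simp: norm_mult intro!: borel_measurable_continuous_onI continuous_intros\<close>)
  qed
  have cont: "continuous_on UNIV p" by (rule continuous_on_polymonial_function[OF p[unfolded real_polynomial_function_eq]])
  have closed: "(\<lambda>x. h x * complex_of_real (p (cis x))) \<in> W" if "h \<in> W" for h
    using p that
  proof (induction arbitrary: h rule: real_polynomial_function.induct)
    case (linear l)
    have h: "continuous_on UNIV h" using linear(2) by (simp add: W_def)
    obtain B where B: "\<And>x. cmod (h x) \<le> B" using linear(2) by (auto simp: W_def)
    have lc: "continuous_on UNIV l" by (rule linear_continuous_on[OF linear(1)])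
    obtain B' where B': "\<And>x. \<bar>l (cis x)\<bar> \<le> B'" using bounded_on_circle[OF lc] by blast
    (* coefficients of cis x and cis (- x) in l (cis x) = cos x * l 1 + sin x * l i *)
    define \<alpha> where "\<alpha> = (complex_of_real (l 1) - \<i> * l \<i>) / 2"
    define \<beta> where "\<beta> = (complex_of_real (l 1) + \<i> * l \<i>) / 2"
    have l: "l (cis x) = cos x * l 1 + sin x * l \<i>" for x
    proof -
      have "cis x = cos x *\<^sub>R 1 + sin x *\<^sub>R \<i>" by (simp add: complex_eq_iff)
      thus ?thesis using linear(1) by (simp add: linear_add linear_scale bounded_linear.linear)
    qed
    have eq: "h x * complex_of_real (l (cis x)) * cis (of_int k * x)
        = \<alpha> * (h x * cis (of_int (k + 1) * x)) + \<beta> * (h x * cis (of_int (k - 1) * x))" for x and k :: int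
    proof -
      have "cis (of_int (k + 1) * x) = cis (of_int k * x) * cis x"
        "cis (of_int (k - 1) * x) = cis (of_int k * x) * cis (- x)"
        by (simp_all add: cis_mult algebra_simps)
      moreover have "complex_of_real (l (cis x)) = \<alpha> * cis x + \<beta> * cis (- x)"
        by (simp add: l \<alpha>_def \<beta>_def complex_eq_iff field_simps)
      ultimately show ?thesis by (simp add: algebra_simps)
    qed
    have "(LINT x|lborel. complex_of_real (G x) * (h x * complex_of_real (l (cis x)) * cis (of_int k * x))) = 0" for k :: int
    proof -
      have "(LINT x|lborel. complex_of_real (G x) * (h x * complex_of_real (l (cis x)) * cis (of_int k * x)))
        = (LINT x|lborel. \<alpha> * (complex_of_real (G x) * (h x * cis (of_int (k + 1) * x)))
            + \<beta> * (complex_of_real (G x) * (h x * cis (of_int (k - 1) * x))))"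
        unfolding eq by (simp add: algebra_simps)
      also have "\<dots> = \<alpha> * (LINT x|lborel. complex_of_real (G x) * (h x * cis (of_int (k + 1) * x)))
            + \<beta> * (LINT x|lborel. complex_of_real (G x) * (h x * cis (of_int (k - 1) * x)))"
        using int[OF linear(2), of "k + 1"] int[OF linear(2), of "k - 1"]
        by (subst Bochner_Integration.integral_add) (auto simp del: of_int_add of_int_diff)
      also have "\<dots> = 0" using linear(2) unfolding W_def by (simp del: of_int_add of_int_diff)
      finally show ?thesis .
    qed
    moreover have "continuous_on UNIV (\<lambda>x. h x * complex_of_real (l (cis x)))"
      by (intro continuous_intros h continuous_on_compose2[OF lc]) auto
    moreover have "cmod (h x * complex_of_real (l (cis x))) \<le> B * B'" for x
      unfolding norm_mult norm_of_real by (intro mult_mono B B' order_trans[OF norm_ge_zero B]) auto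
    ultimately show ?case unfolding W_def by blast
  next
    case (const c)
    obtain B where B: "\<And>x. cmod (h x) \<le> B" using const by (auto simp: W_def)
    have "(LINT x|lborel. complex_of_real (G x) * (h x * complex_of_real c * cis (of_int k * x)))
      = complex_of_real c * (LINT x|lborel. complex_of_real (G x) * (h x * cis (of_int k * x)))" for k :: int
      unfolding integral_mult_right_zero [symmetric] by (simp add: mult_ac)
    moreover have "cmod (h x * complex_of_real c) \<le> B * \<bar>c\<bar>" for x
      unfolding norm_mult norm_of_real by (intro mult_right_mono B) auto
    ultimately show ?case using const unfolding W_def by (auto intro!: continuous_intros)
  next
    case (add f g)
    from add.IH(1)[OF add.prems] add.IH(2)[OF add.prems]
    have f: "(\<lambda>x. h x * complex_of_real (f (cis x))) \<in> W" and g: "(\<lambda>x. h x * complex_of_real (g (cis x))) \<in> W" by auto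
    obtain B where B: "\<And>x. cmod (h x * complex_of_real (f (cis x))) \<le> B" using f by (auto simp: W_def)
    obtain B' where B': "\<And>x. cmod (h x * complex_of_real (g (cis x))) \<le> B'" using g by (auto simp: W_def)
    have "(\<lambda>x. h x * complex_of_real (f (cis x)) + h x * complex_of_real (g (cis x))) \<in> W"
      unfolding W_def
    proof (intro CollectI conjI allI)
      show "continuous_on UNIV (\<lambda>x. h x * complex_of_real (f (cis x)) + h x * complex_of_real (g (cis x)))"
        using f g by (intro continuous_on_add) (auto simp: W_def)
      show "\<exists>B. \<forall>x. cmod (h x * complex_of_real (f (cis x)) + h x * complex_of_real (g (cis x))) \<le> B"
        using B B' by (intro exI[of _ "B + B'"] allI norm_triangle_mono)
      fix k :: int
      have "(LINT x|lborel. complex_of_real (G x) * ((h x * complex_of_real (f (cis x)) + h x * complex_of_real (g (cis x))) * cis (of_int k * x)))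
        = (LINT x|lborel. complex_of_real (G x) * (h x * complex_of_real (f (cis x)) * cis (of_int k * x)))
        + (LINT x|lborel. complex_of_real (G x) * (h x * complex_of_real (g (cis x)) * cis (of_int k * x)))"
        by (subst Bochner_Integration.integral_add [symmetric, OF int[OF f] int[OF g]]) (simp add: algebra_simps)
      also have "\<dots> = 0" using f g by (simp add: W_def)
      finally show "(LINT x|lborel. complex_of_real (G x) * ((h x * complex_of_real (f (cis x)) + h x * complex_of_real (g (cis x))) * cis (of_int k * x))) = 0" .
    qed
    thus ?case by (simp add: algebra_simps)
  next
    case (mult f g)
    from mult.IH(2)[OF mult.IH(1)[OF mult.prems]] show ?case by (simp add: mult_ac)
  qed
  have "(\<lambda>x. 1) \<in> W" unfolding W_def using zero by (auto intro!: exI[of _ 1])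
  from closed[OF this] have "\<forall>k::int. (LINT x|lborel. complex_of_real (G x) * (complex_of_real (p (cis x)) * cis (of_int k * x))) = 0"
    by (simp add: W_def)
  from spec[OF this, of 0] have "(LINT x|lborel. complex_of_real (G x * p (cis x))) = 0" by simp
  thus ?thesis by (simp only: integral_complex_of_real of_real_eq_0_iff)
qed

text \<open>
  Stone-Weierstrass on the unit circle.
\<close>

lemma orthogonal_to_continuous:
  assumes G: "integrable lborel G"
    and zero: "\<And>k::int. (LINT x|lborel. complex_of_real (G x) * cis (of_int k * x)) = 0"
    and \<phi>: "continuous_on UNIV (\<phi> :: complex \<Rightarrow> real)"
  shows "(LINT x|lborel. G x * \<phi> (cis x)) = 0"
proof -
  have int: "integrable lborel (\<lambda>x. G x * q (cis x))" if q: "continuous_on UNIV q" for q :: "complex \<Rightarrow> real"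
  proof -
    obtain B where B: "\<And>x. \<bar>q (cis x)\<bar> \<le> B" using bounded_on_circle[OF q] by blast
    have "integrable lborel (\<lambda>x. complex_of_real (G x) * complex_of_real (q (cis x)))"
      by (rule integrable_times_bounded[OF G, of _ B])
         (use B in \<open>auto intro!: borel_measurable_continuous_onI continuous_intros continuous_on_compose2[OF q]\<close>)
    from integrable_Re[OF this] show ?thesis by simp
  qed
  have "\<bar>LINT x|lborel. G x * \<phi> (cis x)\<bar> \<le> e * (LINT x|lborel. \<bar>G x\<bar>)" if e: "e > 0" for e
  proof -
    obtain p where p: "real_polynomial_function p" "\<And>z. z \<in> sphere 0 1 \<Longrightarrow> \<bar>\<phi> z - p z\<bar> < e"
      using Stone_Weierstrass_real_polynomial_function[of "sphere 0 1" \<phi> e] e continuous_on_subset[OF \<phi>] by auto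
    have pc: "continuous_on UNIV p" by (rule continuous_on_polymonial_function[OF p(1)[unfolded real_polynomial_function_eq]])
    have "(LINT x|lborel. G x * \<phi> (cis x)) = (LINT x|lborel. G x * \<phi> (cis x)) - (LINT x|lborel. G x * p (cis x))"
      using orthogonal_to_polynomials[OF G zero p(1)] by simp
    also have "\<dots> = (LINT x|lborel. G x * \<phi> (cis x) - G x * p (cis x))"
      by (rule Bochner_Integration.integral_diff [symmetric]) (intro int \<phi> pc)+
    also have "\<bar>\<dots>\<bar> \<le> (LINT x|lborel. \<bar>G x * \<phi> (cis x) - G x * p (cis x)\<bar>)"
      using integral_norm_bound[of lborel "\<lambda>x. G x * \<phi> (cis x) - G x * p (cis x)"] by simp
    also have "\<dots> \<le> (LINT x|lborel. e * \<bar>G x\<bar>)"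
    proof (rule integral_mono)
      fix x
      have "\<bar>G x * \<phi> (cis x) - G x * p (cis x)\<bar> = \<bar>G x\<bar> * \<bar>\<phi> (cis x) - p (cis x)\<bar>"
        by (simp add: abs_mult [symmetric] right_diff_distrib)
      also have "\<dots> \<le> \<bar>G x\<bar> * e" using p(2)[of "cis x"] by (intro mult_left_mono) auto
      finally show "\<bar>G x * \<phi> (cis x) - G x * p (cis x)\<bar> \<le> e * \<bar>G x\<bar>" by (simp add: mult.commute)
    qed (use G int[OF \<phi>] int[OF pc] in auto)
    finally show ?thesis by simp
  qed
  hence "\<bar>LINT x|lborel. G x * \<phi> (cis x)\<bar> \<le> e" if "e > 0" for e
  proof -
    let ?I = "LINT x|lborel. \<bar>G x\<bar>"
    have I: "?I \<ge> 0" by simp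
    have "\<bar>LINT x|lborel. G x * \<phi> (cis x)\<bar> \<le> e / (?I + 1) * ?I"
      using \<open>\<And>e. e > 0 \<Longrightarrow> _\<close>[of "e / (?I + 1)"] that I by simp
    also have "\<dots> \<le> e"
    proof -
      have "e / (c + 1) * c \<le> e" if "c \<ge> 0" for c using that \<open>e > 0\<close> by (simp add: field_simps)
      thus ?thesis using I by blast
    qed
    finally show ?thesis .
  qed
  hence "\<bar>LINT x|lborel. G x * \<phi> (cis x)\<bar> \<le> 0" by (rule field_le_epsilon) simp
  thus ?thesis by simp
qed

lemma cis_inj_on_open_period:
  assumes "cis x = cis y" "-pi < x" "x < pi" "-pi \<le> y" "y \<le> pi"
  shows "x = y"
proof -
  from assms(1) have "sin x = sin y" "cos x = cos y" by (auto simp: complex_eq_iff)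
  then obtain n :: int where n: "x = y + 2 * pi * n" using sin_cos_eq_iff by blast
  have "\<bar>2 * pi * real_of_int n\<bar> < 2 * pi" using n assms by linarith
  hence "\<bar>real_of_int n\<bar> < 1" by (simp add: abs_mult)
  hence "n = 0" by linarith
  thus ?thesis using n by simp
qed

text \<open>
  The indicator of an arc of the circle is a bounded pointwise limit of continuous functions.
  An arc ending at \<open>-1 = cis pi = cis (- pi)\<close> meets both ends of the period, which is harmless because these
  are null sets.
\<close>

lemma zero_on_initial_segments:
  assumes G: "integrable lborel G" and supp: "\<And>x. x \<notin> {-pi..pi} \<Longrightarrow> G x = 0"
    and zero: "\<And>k::int. (LINT x|lborel. complex_of_real (G x) * cis (of_int k * x)) = 0"
  shows "(LINT x|lborel. indicator {..a} x * G x) = 0"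
proof -
  have total: "(LINT x|lborel. G x) = 0"
    using zero[of 0] by (simp add: integral_complex_of_real)
  consider "a < -pi" | "a \<ge> pi" | "-pi \<le> a" "a < pi" by linarith
  thus ?thesis
  proof cases
    case 1
    hence eq: "(\<lambda>x. indicator {..a} x * G x) = (\<lambda>x. 0)" using supp by (auto simp: indicator_def fun_eq_iff)
    show ?thesis unfolding eq by simp
  next
    case 2
    hence eq: "(\<lambda>x. indicator {..a} x * G x) = G" using supp by (auto simp: indicator_def fun_eq_iff)
    show ?thesis unfolding eq by (rule total)
  next
    case 3
    define K where "K = cis ` {-pi..a}"
    have K: "closed K" "K \<noteq> {}" unfolding K_def using 3
      by (auto intro!: compact_imp_closed compact_continuous_image continuous_intros)
    (* decreases to the indicator of the closed arc K *)
    define \<phi> where "\<phi> n z = max 0 (1 - real n * infdist z K)" for n z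
    have \<phi>c: "continuous_on UNIV (\<phi> n)" for n unfolding \<phi>_def by (intro continuous_intros)
    have \<phi>b: "\<bar>\<phi> n z\<bar> \<le> 1" for n z by (simp add: \<phi>_def infdist_nonneg)
    have lim: "(\<lambda>n. \<phi> n z) \<longlonglongrightarrow> indicator K z" for z
    proof (cases "z \<in> K")
      case True
      thus ?thesis by (simp add: \<phi>_def)
    next
      case False
      hence d: "infdist z K > 0" using K by (metis in_closed_iff_infdist_zero infdist_nonneg order_less_le)
      obtain N :: nat where N: "1 / infdist z K < real N" using reals_Archimedean2 by blast
      have "\<forall>\<^sub>F n in sequentially. \<phi> n z = 0"
      proof (rule eventually_sequentiallyI[of N])
        fix n assume "N \<le> n"
        hence "1 / infdist z K < real n" using N by linarith
        thus "\<phi> n z = 0" using d by (simp add: \<phi>_def field_simps)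
      qed
      thus ?thesis using False by (simp add: tendsto_eventually)
    qed
    have "(\<lambda>n. LINT x|lborel. G x * \<phi> n (cis x)) \<longlonglongrightarrow> (LINT x|lborel. indicator {..a} x * G x)"
    proof (rule integral_dominated_convergence[where w = "\<lambda>x. \<bar>G x\<bar>"])
      have [measurable]: "G \<in> borel_measurable lborel" by (rule borel_measurable_integrable[OF G])
      show "(\<lambda>x. indicator {..a} x * G x) \<in> borel_measurable lborel" by measurable
      have [measurable]: "(\<lambda>x. \<phi> n (cis x)) \<in> borel_measurable borel" for n
        by (intro borel_measurable_continuous_onI continuous_on_compose2[OF \<phi>c] continuous_intros) auto
      show "(\<lambda>x. G x * \<phi> n (cis x)) \<in> borel_measurable lborel" for n by measurable
      show "integrable lborel (\<lambda>x. \<bar>G x\<bar>)" using G by simp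
      show "AE x in lborel. norm (G x * \<phi> n (cis x)) \<le> \<bar>G x\<bar>" for n
        using \<phi>b by (intro AE_I2) (simp add: abs_mult mult_left_le)
      have "AE x in lborel. x \<noteq> pi" "AE x in lborel. x \<noteq> -pi" by (rule AE_lborel_singleton)+
      thus "AE x in lborel. (\<lambda>n. G x * \<phi> n (cis x)) \<longlonglongrightarrow> indicator {..a} x * G x"
      proof eventually_elim
        case (elim x)
        show ?case
        proof (cases "x \<in> {-pi..pi}")
          case True
          hence x: "-pi < x" "x < pi" using elim by auto
          have "cis x \<in> K \<longleftrightarrow> x \<le> a"
          proof
            assume "cis x \<in> K"
            then obtain y where y: "cis x = cis y" "-pi \<le> y" "y \<le> a" by (auto simp: K_def)
            thus "x \<le> a" using cis_inj_on_open_period[of x y] x 3 by force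
          qed (use x in \<open>auto simp: K_def\<close>)
          hence "indicator K (cis x) = (indicator {..a} x :: real)" by (simp add: indicator_def)
          with tendsto_mult[OF tendsto_const[of "G x"] lim[of "cis x"]] show ?thesis by (simp add: mult.commute)
        qed (simp add: supp)
      qed
    qed
    moreover have "(LINT x|lborel. G x * \<phi> n (cis x)) = 0" for n
      by (rule orthogonal_to_continuous[OF G zero \<phi>c])
    ultimately show ?thesis by (simp add: LIMSEQ_const_iff)
  qed
qed

text \<open>
  The initial segments generate the Borel sets and are closed under intersection, so the integral of
  \<open>G\<close> over every Borel set vanishes, in particular over \<open>{x. G x > 0}\<close> and \<open>{x. G x < 0}\<close>.
\<close>

lemma AE_zero_if_initial_segments:
  assumes G: "integrable lborel G"
    and total: "(LINT x|lborel. G x) = (0::real)" and seg: "\<And>a::real. (LINT x|lborel. indicator {..a} x * G x) = 0"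
  shows "AE x in lborel. G x = 0"
proof -
  have [measurable]: "G \<in> borel_measurable borel" using borel_measurable_integrable[OF G] by simp
  have int: "integrable lborel (\<lambda>x. indicator A x * G x)" if "A \<in> sets borel" for A
    using integrable_mult_indicator[of A lborel G] that G by simp
  have all: "(LINT x|lborel. indicator A x * G x) = 0" if "A \<in> sets borel" for A :: "real set"
  proof -
    have "Int_stable (range (\<lambda>a::real. {..a}))" by (auto simp: Int_stable_def)
    moreover have "range (\<lambda>a::real. {..a}) \<subseteq> Pow UNIV" by simp
    moreover have "A \<in> sigma_sets UNIV (range (\<lambda>a::real. {..a}))"
      using that by (simp add: borel_eq_atMost)
    ultimately show ?thesis
    proof (induction rule: sigma_sets_induct_disjoint)
      case (basic A)
      thus ?case using seg by auto
    next
      case (compl A)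
      have A: "A \<in> sets borel" using compl(1) by (simp add: borel_eq_atMost)
      have "(LINT x|lborel. indicator (UNIV - A) x * G x) = (LINT x|lborel. G x - indicator A x * G x)"
        by (intro Bochner_Integration.integral_cong) (auto simp: indicator_def)
      also have "\<dots> = 0" using compl(2) total int[OF A] G by simp
      finally show ?case .
    next
      case (union A)
      have A: "A i \<in> sets borel" for i using union(2) by (force simp: borel_eq_atMost)
      have "(\<lambda>n. LINT x|lborel. indicator (\<Union>i<n. A i) x * G x) \<longlonglongrightarrow> (LINT x|lborel. indicator (\<Union>i. A i) x * G x)"
      proof (rule integral_dominated_convergence[where w = "\<lambda>x. \<bar>G x\<bar>"])
        show "AE x in lborel. (\<lambda>n. indicator (\<Union>i<n. A i) x * G x) \<longlonglongrightarrow> indicator (\<Union>i. A i) x * G x"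
          by (intro AE_I2 tendsto_intros LIMSEQ_indicator_UN)
        show "AE x in lborel. norm (indicator (\<Union>i<n. A i) x * G x) \<le> \<bar>G x\<bar>" for n
          by (intro AE_I2) (simp add: indicator_def)
      qed (use A G in auto)
      moreover have "(LINT x|lborel. indicator (\<Union>i<n. A i) x * G x) = 0" for n
      proof -
        have "(indicator (\<Union>i<n. A i) x :: real) = (\<Sum>i<n. indicator (A i) x)" for x
          using union(1) by (intro indicator_UN_disjoint) (auto intro: disjoint_family_on_mono)
        hence eq: "(\<lambda>x. indicator (\<Union>i<n. A i) x * G x) = (\<lambda>x. \<Sum>i<n. indicator (A i) x * G x)"
          by (simp only: sum_distrib_right)
        show ?thesis unfolding eq
          by (subst Bochner_Integration.integral_sum) (simp_all only: int[OF A] union(3) sum.neutral_const)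
      qed
      ultimately show ?case by (simp add: LIMSEQ_const_iff)
    qed simp
  qed
  have P: "{x. G x > 0} \<in> sets borel" "{x. G x < 0} \<in> sets borel" by measurable
  have 1: "AE x in lborel. indicator {x. G x > 0} x * G x = 0"
    using integral_nonneg_eq_0_iff_AE[OF int[OF P(1)]] all[OF P(1)] by (auto simp: indicator_def)
  have 2: "AE x in lborel. - (indicator {x. G x < 0} x * G x) = 0"
    using integral_nonneg_eq_0_iff_AE[OF integrable_minus[OF int[OF P(2)]]] all[OF P(2)] by (auto simp: indicator_def)
  from 1 2 show ?thesis
  proof eventually_elim
    case (elim x)
    thus ?case by (cases "G x > 0"; cases "G x < 0") (auto simp: indicator_def)
  qed
qed

section \<open>Absolutely convergent Fourier series\<close>

definition l1 :: "(int \<Rightarrow> complex) \<Rightarrow> bool" where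
  "l1 c \<longleftrightarrow> (\<lambda>n. cmod (c n)) summable_on UNIV"

definition l1_norm :: "(int \<Rightarrow> complex) \<Rightarrow> real" where
  "l1_norm c = (\<Sum>\<^sub>\<infinity>n. cmod (c n))"

definition fseries :: "(int \<Rightarrow> complex) \<Rightarrow> real \<Rightarrow> complex" where
  "fseries c x = (\<Sum>\<^sub>\<infinity>n. c n * cis (of_int n * x))"

lemma l1_bounded: "l1 c \<Longrightarrow> (\<And>n. cmod (d n) \<le> B * cmod (c n)) \<Longrightarrow> l1 d"
  unfolding l1_def
  by (rule summable_on_comparison_test[of "\<lambda>n. B * cmod (c n)"]) (auto intro: summable_on_cmult_right)

lemma l1_add: "l1 c \<Longrightarrow> l1 d \<Longrightarrow> l1 (\<lambda>n. c n + d n)"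
  unfolding l1_def
  by (rule summable_on_comparison_test[of "\<lambda>n. cmod (c n) + cmod (d n)"])
     (auto intro: summable_on_add norm_triangle_ineq)

lemma l1_diff: "l1 c \<Longrightarrow> l1 d \<Longrightarrow> l1 (\<lambda>n. c n - d n)"
  unfolding l1_def
  by (rule summable_on_comparison_test[of "\<lambda>n. cmod (c n) + cmod (d n)"])
     (auto intro: summable_on_add norm_triangle_ineq4)

lemma l1_scale: "l1 c \<Longrightarrow> l1 (\<lambda>n. z * c n)"
  by (rule l1_bounded[of c _ "cmod z"]) (auto simp: norm_mult)

lemma l1_shift: "l1 c \<Longrightarrow> l1 (\<lambda>n. c (n + j))"
  unfolding l1_def
  using summable_on_reindex_bij_betw[of "\<lambda>n. n + j" UNIV UNIV "\<lambda>n. cmod (c n)"]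
  by (simp add: bij_plus_right)

lemma fseries_summable:
  assumes "l1 c"
  shows "(\<lambda>n. c n * cis (of_int n * x)) summable_on UNIV"
  by (rule abs_summable_summable) (use assms in \<open>simp add: l1_def norm_mult\<close>)

lemma fseries_add: "l1 c \<Longrightarrow> l1 d \<Longrightarrow> fseries (\<lambda>n. c n + d n) x = fseries c x + fseries d x"
  unfolding fseries_def distrib_right by (intro infsum_add fseries_summable)

lemma fseries_scale: "fseries (\<lambda>n. z * c n) x = z * fseries c x"
  unfolding fseries_def mult.assoc by (rule infsum_cmult_right')

lemma fseries_diff: "l1 c \<Longrightarrow> l1 d \<Longrightarrow> fseries (\<lambda>n. c n - d n) x = fseries c x - fseries d x"
  using fseries_add[of c "\<lambda>n. - 1 * d n" x] l1_scale[of d "- 1"] fseries_scale[of "- 1" d x] by simp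

lemma fseries_bound: "l1 c \<Longrightarrow> cmod (fseries c x) \<le> l1_norm c"
  unfolding fseries_def l1_norm_def
  by (rule order_trans[OF norm_infsum_bound]) (simp_all add: l1_def norm_mult)

lemma fseries_shift:
  assumes "l1 c"
  shows "fseries (\<lambda>n. c (n + j)) x = cis (- (of_int j * x)) * fseries c x"
proof -
  have "fseries (\<lambda>n. c (n + j)) x = (\<Sum>\<^sub>\<infinity>n. cis (- (of_int j * x)) * (c (n + j) * cis (of_int (n + j) * x)))"
    unfolding fseries_def by (rule infsum_cong) (simp add: mult.left_commute cis_mult algebra_simps)
  also have "\<dots> = cis (- (of_int j * x)) * (\<Sum>\<^sub>\<infinity>n. c (n + j) * cis (of_int (n + j) * x))"
    by (rule infsum_cmult_right')
  also have "(\<Sum>\<^sub>\<infinity>n. c (n + j) * cis (of_int (n + j) * x)) = fseries c x"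
    unfolding fseries_def
    by (rule infsum_reindex_bij_betw[of "\<lambda>n. n + j" UNIV UNIV "\<lambda>n. c n * cis (of_int n * x)"])
       (simp add: bij_plus_right)
  finally show ?thesis .
qed

lemma fseries_periodic: "fseries c (x + 2 * pi) = fseries c x"
proof -
  have "cis (of_int n * (x + 2 * pi)) = cis (of_int n * x)" for n :: int
  proof -
    have "cis (of_int n * (x + 2 * pi)) = cis (of_int n * x) * cis (2 * pi * of_int n)"
      by (simp add: cis_mult algebra_simps)
    also have "cis (2 * pi * of_int n) = 1" by (rule cis_multiple_2pi) auto
    finally show ?thesis by simp
  qed
  thus ?thesis by (simp add: fseries_def)
qed

text \<open>
  The symmetry characterizes the coefficients of real functions.
\<close>

lemma fseries_real:
  assumes "\<And>n. cnj (c (- n)) = c n"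
  shows "complex_of_real (Re (fseries c x)) = fseries c x"
proof -
  have "cnj (fseries c x) = (\<Sum>\<^sub>\<infinity>n. cnj (c n * cis (of_int n * x)))"
    unfolding fseries_def by (rule infsum_cnj [symmetric])
  also have "\<dots> = (\<Sum>\<^sub>\<infinity>n. c (- n) * cis (of_int (- n) * x))"
    by (rule infsum_cong) (use assms[of "- _"] in \<open>simp add: cis_cnj\<close>)
  also have "\<dots> = fseries c x" unfolding fseries_def
    by (rule infsum_reindex_bij_betw[of uminus UNIV UNIV "\<lambda>n. c n * cis (of_int n * x)"])
       (auto intro: bij_uminus)
  finally have "Im (fseries c x) = 0" by (simp add: complex_eq_iff)
  thus ?thesis by (simp add: complex_eq_iff)
qed

text \<open>
  An enumeration of the integers gives access to theorems about series indexed by \<open>nat\<close>.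
\<close>

lemma fseries_sums:
  assumes "l1 c"
  shows "(\<lambda>i. c (int_decode i) * cis (of_int (int_decode i) * x)) sums fseries c x"
    and "summable (\<lambda>i. cmod (c (int_decode i)))"
proof -
  have b: "bij_betw int_decode UNIV UNIV" by (rule bij_int_decode)
  have "((\<lambda>i. c (int_decode i) * cis (of_int (int_decode i) * x)) has_sum fseries c x) UNIV"
    using has_sum_infsum[OF fseries_summable[OF assms]]
    unfolding fseries_def has_sum_reindex_bij_betw[OF b, of "\<lambda>n. c n * cis (of_int n * x)"] .
  thus "(\<lambda>i. c (int_decode i) * cis (of_int (int_decode i) * x)) sums fseries c x"
    by (rule has_sum_imp_sums)
  have "(\<lambda>i. cmod (c (int_decode i))) summable_on UNIV"
    using assms unfolding l1_def summable_on_reindex_bij_betw[OF b, of "\<lambda>n. cmod (c n)"] .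
  thus "summable (\<lambda>i. cmod (c (int_decode i)))" by (rule summable_on_imp_summable)
qed

lemma fseries_has_vector_derivative:
  assumes c: "l1 c" and c': "l1 (\<lambda>n. of_int n * c n)"
  shows "(fseries c has_vector_derivative fseries (\<lambda>n. \<i> * of_int n * c n) x) (at x)"
proof -
  let ?d = "\<lambda>n. \<i> * of_int n * c n"
  have d: "l1 ?d" using l1_scale[OF c', of \<i>] by (simp add: mult.assoc)
  let ?t = "\<lambda>c i x. c (int_decode i) * cis (of_int (int_decode i) * x)"
  have cis: "((\<lambda>x. cis (of_int n * x)) has_vector_derivative \<i> * of_int n * cis (of_int n * x)) (at x)" for n :: int and x
    unfolding has_vector_derivative_complex_iff by (auto intro!: derivative_eq_intros)
  have "\<exists>g. \<forall>x\<in>UNIV. (\<lambda>i. ?t c i x) sums g x \<and> (g has_derivative (\<lambda>h. h *\<^sub>R fseries ?d x)) (at x within UNIV)"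
  proof (rule has_derivative_series[where f = "?t c" and f' = "\<lambda>i x h. h *\<^sub>R ?t ?d i x"])
    fix i x
    have "(?t c i has_vector_derivative c (int_decode i) * (\<i> * of_int (int_decode i) * cis (of_int (int_decode i) * x))) (at x)"
      by (intro has_vector_derivative_mult_right cis)
    thus "(?t c i has_derivative (\<lambda>h. h *\<^sub>R ?t ?d i x)) (at x within UNIV)"
      by (simp add: has_vector_derivative_def mult_ac)
  next
    fix e :: real assume "e > 0"
    have "uniform_limit UNIV (\<lambda>n x. \<Sum>i<n. ?t ?d i x) (\<lambda>x. \<Sum>i. ?t ?d i x) sequentially"
      by (rule Weierstrass_m_test[OF _ fseries_sums(2)[OF d]]) (simp add: norm_mult)
    hence "\<forall>\<^sub>F n in sequentially. \<forall>x\<in>UNIV. dist (\<Sum>i<n. ?t ?d i x) (\<Sum>i. ?t ?d i x) < e"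
      using \<open>e > 0\<close> by (rule uniform_limitD)
    thus "\<forall>\<^sub>F n in sequentially. \<forall>x\<in>UNIV. \<forall>h. norm ((\<Sum>i<n. h *\<^sub>R ?t ?d i x) - h *\<^sub>R fseries ?d x) \<le> e * norm h"
    proof eventually_elim
      case (elim n)
      show ?case
      proof (intro ballI allI)
        fix x h :: real
        have "norm ((\<Sum>i<n. h *\<^sub>R ?t ?d i x) - h *\<^sub>R fseries ?d x) = \<bar>h\<bar> * norm ((\<Sum>i<n. ?t ?d i x) - fseries ?d x)"
          unfolding scaleR_sum_right [symmetric] scaleR_diff_right [symmetric] norm_scaleR ..
        also have "\<dots> \<le> \<bar>h\<bar> * e"
        proof (rule mult_left_mono)
          have "fseries ?d x = (\<Sum>i. ?t ?d i x)" using sums_unique[OF fseries_sums(1)[OF d]] .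
          moreover have "dist (\<Sum>i<n. ?t ?d i x) (\<Sum>i. ?t ?d i x) < e" using elim by blast
          ultimately show "norm ((\<Sum>i<n. ?t ?d i x) - fseries ?d x) \<le> e" by (simp only: dist_norm less_imp_le)
        qed simp
        finally show "norm ((\<Sum>i<n. h *\<^sub>R ?t ?d i x) - h *\<^sub>R fseries ?d x) \<le> e * norm h"
          by (simp add: mult.commute)
      qed
    qed
  next
    show "(\<lambda>i. ?t c i x) sums fseries c x" by (rule fseries_sums(1)[OF c])
  qed auto
  then obtain g where g: "\<And>x. (\<lambda>i. ?t c i x) sums g x" "\<And>x. (g has_derivative (\<lambda>h. h *\<^sub>R fseries ?d x)) (at x)"
    by auto
  have "g = fseries c" using sums_unique2[OF g(1) fseries_sums(1)[OF c]] by (simp add: fun_eq_iff)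
  thus ?thesis using g(2)[of x] by (simp add: has_vector_derivative_def)
qed

lemma continuous_fseries:
  assumes "l1 c"
  shows "continuous_on A (fseries c)"
proof -
  let ?t = "\<lambda>i x. c (int_decode i) * cis (of_int (int_decode i) * x)"
  have "continuous_on A (\<lambda>x. \<Sum>i. ?t i x)"
  proof (rule uniform_limit_theorem)
    show "uniform_limit A (\<lambda>n x. \<Sum>i<n. ?t i x) (\<lambda>x. \<Sum>i. ?t i x) sequentially"
      by (rule Weierstrass_m_test[OF _ fseries_sums(2)[OF assms]]) (simp add: norm_mult)
    show "\<forall>\<^sub>F n in sequentially. continuous_on A (\<lambda>x. \<Sum>i<n. ?t i x)"
      by (intro always_eventually allI continuous_intros)
  qed simp
  thus ?thesis using sums_unique[OF fseries_sums(1)[OF assms]] by simp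
qed

lemma integral_cis_period:
  "(LBINT x:{-pi..pi}. cis (of_int n * x)) = (if n = 0 then 2 * pi else 0)"
proof (cases "n = 0")
  case True
  have "(LBINT x:{-pi..pi}. (1::complex)) = 2 * pi"
    by (simp add: set_lebesgue_integral_def scaleR_conv_of_real)
  thus ?thesis using True by simp
next
  case False
  let ?F = "\<lambda>x. cis (of_int n * x) / (\<i> * of_int n)"
  have "(LBINT x:{-pi..pi}. cis (of_int n * x)) = ?F pi - ?F (-pi)"
    unfolding set_lebesgue_integral_def
  proof (rule integral_FTC_Icc)
    show "(?F has_vector_derivative cis (of_int n * x)) (at x within {-pi..pi})" for x
    proof -
      have "((\<lambda>x. cis (of_int n * x)) has_vector_derivative \<i> * of_int n * cis (of_int n * x)) (at x within {-pi..pi})"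
        unfolding has_vector_derivative_complex_iff by (auto intro!: derivative_eq_intros)
      from has_vector_derivative_divide[OF this, of "\<i> * of_int n"] False show ?thesis by simp
    qed
  qed (auto intro!: continuous_intros)
  also have "cis (of_int n * pi) = cis (of_int n * (- pi))"
    by (simp add: complex_eq_iff mult.commute)
  finally show ?thesis using False by simp
qed

lemma fseries_coeff:
  assumes "l1 c"
  shows "(LBINT x:{-pi..pi}. fseries c x * cis (- (of_int k * x))) / (2 * pi) = c k"
proof -
  let ?t = "\<lambda>i x. indicator {-pi..pi} x *\<^sub>R (c (int_decode i) * cis (of_int (int_decode i) * x) * cis (- (of_int k * x)))"
  have cont: "continuous_on {-pi..pi} (\<lambda>x. c n * cis (of_int n * x) * cis (- (of_int k * x)))" for n :: int
    by (intro continuous_intros)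
  have int: "integrable lborel (?t i)" for i
    by (intro borel_integrable_compact cont) auto
  have n: "norm (?t i x) = indicator {-pi..pi} x * cmod (c (int_decode i))" for i x
    by (simp add: norm_mult)
  have nint: "(LINT x|lborel. norm (?t i x)) = 2 * pi * cmod (c (int_decode i))" for i
    unfolding n by simp
  have "(\<lambda>i. integral\<^sup>L lborel (?t i)) sums (LINT x|lborel. (\<Sum>i. ?t i x))"
  proof (rule sums_integral[OF int])
    show "AE x in lborel. summable (\<lambda>i. norm (?t i x))"
      unfolding n by (intro AE_I2 summable_mult fseries_sums(2)[OF assms])
    show "summable (\<lambda>i. LINT x|lborel. norm (?t i x))"
      unfolding nint by (intro summable_mult fseries_sums(2)[OF assms])
  qed
  moreover have "(\<Sum>i. ?t i x) = indicator {-pi..pi} x *\<^sub>R (fseries c x * cis (- (of_int k * x)))" for x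
    by (intro sums_unique[symmetric] sums_scaleR_right sums_mult2 fseries_sums(1)[OF assms])
  moreover have "integral\<^sup>L lborel (?t i) = (if i = int_encode k then 2 * pi * c k else 0)" for i
  proof -
    let ?n = "int_decode i"
    have "integral\<^sup>L lborel (?t i) = (LBINT x:{-pi..pi}. c ?n * cis (of_int (?n - k) * x))"
      unfolding set_lebesgue_integral_def
      by (intro Bochner_Integration.integral_cong) (auto simp: mult.assoc cis_mult algebra_simps)
    also have "\<dots> = c ?n * (if ?n - k = 0 then 2 * pi else 0)"
      unfolding integral_cis_period [symmetric] by (rule set_integral_mult_right)
    also have "(?n - k = 0) = (i = int_encode k)" by auto
    finally show ?thesis by auto
  qed
  ultimately have "(\<lambda>i. if i = int_encode k then 2 * pi * c k else 0) sums
      (LBINT x:{-pi..pi}. fseries c x * cis (- (of_int k * x)))"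
    by (simp add: set_lebesgue_integral_def)
  moreover have "(\<lambda>i. if i = int_encode k then 2 * pi * c k else 0) sums (2 * pi * c k)"
    using sums_single[of "int_encode k" "\<lambda>_. 2 * pi * c k"] by simp
  ultimately have "(LBINT x:{-pi..pi}. fseries c x * cis (- (of_int k * x))) = 2 * pi * c k"
    by (rule sums_unique2)
  thus ?thesis by simp
qed

lemma fourier_coeff_fseries:
  assumes "l1 c" and f: "\<And>x. complex_of_real (f x) = fseries c x"
  shows "fourier_coeff f = c"
  unfolding fourier_coeff_def f by (rule ext) (rule fseries_coeff[OF assms(1)])

lemma fourier_coeff_cnj: "cnj (fourier_coeff f (- k)) = fourier_coeff f k"
proof -
  have "cnj (LBINT x:{-pi..pi}. complex_of_real (f x) * cis (- (of_int (- k) * x)))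
     = (LINT x|lborel. cnj (indicator {-pi..pi} x *\<^sub>R (complex_of_real (f x) * cis (- (of_int (- k) * x)))))"
    unfolding set_lebesgue_integral_def by (rule Bochner_Integration.integral_cnj [symmetric])
  also have "\<dots> = (LBINT x:{-pi..pi}. complex_of_real (f x) * cis (- (of_int k * x)))"
    unfolding set_lebesgue_integral_def by (intro Bochner_Integration.integral_cong) (auto simp: cis_cnj)
  finally show ?thesis by (simp add: fourier_coeff_def)
qed

lemma hseq_imp_l1: "c \<in> hseq s \<Longrightarrow> s \<ge> 1 \<Longrightarrow> l1 c"
  using hseq_1_l1(1)[OF hseq_mono] by (simp add: l1_def)

lemma hseq_imp_l1_deriv: "c \<in> hseq s \<Longrightarrow> s \<ge> 2 \<Longrightarrow> l1 (\<lambda>n. of_int n * c n)"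
  using hseq_2_l1[OF hseq_mono] by (simp add: l1_def)

lemma sobolev_iff:
  "f \<in> sobolev m \<longleftrightarrow> periodic f \<and> f \<in> borel_measurable borel \<and>
     set_integrable lborel {-pi..pi} (\<lambda>x. (f x)\<^sup>2) \<and> fourier_coeff f \<in> hseq m"
  by (simp add: sobolev_def hseq_def wt_def)

lemma sobolev_norm_eq: "sobolev_norm m f = sqrt (hsq m (fourier_coeff f))"
  by (simp add: sobolev_norm_def hsq_def wt_def)

lemma fseries_in_sobolev:
  assumes c: "c \<in> hseq s" "s \<ge> 1" and f: "\<And>x. complex_of_real (f x) = fseries c x"
  shows "f \<in> sobolev s"
proof -
  have l: "l1 c" by (rule hseq_imp_l1[OF c])
  have f': "f = (\<lambda>x. Re (fseries c x))" using f by (metis Re_complex_of_real)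
  have cont: "continuous_on A f" for A unfolding f' by (intro continuous_intros continuous_fseries l)
  have "periodic f" by (simp add: periodic_def f' fseries_periodic)
  moreover have "f \<in> borel_measurable borel" by (rule borel_measurable_continuous_onI[OF cont])
  moreover have "set_integrable lborel {-pi..pi} (\<lambda>x. (f x)\<^sup>2)"
    by (intro borel_integrable_atLeastAtMost' continuous_intros cont)
  ultimately show ?thesis using c fourier_coeff_fseries[OF l f] by (simp add: sobolev_iff)
qed

lemma periodic_int:
  assumes "periodic f"
  shows "f (x + 2 * pi * of_int n) = f x"
proof (induction n rule: int_induct[of _ 0])
  case (step1 i)
  have "f (x + 2 * pi * of_int (i + 1)) = f (x + 2 * pi * of_int i + 2 * pi)" by (simp add: algebra_simps)
  thus ?case using step1 assms by (simp add: periodic_def)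
next
  case (step2 i)
  have "f (x + 2 * pi * of_int i) = f (x + 2 * pi * of_int (i - 1) + 2 * pi)" by (simp add: algebra_simps)
  thus ?case using step2 assms by (simp add: periodic_def)
qed simp

lemma AE_periodic:
  assumes f: "periodic f" and m: "f \<in> borel_measurable borel"
    and ae: "AE x in lborel. x \<in> {-pi..pi} \<longrightarrow> f x = 0"
  shows "AE x in lborel. f x = 0"
proof -
  have "AE x in lborel. x + 2 * pi * of_int n \<in> {-pi..pi} \<longrightarrow> f (x + 2 * pi * of_int n) = 0" for n :: int
  proof -
    have [measurable]: "f \<in> borel_measurable borel" by (rule m)
    have d: "lborel = distr lborel borel (\<lambda>x. 2 * pi * of_int n + 1 *\<^sub>R x)"
      using lborel_affine[of 1 "2 * pi * of_int n :: real"] by (simp add: density_1)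
    have "AE x in distr lborel borel (\<lambda>x. 2 * pi * of_int n + 1 *\<^sub>R x). x \<in> {-pi..pi} \<longrightarrow> f x = 0"
      using ae d by metis
    hence "AE x in lborel. 2 * pi * of_int n + 1 *\<^sub>R x \<in> {-pi..pi} \<longrightarrow> f (2 * pi * of_int n + 1 *\<^sub>R x) = 0"
      by (subst (asm) AE_distr_iff) auto
    thus ?thesis by (simp add: add.commute)
  qed
  hence "AE x in lborel. \<forall>n::int. x + 2 * pi * of_int n \<in> {-pi..pi} \<longrightarrow> f (x + 2 * pi * of_int n) = 0"
    by (simp add: AE_all_countable)
  thus ?thesis
  proof eventually_elim
    case (elim x)
    define k where "k = \<lfloor>(x + pi) / (2 * pi)\<rfloor>"
    define n where "n = - k"
    have "of_int k \<le> (x + pi) / (2 * pi)" "(x + pi) / (2 * pi) < of_int k + 1"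
      unfolding k_def by linarith+
    hence "of_int k * (2 * pi) \<le> x + pi" "x + pi < (of_int k + 1) * (2 * pi)"
      by (simp_all only: pos_le_divide_eq pos_divide_less_eq pi_gt_zero zero_less_mult_iff zero_less_numeral simp_thms)
    hence "x + 2 * pi * of_int n \<in> {-pi..pi}" by (simp add: n_def algebra_simps)
    with elim have "f (x + 2 * pi * of_int n) = 0" by blast
    thus ?case using periodic_int[OF f, of x n] by simp
  qed
qed

lemma square_integrable_imp_integrable:
  assumes m: "f \<in> borel_measurable borel" and "set_integrable lborel {-pi..pi} (\<lambda>x. (f x)\<^sup>2 :: real)"
  shows "set_integrable lborel {-pi..pi} f"
  unfolding set_integrable_def
proof (rule Bochner_Integration.integrable_bound)
  have "set_integrable lborel {-pi..pi} (\<lambda>x. 1 + (f x)\<^sup>2)"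
    by (intro set_integral_add assms borel_integrable_atLeastAtMost' continuous_intros)
  thus "integrable lborel (\<lambda>x. indicator {-pi..pi} x *\<^sub>R (1 + (f x)\<^sup>2))" by (simp add: set_integrable_def)
  show "(\<lambda>x. indicator {-pi..pi} x *\<^sub>R f x) \<in> borel_measurable lborel" using m by simp
  have "\<bar>y\<bar> \<le> 1 + y\<^sup>2" for y :: real
    using zero_le_square[of "\<bar>y\<bar> - 1"] by (simp add: power2_eq_square algebra_simps)
  thus "AE x in lborel. norm (indicator {-pi..pi} x *\<^sub>R f x) \<le> norm (indicator {-pi..pi} x *\<^sub>R (1 + (f x)\<^sup>2))"
    by (intro AE_I2) (simp add: indicator_def)
qed

text \<open>
  The difference of \<open>f\<close> and the sum of its Fourier series is integrable with vanishing coefficients, so it is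
  null on one period by completeness and then everywhere by periodicity.
\<close>

theorem sobolev_expansion:
  assumes f: "f \<in> sobolev m" "m \<ge> 1"
  shows "AE x in lborel. complex_of_real (f x) = fseries (fourier_coeff f) x"
proof -
  let ?c = "fourier_coeff f"
  have c: "l1 ?c" using f hseq_imp_l1 by (auto simp: sobolev_iff)
  have per: "periodic f" and [measurable]: "f \<in> borel_measurable borel"
    and sq: "set_integrable lborel {-pi..pi} (\<lambda>x. (f x)\<^sup>2)" using f by (auto simp: sobolev_iff)
  have int: "set_integrable lborel {-pi..pi} f" by (rule square_integrable_imp_integrable[OF _ sq]) simp
  define g where "g x = f x - Re (fseries ?c x)" for x
  have g: "complex_of_real (g x) = complex_of_real (f x) - fseries ?c x" for x
    using fseries_real[of ?c x] fourier_coeff_cnj by (simp add: g_def)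
  have gper: "periodic g" using per by (simp add: periodic_def g_def fseries_periodic)
  have cont: "continuous_on A (fseries ?c)" for A by (rule continuous_fseries[OF c])
  have gm[measurable]: "g \<in> borel_measurable borel"
  proof -
    have [measurable]: "(\<lambda>x. Re (fseries ?c x)) \<in> borel_measurable borel"
      by (intro borel_measurable_continuous_onI continuous_intros cont)
    show ?thesis unfolding g_def by measurable
  qed
  have gint: "set_integrable lborel {-pi..pi} g"
    unfolding g_def by (intro set_integral_diff int borel_integrable_atLeastAtMost' continuous_intros cont)
  define G where "G x = indicator {-pi..pi} x * g x" for x
  have G: "integrable lborel G" using gint by (simp add: G_def[abs_def] set_integrable_def)
  have zero: "(LINT x|lborel. complex_of_real (G x) * cis (of_int k * x)) = 0" for k :: int
  proof -
    have fi: "set_integrable lborel {-pi..pi} (\<lambda>x. complex_of_real (f x) * cis (- (of_int (- k) * x)))"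
    proof -
      have "integrable lborel (\<lambda>x. complex_of_real (indicator {-pi..pi} x *\<^sub>R f x) * cis (of_int k * x))"
        by (rule integrable_times_bounded[of _ _ 1])
           (use int in \<open>auto simp: set_integrable_def intro!: borel_measurable_continuous_onI continuous_intros\<close>)
      thus ?thesis by (simp add: set_integrable_def scaleR_conv_of_real mult.assoc)
    qed
    have "(LINT x|lborel. complex_of_real (G x) * cis (of_int k * x))
      = (LBINT x:{-pi..pi}. complex_of_real (f x) * cis (- (of_int (- k) * x)) - fseries ?c x * cis (- (of_int (- k) * x)))"
      unfolding set_lebesgue_integral_def G_def
      by (intro Bochner_Integration.integral_cong) (auto simp: g indicator_def algebra_simps)
    also have "\<dots> = (LBINT x:{-pi..pi}. complex_of_real (f x) * cis (- (of_int (- k) * x)))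
        - (LBINT x:{-pi..pi}. fseries ?c x * cis (- (of_int (- k) * x)))"
      by (intro set_integral_diff fi borel_integrable_atLeastAtMost' continuous_intros cont)
    also have "\<dots> = 2 * pi * ?c (- k) - 2 * pi * ?c (- k)"
      using fseries_coeff[OF c, of "- k"] unfolding fourier_coeff_def[of f "- k"]
      by (simp add: field_simps)
    finally show ?thesis by simp
  qed
  have supp: "\<And>x. x \<notin> {-pi..pi} \<Longrightarrow> G x = 0" by (simp add: G_def)
  have total: "(LINT x|lborel. G x) = 0" using zero[of 0] by (simp add: integral_complex_of_real)
  have "AE x in lborel. G x = 0"
    by (rule AE_zero_if_initial_segments[OF G total zero_on_initial_segments[OF G supp zero]])
  hence "AE x in lborel. x \<in> {-pi..pi} \<longrightarrow> g x = 0"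
    by eventually_elim (auto simp: G_def)
  hence "AE x in lborel. g x = 0" by (rule AE_periodic[OF gper gm])
  thus ?thesis
  proof eventually_elim
    case (elim x)
    thus ?case using g[of x] by simp
  qed
qed

lemma continuous_AE_eq:
  fixes f g :: "real \<Rightarrow> 'a::real_normed_vector"
  assumes "continuous_on UNIV f" "continuous_on UNIV g" "AE x in lborel. f x = g x"
  shows "f = g"
proof -
  let ?S = "{x. f x \<noteq> g x}"
  have op: "open ?S" by (rule open_Collect_neq[OF assms(1,2)])
  have "?S \<in> null_sets lborel"
    using assms(3) op by (subst AE_iff_null_sets) auto
  hence "negligible ?S" by (simp add: negligible_iff_null_sets null_sets_completionI)
  thus ?thesis using open_not_negligible[OF op] by auto
qed

corollary continuous_sobolev_expansion:
  assumes "f \<in> sobolev m" "m \<ge> 1" "continuous_on UNIV f"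
  shows "complex_of_real (f x) = fseries (fourier_coeff f) x"
proof -
  have "l1 (fourier_coeff f)" using assms hseq_imp_l1 by (auto simp: sobolev_iff)
  hence "(\<lambda>x. complex_of_real (f x)) = fseries (fourier_coeff f)"
    by (intro continuous_AE_eq sobolev_expansion[OF assms(1,2)] assms(3) continuous_fseries continuous_intros)
  thus ?thesis by metis
qed

text \<open>
  The norm of order \<open>1\<close> controls the sum of the absolute values of the coefficients and thus the uniform norm.
\<close>

lemma continuous_on_fseries_curve:
  assumes c: "hcont T 1 c"
  shows "continuous_on ({0..T} \<times> UNIV) (\<lambda>(t, x). fseries (c t) x)"
  unfolding continuous_on_def
proof
  fix p assume p: "p \<in> {0..T} \<times> (UNIV :: real set)"
  obtain t x where tx: "p = (t, x)" and t: "t \<in> {0..T}" using p by auto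
  let ?S = "{0..T} \<times> (UNIV :: real set)"
  have l: "l1 (c r)" if "r \<in> {0..T}" for r using hcont_seq[OF c that] hseq_imp_l1 by auto
  define g where "g r = sqrt (inv_sq_sum * hsq 1 (\<lambda>n. c r n - c t n))" for r
  have "g t = 0" by (simp add: g_def hsq_def)
  have "(g \<longlongrightarrow> sqrt (inv_sq_sum * 0)) (at t within {0..T})"
    unfolding g_def by (intro tendsto_intros hcont_tendsto[OF c t])
  hence "continuous (at t within {0..T}) g" by (simp add: continuous_within g_def hsq_def)
  moreover have "fst ` ?S = {0..T}" by force
  moreover have "continuous (at p within ?S) fst"
    unfolding continuous_within by (intro tendsto_intros)
  ultimately have "continuous (at p within ?S) (g \<circ> fst)"
    using tx by (intro continuous_within_compose) simp_all
  hence gl: "((\<lambda>q. g (fst q)) \<longlongrightarrow> 0) (at p within ?S)"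
    using \<open>g t = 0\<close> by (simp add: continuous_within tx o_def)
  have "((\<lambda>q. fseries (c (fst q)) (snd q) - fseries (c t) (snd q)) \<longlongrightarrow> 0) (at p within ?S)"
  proof (rule Lim_null_comparison[OF _ gl])
    show "\<forall>\<^sub>F q in at p within ?S. norm (fseries (c (fst q)) (snd q) - fseries (c t) (snd q)) \<le> g (fst q)"
      using eventually_in_interval
    proof eventually_elim
      case (elim q)
      hence q: "fst q \<in> {0..T}" by auto
      have h: "(\<lambda>n. c (fst q) n - c t n) \<in> hseq 1" by (intro hseq_diff hcont_seq[OF c] q t)
      have "fseries (c (fst q)) (snd q) - fseries (c t) (snd q) = fseries (\<lambda>n. c (fst q) n - c t n) (snd q)"
        by (rule fseries_diff [symmetric]) (intro l q t)+
      also have "cmod \<dots> \<le> l1_norm (\<lambda>n. c (fst q) n - c t n)"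
        by (intro fseries_bound l1_diff l q t)
      also have "\<dots> \<le> g (fst q)" unfolding g_def l1_norm_def
        by (rule real_le_rsqrt) (rule hseq_1_l1(2)[OF h])
      finally show ?case .
    qed
  qed
  moreover have "((\<lambda>q. fseries (c t) (snd q)) \<longlongrightarrow> fseries (c t) x) (at p within ?S)"
  proof -
    have "isCont (fseries (c t)) x"
      using continuous_fseries[OF l[OF t], of UNIV] by (simp add: continuous_on_eq_continuous_at)
    moreover have "(snd \<longlongrightarrow> x) (at p within ?S)" using tx by (auto intro!: tendsto_eq_intros)
    ultimately show ?thesis by (rule isCont_tendsto_compose)
  qed
  ultimately have "((\<lambda>q. (fseries (c (fst q)) (snd q) - fseries (c t) (snd q)) + fseries (c t) (snd q))
      \<longlongrightarrow> 0 + fseries (c t) x) (at p within ?S)" by (rule tendsto_add)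
  thus "((\<lambda>(t, x). fseries (c t) x) \<longlongrightarrow> (case p of (t, x) \<Rightarrow> fseries (c t) x)) (at p within ?S)"
    by (simp add: tx case_prod_beta')
qed

section \<open>The Hilbert transform as a Fourier multiplier\<close>

text \<open>
  This is \<open>1 + 2 * (\<Sum>j=1..<m. cos (j * z)) + cos (m * z)\<close> for \<open>m \<ge> 1\<close>. By the identity below, it is the continuous extension of
  \<open>cot (z / 2) * sin (m * z)\<close>.
\<close>

definition dirichlet :: "nat \<Rightarrow> real \<Rightarrow> real" where
  "dirichlet m z = (\<Sum>j<m. cos (real j * z) + cos (real (Suc j) * z))"

lemma dirichlet_identity: "sin (z / 2) * dirichlet m z = cos (z / 2) * sin (real m * z)"
proof (induction m)
  case (Suc m)
  define a where "a = (real m + 1 / 2) * z"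
  define b where "b = z / 2"
  have ab: "real m * z = a - b" "real (Suc m) * z = a + b" "z / 2 = b"
    by (simp_all add: a_def b_def field_simps)
  have "sin b * (cos (a - b) + cos (a + b)) = cos b * (sin (a + b) - sin (a - b))"
    by (simp add: cos_add cos_diff sin_add sin_diff algebra_simps)
  moreover have "dirichlet (Suc m) z = dirichlet m z + (cos (a - b) + cos (a + b))"
    by (simp only: dirichlet_def sum.lessThan_Suc ab)
  ultimately show ?case using Suc unfolding ab by (simp add: algebra_simps)
qed (simp add: dirichlet_def)

lemma dirichlet_bound: "\<bar>dirichlet m z\<bar> \<le> 2 * real m"
proof -
  have "\<bar>dirichlet m z\<bar> \<le> (\<Sum>j<m. 2)" unfolding dirichlet_def
  proof (rule order_trans[OF sum_abs sum_mono])
    fix j show "\<bar>cos (real j * z) + cos (real (Suc j) * z)\<bar> \<le> 2"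
      by (rule order_trans[OF abs_triangle_ineq]) (use abs_cos_le_one[of "real j * z"] abs_cos_le_one[of "real (Suc j) * z"] in linarith)
  qed
  thus ?thesis by simp
qed

lemma continuous_dirichlet: "continuous_on A (dirichlet m)"
  unfolding dirichlet_def by (intro continuous_intros)

lemma integral_cos_half_period: "((\<lambda>z. cos (real j * z)) has_integral (if j = 0 then pi else 0)) {0..pi}"
proof (cases "j = 0")
  case True
  thus ?thesis using has_integral_const_real[of "1::real" 0 pi] by simp
next
  case False
  have "((\<lambda>z. cos (real j * z)) has_integral sin (real j * pi) / real j - sin (real j * 0) / real j) {0..pi}"
  proof (rule fundamental_theorem_of_calculus)
    show "((\<lambda>z. sin (real j * z) / real j) has_vector_derivative cos (real j * z)) (at z within {0..pi})" for z
      unfolding has_real_derivative_iff_has_vector_derivative [symmetric]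
      using False by (auto intro!: derivative_eq_intros)
  qed simp
  thus ?thesis using False by simp
qed

lemma integral_dirichlet: "(dirichlet m has_integral (if m = 0 then 0 else pi)) {0..pi}"
proof -
  have "(dirichlet m has_integral (\<Sum>j<m. (if j = 0 then pi else 0) + (if Suc j = 0 then pi else 0))) {0..pi}"
    unfolding dirichlet_def by (intro has_integral_sum has_integral_add integral_cos_half_period) simp
  also have "(\<Sum>j<m. (if j = 0 then pi else 0) + (if Suc j = 0 then pi else 0)) = (if m = 0 then 0 else pi)"
    by (simp add: sum.delta)
  finally show ?thesis .
qed

lemma LBINT_translate:
  fixes g :: "real \<Rightarrow> real"
  shows "(LBINT y:{u + c..<v + c}. g y) = (LBINT y:{u..<v}. g (y + c))"
    and "set_integrable lborel {u + c..<v + c} g \<longleftrightarrow> set_integrable lborel {u..<v} (\<lambda>y. g (y + c))"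
proof -
  have ind: "indicator {u + c..<v + c} (c + 1 * y) = (indicator {u..<v} y :: real)" for y
    by (auto simp: indicator_def)
  show "(LBINT y:{u + c..<v + c}. g y) = (LBINT y:{u..<v}. g (y + c))"
    unfolding set_lebesgue_integral_def
    by (subst lborel_integral_real_affine[of 1 _ c]) (simp_all only: ind, simp_all add: add.commute)
  show "set_integrable lborel {u + c..<v + c} g \<longleftrightarrow> set_integrable lborel {u..<v} (\<lambda>y. g (y + c))"
    unfolding set_integrable_def
    by (subst lborel_integrable_real_affine_iff[of 1 _ c, symmetric]) (simp_all only: ind, simp_all add: add.commute)
qed

lemma LBINT_reflect:
  fixes g :: "real \<Rightarrow> real"
  shows "(LBINT y:{x - v..x - u}. g y) = (LBINT z:{u..v}. g (x - z))"
proof -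
  have ind: "indicator {x - v..x - u} (x + - 1 * z) = (indicator {u..v} z :: real)" for z
    by (auto simp: indicator_def)
  show ?thesis unfolding set_lebesgue_integral_def
    by (subst lborel_integral_real_affine[of "- 1" _ x]) (simp_all only: ind, simp_all)
qed

lemma LBINT_shift:
  fixes g :: "real \<Rightarrow> real"
  shows "(LBINT y:{x + u..x + v}. g y) = (LBINT z:{u..v}. g (x + z))"
proof -
  have ind: "indicator {x + u..x + v} (x + 1 * z) = (indicator {u..v} z :: real)" for z
    by (auto simp: indicator_def)
  show ?thesis unfolding set_lebesgue_integral_def
    by (subst lborel_integral_real_affine[of 1 _ x]) (simp_all only: ind, simp_all)
qed

lemma LBINT_half_open: "(LBINT y:{u..v}. g y) = (LBINT y:{u..<v}. g y)" if "u \<le> v"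
  for g :: "real \<Rightarrow> real"
  using interval_integral_Icc[OF that, of g] interval_integral_Ico[of u v g] that by simp

text \<open>
  Let \<open>b\<close> be the point congruent to \<open>- pi\<close> in the interval. The pieces to the left and to the right of \<open>b\<close> are
  translated by different multiples of the period and then fill \<open>[- pi, pi)\<close> in exchanged order.
\<close>

lemma LBINT_periodic:
  assumes per: "periodic g" and int: "set_integrable lborel {a..<a + 2 * pi} g"
  shows "(LBINT y:{-pi..<pi}. g y) = (LBINT y:{a..<a + 2 * pi}. g y)"
proof -
  define k where "k = \<lceil>(a + pi) / (2 * pi)\<rceil>"
  (* the multiple of the period, counted from - pi, that lies in the interval *)
  define b where "b = - pi + 2 * pi * of_int k"
  have "(a + pi) / (2 * pi) \<le> of_int k" "of_int k - 1 < (a + pi) / (2 * pi)"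
    unfolding k_def by linarith+
  hence "a + pi \<le> of_int k * (2 * pi)" "(of_int k - 1) * (2 * pi) < a + pi"
    by (simp_all only: pos_divide_le_eq pos_less_divide_eq pi_gt_zero zero_less_mult_iff zero_less_numeral simp_thms)
  hence b: "a \<le> b" "b \<le> a + 2 * pi" by (simp_all add: b_def algebra_simps)
  have split: "(LBINT y:{u..<w}. g y) = (LBINT y:{u..<v}. g y) + (LBINT y:{v..<w}. g y)"
    if "u \<le> v" "v \<le> w" "set_integrable lborel {u..<v} g" "set_integrable lborel {v..<w} g" for u v w
  proof -
    have "{u..<w} = {u..<v} \<union> {v..<w}" using that by auto
    thus ?thesis using that by (simp add: set_integral_Un)
  qed
  have i1: "set_integrable lborel {a..<b} g" and i2: "set_integrable lborel {b..<a + 2 * pi} g"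
    using b by (auto intro!: set_integrable_subset[OF int])
  have shift: "g (y + 2 * pi * of_int j) = g y" for y j by (rule periodic_int[OF per])
  define c1 where "c1 = 2 * pi * of_int (1 - k)"
  define c2 where "c2 = 2 * pi * of_int (- k)"
  have e: "a + 2 * pi + c2 = a + c1" "b + c1 = pi" "b + c2 = - pi"
    by (simp_all add: b_def c1_def c2_def algebra_simps)
  have j1: "set_integrable lborel {a + c1..<pi} g" "(LBINT y:{a + c1..<pi}. g y) = (LBINT y:{a..<b}. g y)"
    unfolding e(2) [symmetric] LBINT_translate using i1 by (simp_all only: shift c1_def)
  have j2: "set_integrable lborel {- pi..<a + c1} g" "(LBINT y:{- pi..<a + c1}. g y) = (LBINT y:{b..<a + 2 * pi}. g y)"
    unfolding e(3) [symmetric] e(1) [symmetric] LBINT_translate using i2 by (simp_all only: shift c2_def)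
  have le: "- pi \<le> a + c1" "a + c1 \<le> pi" using b e by linarith+
  have "(LBINT y:{-pi..<pi}. g y) = (LBINT y:{-pi..<a + c1}. g y) + (LBINT y:{a + c1..<pi}. g y)"
    by (rule split[OF le j2(1) j1(1)])
  also have "\<dots> = (LBINT y:{b..<a + 2 * pi}. g y) + (LBINT y:{a..<b}. g y)"
    using j1(2) j2(2) by simp
  also have "\<dots> = (LBINT y:{a..<a + 2 * pi}. g y)"
    using split[OF b i1 i2] by simp
  finally show ?thesis .
qed

text \<open>
  Centring the period at the singularity \<open>y = x\<close> and pairing \<open>x - z\<close> with \<open>x + z\<close> uses that the cotangent is odd.
\<close>

lemma truncated_hilbert_integral:
  assumes per: "periodic f" and cont: "continuous_on UNIV f" and \<epsilon>: "0 < \<epsilon>" "\<epsilon> < pi"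
  shows "(LBINT y:{y \<in> {-pi..pi}. \<forall>k::int. \<epsilon> \<le> \<bar>x - y - 2 * pi * of_int k\<bar>}. cot ((x - y) / 2) * f y)
     = (LBINT z:{\<epsilon>..pi}. cot (z / 2) * (f (x - z) - f (x + z)))"
proof -
  define P where "P y \<longleftrightarrow> (\<forall>k::int. \<epsilon> \<le> \<bar>x - y - 2 * pi * of_int k\<bar>)" for y
  define h where "h y = cot ((x - y) / 2) * f y" for y
  define g where "g y = (if P y then h y else 0)" for y
  have P_near: "P y \<longleftrightarrow> \<epsilon> \<le> \<bar>x - y\<bar>" if "\<bar>x - y\<bar> \<le> pi" for y
  proof
    assume "P y"
    thus "\<epsilon> \<le> \<bar>x - y\<bar>" using P_def[of y] by (metis diff_zero mult_zero_right of_int_0)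
  next
    assume *: "\<epsilon> \<le> \<bar>x - y\<bar>"
    show "P y" unfolding P_def
    proof
      fix k :: int
      show "\<epsilon> \<le> \<bar>x - y - 2 * pi * of_int k\<bar>"
      proof (cases "k = 0")
        case False
        hence "1 \<le> \<bar>k\<bar>" by linarith
        hence "1 \<le> \<bar>real_of_int k\<bar>" by linarith
        hence "2 * pi \<le> \<bar>2 * pi * real_of_int k\<bar>" by (simp add: abs_mult)
        thus ?thesis using that \<epsilon> by linarith
      qed (use * in simp)
    qed
  qed
  have hc1: "continuous_on {x - pi..x - \<epsilon>} h" unfolding h_def cot_def
  proof (intro continuous_intros continuous_on_subset[OF cont] ballI)
    fix y assume "y \<in> {x - pi..x - \<epsilon>}"
    hence "0 < (x - y) / 2" "(x - y) / 2 < pi" using \<epsilon> by auto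
    thus "sin ((x - y) / 2) \<noteq> 0" using sin_gt_zero[of "(x - y) / 2"] by linarith
  qed auto
  have hc2: "continuous_on {x + \<epsilon>..x + pi} h" unfolding h_def cot_def
  proof (intro continuous_intros continuous_on_subset[OF cont] ballI)
    fix y assume "y \<in> {x + \<epsilon>..x + pi}"
    hence "0 < (y - x) / 2" "(y - x) / 2 < pi" using \<epsilon> by auto
    hence "sin ((y - x) / 2) \<noteq> 0" using sin_gt_zero[of "(y - x) / 2"] by linarith
    moreover have "(x - y) / 2 = - ((y - x) / 2)" by (simp add: field_simps)
    hence "sin ((x - y) / 2) = - sin ((y - x) / 2)" by (simp only: sin_minus)
    ultimately show "sin ((x - y) / 2) \<noteq> 0" by simp
  qed auto
  note hi1 = borel_integrable_atLeastAtMost'[OF hc1] and hi2 = borel_integrable_atLeastAtMost'[OF hc2]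
  have hi2': "set_integrable lborel {x + \<epsilon>..<x + pi} h" by (rule set_integrable_subset[OF hi2]) auto
  have U: "set_integrable lborel ({x - pi..x - \<epsilon>} \<union> {x + \<epsilon>..<x + pi}) h"
    by (rule set_integrable_Un[OF hi1 hi2']) auto
  have geq: "indicator {x - pi..<x - pi + 2 * pi} y *\<^sub>R g y
      = indicator ({x - pi..x - \<epsilon>} \<union> {x + \<epsilon>..<x + pi}) y *\<^sub>R h y" for y
    using P_near[of y] \<epsilon> by (auto simp: indicator_def g_def)
  have "(LBINT y:{y \<in> {-pi..pi}. P y}. cot ((x - y) / 2) * f y) = (LBINT y:{-pi..pi}. g y)"
    unfolding set_lebesgue_integral_def g_def h_def
    by (intro Bochner_Integration.integral_cong) (auto simp: indicator_def)
  also have "\<dots> = (LBINT y:{-pi..<pi}. g y)" by (rule LBINT_half_open) simp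
  also have "\<dots> = (LBINT y:{x - pi..<x - pi + 2 * pi}. g y)"
  proof (rule LBINT_periodic)
    show "periodic g" unfolding periodic_def
    proof
      fix y
      have "P (y + 2 * pi) \<longleftrightarrow> P y"
      proof
        assume *: "P (y + 2 * pi)"
        show "P y" unfolding P_def
        proof
          fix k :: int
          show "\<epsilon> \<le> \<bar>x - y - 2 * pi * of_int k\<bar>"
            using *[unfolded P_def, rule_format, of "k - 1"] by (simp add: algebra_simps)
        qed
      next
        assume *: "P y"
        show "P (y + 2 * pi)" unfolding P_def
        proof
          fix k :: int
          show "\<epsilon> \<le> \<bar>x - (y + 2 * pi) - 2 * pi * of_int k\<bar>"
            using *[unfolded P_def, rule_format, of "k + 1"] by (simp add: algebra_simps)
        qed
      qed
      moreover have "cot ((x - (y + 2 * pi)) / 2) = cot ((x - y) / 2)"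
      proof -
        have "(x - (y + 2 * pi)) / 2 = (x - y) / 2 - pi" by (simp add: field_simps)
        thus ?thesis by (simp only: cot_def sin_diff cos_diff) simp
      qed
      ultimately show "g (y + 2 * pi) = g y" using per by (simp add: g_def h_def periodic_def)
    qed
  next
    show "set_integrable lborel {x - pi..<x - pi + 2 * pi} g"
      using U unfolding set_integrable_def geq .
  qed
  also have "\<dots> = (LBINT y:{x - pi..x - \<epsilon>} \<union> {x + \<epsilon>..<x + pi}. h y)"
    unfolding set_lebesgue_integral_def geq ..
  also have "\<dots> = (LBINT y:{x - pi..x - \<epsilon>}. h y) + (LBINT y:{x + \<epsilon>..<x + pi}. h y)"
    by (rule set_integral_Un[OF _ hi1 hi2']) (use \<epsilon> in auto)
  also have "(LBINT y:{x + \<epsilon>..<x + pi}. h y) = (LBINT y:{x + \<epsilon>..x + pi}. h y)"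
    by (rule LBINT_half_open [symmetric]) (use \<epsilon> in simp)
  also have "(LBINT y:{x - pi..x - \<epsilon>}. h y) + (LBINT y:{x + \<epsilon>..x + pi}. h y)
      = (LBINT z:{\<epsilon>..pi}. h (x - z)) + (LBINT z:{\<epsilon>..pi}. h (x + z))"
    unfolding LBINT_reflect LBINT_shift ..
  also have "\<dots> = (LBINT z:{\<epsilon>..pi}. h (x - z) + h (x + z))"
  proof (rule set_integral_add(2) [symmetric]; rule borel_integrable_atLeastAtMost')
    show "continuous_on {\<epsilon>..pi} (\<lambda>z. h (x - z))"
      by (rule continuous_on_compose2[OF hc1]) (auto intro!: continuous_intros)
    show "continuous_on {\<epsilon>..pi} (\<lambda>z. h (x + z))"
      by (rule continuous_on_compose2[OF hc2]) (auto intro!: continuous_intros)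
  qed
  also have "(\<lambda>z. h (x - z) + h (x + z)) = (\<lambda>z. cot (z / 2) * (f (x - z) - f (x + z)))"
  proof
    fix z
    have "(x - (x + z)) / 2 = - (z / 2)" "(x - (x - z)) / 2 = z / 2" by simp_all
    moreover have "cot (- (z / 2)) = - cot (z / 2)" by (simp add: cot_def)
    ultimately show "h (x - z) + h (x + z) = cot (z / 2) * (f (x - z) - f (x + z))"
      by (simp add: h_def right_diff_distrib)
  qed
  finally show ?thesis unfolding P_def .
qed

text \<open>
  For a single exponential, \<open>cot (z / 2) * (f (x - z) - f (x + z))\<close> is a multiple of \<open>cot (z / 2) * sin (n * z)\<close>,
  which extends continuously to \<open>z = 0\<close> as a Dirichlet kernel of size at most \<open>2 * \<bar>n\<bar>\<close> and has integral \<open>sgn n * pi\<close> over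
  \<open>[0, pi]\<close>. Since \<open>\<Sum>n. \<bar>n\<bar> * \<bar>c n\<bar>\<close> is finite, the paired integrand of \<open>f\<close> itself extends to a continuous function \<open>Q\<close>, so
  the principal value exists and is the integral of \<open>Q\<close>, computed term by term.
\<close>

theorem hilbert_fseries:
  assumes c: "l1 c" and nc: "l1 (\<lambda>n. of_int n * c n)" and f: "\<And>x. complex_of_real (f x) = fseries c x"
  shows "complex_of_real (hilbert f x) = fseries (\<lambda>n. - \<i> * of_int (sgn n) * c n) x"
proof -
  have f': "f = (\<lambda>x. Re (fseries c x))" using f by (metis Re_complex_of_real)
  have cont: "continuous_on A f" for A unfolding f' by (intro continuous_intros continuous_fseries c)
  have per: "periodic f" by (simp add: periodic_def f' fseries_periodic)
  have sym: "cnj (c (- n)) = c n" for n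
    using fourier_coeff_cnj[of f n] fourier_coeff_fseries[OF c f] by simp
  let ?d = "\<lambda>n. - \<i> * of_int (sgn n) * c n"
  have d: "l1 ?d" by (rule l1_bounded[OF c, of _ 1]) (auto simp: norm_mult sgn_if)
  have dsym: "cnj (?d (- n)) = ?d n" for n using sym[of n] by (simp add: sgn_if)
  define \<nu> where "\<nu> i = int_decode i" for i
  define K where "K i z = of_int (sgn (\<nu> i)) * dirichlet (nat \<bar>\<nu> i\<bar>) z" for i z
  define b where "b i = - 2 * \<i> * (c (\<nu> i) * cis (of_int (\<nu> i) * x))" for i
  have bound: "cmod (b i * of_real (K i z)) \<le> 4 * cmod (of_int (\<nu> i) * c (\<nu> i))" for i z
  proof -
    have "\<bar>K i z\<bar> \<le> 2 * \<bar>of_int (\<nu> i)\<bar>"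
      using dirichlet_bound[of "nat \<bar>\<nu> i\<bar>" z] by (auto simp: K_def abs_mult sgn_if)
    hence "2 * cmod (c (\<nu> i)) * \<bar>K i z\<bar> \<le> 2 * cmod (c (\<nu> i)) * (2 * \<bar>of_int (\<nu> i)\<bar>)"
      by (intro mult_left_mono) auto
    thus ?thesis by (simp add: b_def norm_mult algebra_simps)
  qed
  have sm: "summable (\<lambda>i. 4 * cmod (of_int (\<nu> i) * c (\<nu> i)))"
    unfolding \<nu>_def by (intro summable_mult fseries_sums(2)[OF nc])
  define Q where "Q z = (\<Sum>i. b i * of_real (K i z))" for z
  have Qc: "continuous_on A Q" for A
    unfolding Q_def
  proof (rule uniform_limit_theorem)
    show "uniform_limit A (\<lambda>n z. \<Sum>i<n. b i * of_real (K i z)) (\<lambda>z. \<Sum>i. b i * of_real (K i z)) sequentially"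
      by (rule Weierstrass_m_test[OF bound sm])
    show "\<forall>\<^sub>F n in sequentially. continuous_on A (\<lambda>z. \<Sum>i<n. b i * of_real (K i z))"
      unfolding K_def by (intro always_eventually allI continuous_intros continuous_dirichlet)
  qed simp
  have kernel: "cot (z / 2) * (f (x - z) - f (x + z)) = Re (Q z)" if z: "0 < z" "z \<le> pi" for z
  proof -
    have sin: "sin (z / 2) \<noteq> 0" using sin_gt_zero[of "z / 2"] z pi_gt_zero by linarith
    have K: "of_real (cot (z / 2)) * (c (\<nu> i) * cis (of_int (\<nu> i) * (x - z)) - c (\<nu> i) * cis (of_int (\<nu> i) * (x + z)))
        = b i * of_real (K i z)" for i
    proof -
      have "sin (of_int (\<nu> i) * z) = of_int (sgn (\<nu> i)) * sin (real (nat \<bar>\<nu> i\<bar>) * z)"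
        by (auto simp: sgn_if abs_if)
      hence "cot (z / 2) * sin (of_int (\<nu> i) * z) = K i z"
        using dirichlet_identity[of z "nat \<bar>\<nu> i\<bar>"] sin by (simp add: K_def cot_def field_simps)
      moreover have "cis (of_int (\<nu> i) * (x - z)) - cis (of_int (\<nu> i) * (x + z))
          = cis (of_int (\<nu> i) * x) * (- 2 * \<i> * of_real (sin (of_int (\<nu> i) * z)))"
        by (simp add: complex_eq_iff distrib_left right_diff_distrib cos_add cos_diff sin_add sin_diff)
      ultimately have "of_real (cot (z / 2)) * (c (\<nu> i) * (cis (of_int (\<nu> i) * (x - z)) - cis (of_int (\<nu> i) * (x + z))))
        = b i * of_real (K i z)"
        by (simp add: b_def mult_ac flip: of_real_mult)
      thus ?thesis by (simp add: right_diff_distrib)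
    qed
    have "(\<lambda>i. of_real (cot (z / 2)) * (c (\<nu> i) * cis (of_int (\<nu> i) * (x - z)) - c (\<nu> i) * cis (of_int (\<nu> i) * (x + z))))
        sums (of_real (cot (z / 2)) * (fseries c (x - z) - fseries c (x + z)))"
      unfolding \<nu>_def by (intro sums_mult sums_diff fseries_sums(1)[OF c])
    hence "of_real (cot (z / 2)) * (fseries c (x - z) - fseries c (x + z)) = Q z"
      unfolding K Q_def by (rule sums_unique)
    thus ?thesis unfolding f [symmetric] by (metis Re_complex_of_real of_real_diff of_real_mult)
  qed
  have LQ: "(LBINT z:{0..pi}. Q z) = 2 * pi * fseries ?d x"
  proof -
    let ?t = "\<lambda>i z. indicator {0..pi} z *\<^sub>R (b i * of_real (K i z))"
    have int: "integrable lborel (?t i)" for i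
      unfolding K_def by (intro borel_integrable_compact continuous_intros continuous_dirichlet) auto
    have "(\<lambda>i. integral\<^sup>L lborel (?t i)) sums (LINT z|lborel. (\<Sum>i. ?t i z))"
    proof (rule sums_integral[OF int])
      have le: "norm (?t i z) \<le> 4 * cmod (of_int (\<nu> i) * c (\<nu> i))" for i z
        using bound[of i z] by (auto simp: indicator_def)
      show "AE z in lborel. summable (\<lambda>i. norm (?t i z))"
        by (intro AE_I2 summable_comparison_test'[OF sm]) (use le in simp)
      have "(LINT z|lborel. norm (?t i z)) \<le> (LINT z|lborel. indicator {0..pi} z * (4 * cmod (of_int (\<nu> i) * c (\<nu> i))))" for i
      proof (rule integral_mono)
        show "integrable lborel (\<lambda>z. norm (?t i z))" by (intro integrable_norm int)
        show "norm (?t i z) \<le> indicator {0..pi} z * (4 * cmod (of_int (\<nu> i) * c (\<nu> i)))" for z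
        proof (cases "z \<in> {0..pi}")
          case True
          hence ind: "indicator {0..pi} z = (1::real)" by (rule indicator_simps(1))
          show ?thesis using le[of z i] unfolding ind by (simp only: mult_1)
        next
          case False
          hence ind: "indicator {0..pi} z = (0::real)" by (rule indicator_simps(2))
          show ?thesis unfolding ind by (simp only: scaleR_zero_left norm_zero mult_zero_left)
        qed
        show "integrable lborel (\<lambda>z. indicator {0..pi} z * (4 * cmod (of_int (\<nu> i) * c (\<nu> i))))"
          by (intro integrable_mult_left) simp
      qed
      hence "(LINT z|lborel. norm (?t i z)) \<le> pi * (4 * cmod (of_int (\<nu> i) * c (\<nu> i)))" for i by simp
      thus "summable (\<lambda>i. LINT z|lborel. norm (?t i z))"
        by (intro summable_comparison_test'[OF summable_mult[OF sm, of pi]]) simp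
    qed
    moreover have "(\<Sum>i. ?t i z) = indicator {0..pi} z *\<^sub>R Q z" for z
    proof -
      have "summable (\<lambda>i. b i * of_real (K i z))"
        by (rule summable_comparison_test'[OF sm, of 0]) (rule bound)
      thus ?thesis unfolding Q_def by (rule suminf_scaleR_right [symmetric])
    qed
    moreover have "integral\<^sup>L lborel (?t i) = 2 * pi * (?d (\<nu> i) * cis (of_int (\<nu> i) * x))" for i
    proof -
      have Ki: "(K i has_integral of_int (sgn (\<nu> i)) * (if nat \<bar>\<nu> i\<bar> = 0 then 0 else pi)) {0..pi}"
        unfolding K_def[abs_def] by (intro has_integral_mult_right integral_dirichlet)
      have "set_integrable lborel {0..pi} (K i)"
        unfolding K_def by (intro borel_integrable_atLeastAtMost' continuous_intros continuous_dirichlet)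
      hence "(LBINT z:{0..pi}. K i z) = integral {0..pi} (K i)"
        by (rule set_borel_integral_eq_integral(2))
      also have "\<dots> = of_int (sgn (\<nu> i)) * pi"
        using integral_unique[OF Ki] by (auto simp: sgn_if)
      finally have "(LBINT z:{0..pi}. K i z) = of_int (sgn (\<nu> i)) * pi" .
      hence Kc: "(LBINT z:{0..pi}. complex_of_real (K i z)) = of_int (sgn (\<nu> i)) * pi"
        by (simp add: set_integral_complex_of_real)
      have "integral\<^sup>L lborel (?t i) = (LBINT z:{0..pi}. b i * complex_of_real (K i z))"
        unfolding set_lebesgue_integral_def ..
      also have "\<dots> = b i * (LBINT z:{0..pi}. complex_of_real (K i z))"
        by (rule set_integral_mult_right)
      finally have "integral\<^sup>L lborel (?t i) = b i * (LBINT z:{0..pi}. complex_of_real (K i z))" .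
      thus ?thesis unfolding Kc by (simp add: b_def algebra_simps)
    qed
    ultimately have "(\<lambda>i. 2 * pi * (?d (\<nu> i) * cis (of_int (\<nu> i) * x))) sums (LBINT z:{0..pi}. Q z)"
      by (simp add: set_lebesgue_integral_def)
    moreover have "(\<lambda>i. 2 * pi * (?d (\<nu> i) * cis (of_int (\<nu> i) * x))) sums (2 * pi * fseries ?d x)"
      unfolding \<nu>_def by (intro sums_mult fseries_sums(1)[OF d])
    ultimately show ?thesis by (rule sums_unique2)
  qed
  define q where "q z = Re (Q z)" for z
  have qc: "continuous_on A q" for A unfolding q_def by (intro continuous_intros Qc)
  have Lq: "integral {0..pi} q = 2 * pi * Re (fseries ?d x)"
  proof -
    have "integral {0..pi} q = (LBINT z:{0..pi}. q z)"
      by (intro set_borel_integral_eq_integral(2) [symmetric] borel_integrable_atLeastAtMost' qc)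
    also have "\<dots> = Re (LBINT z:{0..pi}. Q z)"
      using borel_integrable_atLeastAtMost'[OF Qc, of 0 pi]
      by (simp add: q_def set_lebesgue_integral_def set_integrable_def flip: integral_Re)
    finally show ?thesis unfolding LQ by simp
  qed
  have "continuous_on {0..pi} (\<lambda>\<epsilon>. integral {\<epsilon>..pi} q)"
    by (intro indefinite_integral_continuous_1' integrable_continuous_interval qc)
  hence "((\<lambda>\<epsilon>. integral {\<epsilon>..pi} q) \<longlongrightarrow> integral {0..pi} q) (at 0 within {0..pi})"
    by (simp add: continuous_on_def)
  hence "((\<lambda>\<epsilon>. integral {\<epsilon>..pi} q) \<longlongrightarrow> integral {0..pi} q) (at_right 0)"
    by (simp only: at_within_Icc_at_right[OF pi_gt_zero])
  hence lim: "((\<lambda>\<epsilon>. 1 / (2 * pi) * integral {\<epsilon>..pi} q) \<longlongrightarrow> 1 / (2 * pi) * (2 * pi * Re (fseries ?d x))) (at_right 0)"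
    unfolding Lq by (intro tendsto_intros)
  let ?H = "\<lambda>\<epsilon>. 1 / (2 * pi) *
       (LBINT y:{y \<in> {-pi..pi}. \<forall>k::int. \<epsilon> \<le> \<bar>x - y - 2 * pi * of_int k\<bar>}. cot ((x - y) / 2) * f y)"
  have "\<forall>\<^sub>F \<epsilon> in at_right 0. 1 / (2 * pi) * integral {\<epsilon>..pi} q = ?H \<epsilon>"
  proof (rule eventually_at_rightI[of 0 pi])
    fix \<epsilon> :: real assume "\<epsilon> \<in> {0<..<pi}"
    hence \<epsilon>: "0 < \<epsilon>" "\<epsilon> < pi" by auto
    have "integral {\<epsilon>..pi} q = (LBINT z:{\<epsilon>..pi}. q z)"
      by (intro set_borel_integral_eq_integral(2) [symmetric] borel_integrable_atLeastAtMost' qc)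
    also have "\<dots> = (LBINT z:{\<epsilon>..pi}. cot (z / 2) * (f (x - z) - f (x + z)))"
      by (rule set_lebesgue_integral_cong) (use kernel \<epsilon> in \<open>auto simp: q_def\<close>)
    finally show "1 / (2 * pi) * integral {\<epsilon>..pi} q = ?H \<epsilon>"
      unfolding truncated_hilbert_integral[OF per cont \<epsilon>] by simp
  qed simp
  with lim have "(?H \<longlongrightarrow> 1 / (2 * pi) * (2 * pi * Re (fseries ?d x))) (at_right 0)"
    by (rule Lim_transform_eventually)
  hence "hilbert f x = 1 / (2 * pi) * (2 * pi * Re (fseries ?d x))"
    unfolding hilbert_def by (intro tendsto_Lim) auto
  hence "hilbert f x = Re (fseries ?d x)" by simp
  thus ?thesis using fseries_real[of ?d x, OF dsym] by simp
qed

section \<open>The operator in physical and in Fourier variables\<close>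

lemma fseries_single: "fseries (\<lambda>n. if n = j then z else 0) x = z * cis (of_int j * x)"
  unfolding fseries_def
  by (rule infsumI, rule has_sum_finite_neutralI[where B = "{j}"]) auto

lemma l1_single: "l1 (\<lambda>n. if n = j then z else 0)"
  unfolding l1_def
  by (rule has_sum_imp_summable, rule has_sum_finite_neutralI[where B = "{j}"]) auto

text \<open>
  The coefficients of \<open>v\<close>, including the mean that makes \<open>v 0 = 0\<close>.
\<close>

definition velocity_coeff :: "(int \<Rightarrow> complex) \<Rightarrow> int \<Rightarrow> complex" where
  "velocity_coeff c n = (if n = 0 then vsum c else 0) - c n / of_int \<bar>n\<bar>"

lemma of_int_mult_div_abs: "of_int n / complex_of_int \<bar>n\<bar> = of_int (sgn n)"
  by (auto simp: sgn_if abs_if)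

lemma l1_velocity:
  assumes "l1 c"
  shows "l1 (\<lambda>n. c n / of_int \<bar>n\<bar>)" "l1 (velocity_coeff c)" "l1 (\<lambda>n. of_int n * velocity_coeff c n)"
proof -
  show a: "l1 (\<lambda>n. c n / of_int \<bar>n\<bar>)"
  proof (rule l1_bounded[OF assms, of _ 1])
    fix n :: int
    show "cmod (c n / of_int \<bar>n\<bar>) \<le> 1 * cmod (c n)"
    proof (cases "n = 0")
      case False
      hence "1 \<le> \<bar>n\<bar>" by linarith
      hence "1 \<le> real_of_int \<bar>n\<bar>" by linarith
      thus ?thesis by (simp add: norm_divide divide_le_eq mult_left_le_one_le mult_le_cancel_left1)
    qed simp
  qed
  show "l1 (velocity_coeff c)" unfolding velocity_coeff_def by (intro l1_diff l1_single a)
  show "l1 (\<lambda>n. of_int n * velocity_coeff c n)"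
    by (rule l1_bounded[OF assms, of _ 1]) (auto simp: velocity_coeff_def norm_mult norm_divide)
qed

lemma fseries_velocity_at_0:
  assumes "l1 c"
  shows "fseries (velocity_coeff c) 0 = 0"
proof -
  have "fseries (velocity_coeff c) 0 = fseries (\<lambda>n. if n = 0 then vsum c else 0) 0 - fseries (\<lambda>n. c n / of_int \<bar>n\<bar>) 0"
    unfolding velocity_coeff_def by (intro fseries_diff l1_single l1_velocity assms)
  also have "fseries (\<lambda>n. c n / of_int \<bar>n\<bar>) 0 = vsum c" by (simp add: fseries_def vsum_def)
  finally show ?thesis by (simp add: fseries_single)
qed

lemma fseries_velocity_derivative:
  assumes "l1 c"
  shows "(fseries (velocity_coeff c) has_vector_derivative fseries (\<lambda>n. - \<i> * of_int (sgn n) * c n) x) (at x)"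
proof -
  have "\<i> * of_int n * velocity_coeff c n = - \<i> * of_int (sgn n) * c n" for n
  proof (cases "n = 0")
    case False
    have "\<i> * of_int n * velocity_coeff c n = - \<i> * (of_int n / complex_of_int \<bar>n\<bar>) * c n"
      using False by (simp add: velocity_coeff_def)
    thus ?thesis unfolding of_int_mult_div_abs .
  qed simp
  hence "(\<lambda>n. \<i> * of_int n * velocity_coeff c n) = (\<lambda>n. - \<i> * of_int (sgn n) * c n)" by (rule ext)
  with fseries_has_vector_derivative[OF l1_velocity(2,3)[OF assms], of x] show ?thesis by simp
qed

lemma velocity_symmetric:
  assumes "\<And>n. cnj (c (- n)) = c n"
  shows "cnj (velocity_coeff c (- n)) = velocity_coeff c n"
proof -
  have "cnj (vsum c) = (\<Sum>\<^sub>\<infinity>k. cnj (c k / of_int \<bar>k\<bar>))" unfolding vsum_def by (rule infsum_cnj [symmetric])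
  also have "\<dots> = (\<Sum>\<^sub>\<infinity>k. c (- k) / of_int \<bar>- k\<bar>)"
    by (rule infsum_cong) (use assms[of "- _"] in simp)
  also have "\<dots> = vsum c" unfolding vsum_def
    by (rule infsum_reindex_bij_betw[of uminus UNIV UNIV "\<lambda>k. c k / of_int \<bar>k\<bar>"]) (auto intro: bij_uminus)
  finally show ?thesis using assms by (simp add: velocity_coeff_def)
qed

lemma coeff_symmetric:
  assumes "l1 c" "\<And>x. complex_of_real (f x) = fseries c x"
  shows "cnj (c (- n)) = c n"
  using fourier_coeff_cnj[of f n] fourier_coeff_fseries[OF assms] by simp

lemma velocity_real:
  assumes "l1 c" "\<And>x. complex_of_real (f x) = fseries c x"
  shows "complex_of_real (Re (fseries (velocity_coeff c) x)) = fseries (velocity_coeff c) x"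
  by (rule fseries_real, rule velocity_symmetric, rule coeff_symmetric[OF assms])

lemma velocity_derivative:
  assumes c: "c \<in> hseq 2" and f: "\<And>x. complex_of_real (f x) = fseries c x"
  shows "((\<lambda>x. Re (fseries (velocity_coeff c) x)) has_real_derivative hilbert f x) (at x)"
proof -
  have l: "l1 c" "l1 (\<lambda>n. of_int n * c n)" using c hseq_imp_l1 hseq_imp_l1_deriv by auto
  have "((\<lambda>x. Re (fseries (velocity_coeff c) x)) has_real_derivative
      Re (fseries (\<lambda>n. - \<i> * of_int (sgn n) * c n) x)) (at x)"
    using fseries_velocity_derivative[OF l(1)] by (rule has_field_derivative_Re)
  thus ?thesis unfolding hilbert_fseries[OF l f, symmetric] by simp
qed

lemma velocity_unique:
  assumes c: "c \<in> hseq 2" and f: "\<And>x. complex_of_real (f x) = fseries c x"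
    and v: "\<And>x. (v has_real_derivative hilbert f x) (at x)" "v 0 = 0"
  shows "complex_of_real (v x) = fseries (velocity_coeff c) x"
proof -
  have l: "l1 c" using c hseq_imp_l1 by auto
  have "DERIV (\<lambda>x. v x - Re (fseries (velocity_coeff c) x)) x :> hilbert f x - hilbert f x" for x
    by (intro DERIV_diff v velocity_derivative[OF c f])
  hence "v x - Re (fseries (velocity_coeff c) x) = v 0 - Re (fseries (velocity_coeff c) 0)"
    by (intro DERIV_isconst_all) simp
  hence "v x = Re (fseries (velocity_coeff c) x)" by (simp add: v(2) fseries_velocity_at_0[OF l])
  thus ?thesis using velocity_real[OF l f] by simp
qed

lemma deriv_fseries:
  assumes c: "c \<in> hseq 2" and f: "\<And>x. complex_of_real (f x) = fseries c x"
  shows "(f has_real_derivative Re (fseries (\<lambda>n. \<i> * of_int n * c n) x)) (at x)"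
    and "complex_of_real (deriv f x) = fseries (\<lambda>n. \<i> * of_int n * c n) x"
proof -
  have l: "l1 c" "l1 (\<lambda>n. of_int n * c n)" using c hseq_imp_l1 hseq_imp_l1_deriv by auto
  have f': "f = (\<lambda>x. Re (fseries c x))" using f by (metis Re_complex_of_real)
  show d: "(f has_real_derivative Re (fseries (\<lambda>n. \<i> * of_int n * c n) x)) (at x)"
    unfolding f' by (rule has_field_derivative_Re[OF fseries_has_vector_derivative[OF l]])
  have "complex_of_real (Re (fseries (\<lambda>n. \<i> * of_int n * c n) x)) = fseries (\<lambda>n. \<i> * of_int n * c n) x"
    by (rule fseries_real) (use coeff_symmetric[OF l(1) f] in simp)
  thus "complex_of_real (deriv f x) = fseries (\<lambda>n. \<i> * of_int n * c n) x"
    using DERIV_imp_deriv[OF d] by simp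
qed

text \<open>
  Writing \<open>sin 2x\<close> and \<open>cos 2x\<close> with \<open>cis (2x)\<close> and \<open>cis (- 2x)\<close>, the operator becomes
  \<open>cis (2x) * p + cis (- 2x) * q\<close>, where the coefficients of \<open>p\<close> and \<open>q\<close> are \<open>shift_coeff n * c n\<close> and \<open>shift_coeff (- n) * c n\<close>,
  corrected at \<open>n = 0\<close> by the mean of \<open>v\<close>; the correction is what appears at \<open>\<bar>n\<bar> = 2\<close> in \<open>Lseq\<close>.
\<close>

theorem L_op_fseries:
  assumes c: "c \<in> hseq 2" and f: "\<And>x. complex_of_real (f x) = fseries c x"
    and v: "complex_of_real (v x) = fseries (velocity_coeff c) x"
  shows "complex_of_real (L_op f v x) = fseries (Lseq c) x"
proof -
  have l: "l1 c" "l1 (\<lambda>n. of_int n * c n)" using c hseq_imp_l1 hseq_imp_l1_deriv by auto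
  define w where "w = velocity_coeff c"
  define p where "p n = of_real (shift_coeff n) * c n - (if n = 0 then vsum c else 0)" for n
  define q where "q n = of_real (shift_coeff (- n)) * c n - (if n = 0 then vsum c else 0)" for n
  have lw: "l1 w" unfolding w_def by (rule l1_velocity[OF l(1)])
  have lh: "l1 (\<lambda>n. of_int (sgn n) * c n)" by (rule l1_bounded[OF l(1), of _ 1]) (auto simp: norm_mult sgn_if)
  have p: "p n = (1 / 4) * (of_int n * c n) + (- 1 / 2) * c n + (- 1 / 2) * (of_int (sgn n) * c n) + - 1 * w n" for n
    by (simp add: p_def w_def velocity_coeff_def shift_coeff_def field_simps del: of_int_abs)
  have q: "q n = (- 1 / 4) * (of_int n * c n) + (- 1 / 2) * c n + (1 / 2) * (of_int (sgn n) * c n) + - 1 * w n" for n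
    by (simp add: q_def w_def velocity_coeff_def shift_coeff_def field_simps del: of_int_abs)
  note ls = l1_add l1_scale l lh lw
  have lp: "l1 p" and lq: "l1 q" unfolding p[abs_def] q[abs_def] by (intro ls)+
  define F where "F = fseries c x"
  define D where "D = fseries (\<lambda>n. of_int n * c n) x"
  define S where "S = fseries (\<lambda>n. of_int (sgn n) * c n) x"
  define W where "W = fseries w x"
  have P: "fseries p x = (1 / 4) * D + (- 1 / 2) * F + (- 1 / 2) * S + - 1 * W"
    unfolding p[abs_def] D_def F_def S_def W_def
    by (simp only: fseries_add fseries_scale ls)
  have Q: "fseries q x = (- 1 / 4) * D + (- 1 / 2) * F + (1 / 2) * S + - 1 * W"
    unfolding q[abs_def] D_def F_def S_def W_def
    by (simp only: fseries_add fseries_scale ls)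
  have L: "Lseq c n = p (n + - 2) + q (n + 2)" for n
    by (auto simp: Lseq_def p_def q_def)
  have "fseries (Lseq c) x = fseries (\<lambda>n. p (n + - 2) + q (n + 2)) x" unfolding L[abs_def] ..
  also have "\<dots> = fseries (\<lambda>n. p (n + - 2)) x + fseries (\<lambda>n. q (n + 2)) x"
    by (intro fseries_add l1_shift lp lq)
  also have "\<dots> = cis (- (of_int (- 2) * x)) * fseries p x + cis (- (of_int 2 * x)) * fseries q x"
    by (simp only: fseries_shift[OF lp] fseries_shift[OF lq])
  also have "\<dots> = cis (2 * x) * fseries p x + cis (- (2 * x)) * fseries q x" by simp
  also have "\<dots> = 1 / 2 * sin (2 * x) * (\<i> * D) - cos (2 * x) * F + sin (2 * x) * (- \<i> * S) - 2 * cos (2 * x) * W"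
  proof -
    have cis: "cis (2 * x) = of_real (cos (2 * x)) + \<i> * of_real (sin (2 * x))"
      "cis (- (2 * x)) = of_real (cos (2 * x)) - \<i> * of_real (sin (2 * x))"
      by (simp_all add: complex_eq_iff)
    show ?thesis unfolding P Q cis by (simp add: field_simps)
  qed
  also have "\<i> * D = complex_of_real (deriv f x)"
    unfolding deriv_fseries(2)[OF c f] D_def by (simp only: fseries_scale [symmetric] mult.assoc)
  also have "- \<i> * S = complex_of_real (hilbert f x)"
    unfolding hilbert_fseries[OF l f] S_def by (simp only: fseries_scale [symmetric] mult.assoc)
  also have "F = complex_of_real (f x)" by (simp add: F_def f)
  also have "W = complex_of_real (v x)" by (simp add: W_def w_def v)
  finally show ?thesis by (simp add: L_op_def)
qed

section \<open>Curves in Sobolev spaces\<close>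

lemma C_sobolev_0_fseries:
  assumes c: "hcont T s c" and s: "s \<ge> 1"
    and u: "\<And>t x. t \<in> {0..T} \<Longrightarrow> complex_of_real (u t x) = fseries (c t) x"
  shows "u \<in> C_sobolev 0 T s"
  unfolding C_sobolev.simps
proof (intro CollectI ballI conjI)
  fix t assume t: "t \<in> {0..T}"
  show "u t \<in> sobolev s" by (rule fseries_in_sobolev[OF hcont_seq[OF c t] s u[OF t]])
  have "((\<lambda>r. sqrt (hsq s (\<lambda>n. c r n - c t n))) \<longlongrightarrow> sqrt 0) (at t within {0..T})"
    by (intro tendsto_intros hcont_tendsto[OF c t])
  hence lim: "((\<lambda>r. sqrt (hsq s (\<lambda>n. c r n - c t n))) \<longlongrightarrow> 0) (at t within {0..T})" by simp
  show "((\<lambda>r. sobolev_norm s (\<lambda>x. u r x - u t x)) \<longlongrightarrow> 0) (at t within {0..T})"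
  proof (rule Lim_transform_eventually[OF lim])
    show "\<forall>\<^sub>F r in at t within {0..T}. sqrt (hsq s (\<lambda>n. c r n - c t n)) = sobolev_norm s (\<lambda>x. u r x - u t x)"
      using eventually_in_interval
    proof eventually_elim
      case (elim r)
      have l: "l1 (c r)" "l1 (c t)" using hcont_seq[OF c] elim t s hseq_imp_l1 by auto
      have "fourier_coeff (\<lambda>x. u r x - u t x) = (\<lambda>n. c r n - c t n)"
        by (rule fourier_coeff_fseries) (simp_all add: l1_diff l fseries_diff u elim[simplified] t[simplified])
      thus ?case by (simp add: sobolev_norm_eq)
    qed
  qed
qed

lemma C_sobolev_Suc_fseries:
  assumes c: "hcont T s c" and c': "hcont T s c'" and s: "s \<ge> 1"
    and der: "\<And>t n. t \<in> {0..T} \<Longrightarrow> ((\<lambda>r. c r n) has_vector_derivative c' t n) (at t within {0..T})"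
    and u: "\<And>t x. t \<in> {0..T} \<Longrightarrow> complex_of_real (u t x) = fseries (c t) x"
    and u': "\<And>t x. t \<in> {0..T} \<Longrightarrow> complex_of_real (u' t x) = fseries (c' t) x"
    and mem: "u' \<in> C_sobolev j T s"
  shows "u \<in> C_sobolev (Suc j) T s"
  unfolding C_sobolev.simps
proof (intro CollectI bexI[OF _ mem] ballI conjI)
  fix t assume t: "t \<in> {0..T}"
  show "u t \<in> sobolev s" by (rule fseries_in_sobolev[OF hcont_seq[OF c t] s u[OF t]])
  let ?q = "\<lambda>r n. (c r n - c t n) / of_real (r - t) - c' t n"
  have "((\<lambda>r. sqrt (hsq s (?q r))) \<longlongrightarrow> sqrt 0) (at t within {0..T})"
    by (intro tendsto_intros hcont_derivative[OF der c' t])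
  hence lim: "((\<lambda>r. sqrt (hsq s (?q r))) \<longlongrightarrow> 0) (at t within {0..T})" by simp
  show "((\<lambda>r. sobolev_norm s (\<lambda>x. (u r x - u t x) / (r - t) - u' t x)) \<longlongrightarrow> 0) (at t within {0..T})"
  proof (rule Lim_transform_eventually[OF lim])
    show "\<forall>\<^sub>F r in at t within {0..T}. sqrt (hsq s (?q r)) = sobolev_norm s (\<lambda>x. (u r x - u t x) / (r - t) - u' t x)"
      using eventually_in_interval
    proof eventually_elim
      case (elim r)
      have l: "l1 (c r)" "l1 (c t)" "l1 (c' t)"
        using hcont_seq[OF c] hcont_seq[OF c'] elim t s hseq_imp_l1 by auto
      define z where "z = 1 / complex_of_real (r - t)"
      have q: "?q r = (\<lambda>n. z * (c r n - c t n) - c' t n)" by (simp add: z_def fun_eq_iff)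
      have lz: "l1 (\<lambda>n. z * (c r n - c t n))" by (intro l1_scale l1_diff l)
      have "fourier_coeff (\<lambda>x. (u r x - u t x) / (r - t) - u' t x) = ?q r"
        unfolding q
      proof (rule fourier_coeff_fseries)
        show "l1 (\<lambda>n. z * (c r n - c t n) - c' t n)" by (intro l1_diff[OF lz] l)
        fix x
        have "fseries (\<lambda>n. z * (c r n - c t n) - c' t n) x = z * (fseries (c r) x - fseries (c t) x) - fseries (c' t) x"
          by (simp only: fseries_diff[OF lz l(3)] fseries_scale fseries_diff[OF l(1,2)])
        thus "complex_of_real ((u r x - u t x) / (r - t) - u' t x) = fseries (\<lambda>n. z * (c r n - c t n) - c' t n) x"
          using u[OF elim] u[OF t] u'[OF t] by (simp add: z_def)
      qed
      thus ?case by (simp add: sobolev_norm_eq)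
    qed
  qed
qed

text \<open>
  Convergence of the difference quotients in the norm of order \<open>1\<close> implies pointwise convergence.
\<close>

lemma fseries_curve_derivative:
  assumes c: "hcont T 1 c" and c': "hcont T 1 c'"
    and der: "\<And>t n. t \<in> {0..T} \<Longrightarrow> ((\<lambda>r. c r n) has_vector_derivative c' t n) (at t within {0..T})"
    and t: "t \<in> {0..T}"
  shows "((\<lambda>r. fseries (c r) x) has_vector_derivative fseries (c' t) x) (at t within {0..T})"
  unfolding has_vector_derivative_complex_quotient
proof (rule LIM_zero_cancel)
  let ?q = "\<lambda>r n. (c r n - c t n) / of_real (r - t) - c' t n"
  have "((\<lambda>r. sqrt (inv_sq_sum * hsq 1 (?q r))) \<longlongrightarrow> sqrt (inv_sq_sum * 0)) (at t within {0..T})"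
    by (intro tendsto_intros hcont_derivative[OF der c' t])
  hence lim: "((\<lambda>r. sqrt (inv_sq_sum * hsq 1 (?q r))) \<longlongrightarrow> 0) (at t within {0..T})" by simp
  show "((\<lambda>r. (fseries (c r) x - fseries (c t) x) / of_real (r - t) - fseries (c' t) x) \<longlongrightarrow> 0) (at t within {0..T})"
  proof (rule Lim_null_comparison[OF _ lim])
    show "\<forall>\<^sub>F r in at t within {0..T}. norm ((fseries (c r) x - fseries (c t) x) / of_real (r - t) - fseries (c' t) x)
        \<le> sqrt (inv_sq_sum * hsq 1 (?q r))"
      using eventually_in_interval
    proof eventually_elim
      case (elim r)
      define z where "z = 1 / complex_of_real (r - t)"
      have q: "?q r = (\<lambda>n. z * (c r n - c t n) - c' t n)" by (simp add: z_def fun_eq_iff)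
      have h: "(\<lambda>n. z * (c r n - c t n) - c' t n) \<in> hseq 1"
        by (intro hseq_diff hseq_scale hcont_seq[OF c] hcont_seq[OF c'] elim t)
      have l: "l1 (c r)" "l1 (c t)" "l1 (c' t)"
        using hcont_seq[OF c] hcont_seq[OF c'] elim t hseq_imp_l1 by auto
      have lz: "l1 (\<lambda>n. z * (c r n - c t n))" by (intro l1_scale l1_diff l)
      have "(fseries (c r) x - fseries (c t) x) / of_real (r - t) - fseries (c' t) x
          = fseries (\<lambda>n. z * (c r n - c t n) - c' t n) x"
        by (simp only: fseries_diff[OF lz l(3)] fseries_scale fseries_diff[OF l(1,2)]) (simp add: z_def)
      also have "cmod \<dots> \<le> l1_norm (\<lambda>n. z * (c r n - c t n) - c' t n)"
        by (intro fseries_bound l1_diff[OF lz] l)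
      also have "\<dots> \<le> sqrt (inv_sq_sum * hsq 1 (\<lambda>n. z * (c r n - c t n) - c' t n))"
        unfolding l1_norm_def by (rule real_le_rsqrt) (rule hseq_1_l1(2)[OF h])
      finally show ?case unfolding q .
    qed
  qed
qed

lemma hcont_deriv: "hcont T 2 c \<Longrightarrow> hcont T 1 (\<lambda>t n. \<i> * of_int n * c t n)"
proof (rule hcont_contraction[of T 2 c 1])
  fix x assume x: "x \<in> hseq 2"
  have "wt 1 n * (cmod (\<i> * of_int n * x n))\<^sup>2 \<le> 1 * (wt 2 n * (cmod (x n))\<^sup>2)" for n
  proof -
    have "(of_int n)\<^sup>2 \<le> (1 + (of_int n)\<^sup>2 :: real)" by simp
    from mult_right_mono[OF this, of "(1 + (of_int n)\<^sup>2) * (cmod (x n))\<^sup>2"]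
    show ?thesis by (simp add: wt_def norm_mult power_mult_distrib power2_eq_square[of "1 + _"] mult_ac)
  qed
  from hseq_dominated[OF x _ this]
  show "(\<lambda>n. \<i> * of_int n * x n) \<in> hseq 1" "hsq 1 (\<lambda>n. \<i> * of_int n * x n) \<le> 1 * hsq 2 x" by auto
qed (auto simp: algebra_simps)

section \<open>Classical solutions and their coefficients\<close>

text \<open>
  Continuity of order \<open>2\<close> makes \<open>\<eta>\<close> and \<open>\<partial>\<^sub>\<theta>\<eta>\<close> jointly continuous. It also makes
  \<open>Lseq (c t)\<close> continuous of order \<open>1\<close>, and this gives a jointly continuous time derivative.
\<close>

theorem coeff_solution_imp_classical:
  assumes c: "hcont T s c" "coeff_solution T c" and s: "s \<ge> 2"
    and \<eta>: "\<And>t x. t \<in> {0..T} \<Longrightarrow> complex_of_real (\<eta> t x) = fseries (c t) x"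
    and init: "AE x in lborel. \<eta> 0 x = \<eta>\<^sub>0 x"
  shows "classical_solution T \<eta>\<^sub>0 \<eta>"
proof -
  have \<eta>': "\<eta> t x = Re (fseries (c t) x)" if "t \<in> {0..T}" for t x
    using \<eta>[OF that, of x] by (metis Re_complex_of_real)
  have h1: "hcont T 1 c" and h2: "hcont T 2 c" by (rule hcont_mono[OF c(1)]; use s in simp)+
  have hL: "hcont T 1 (\<lambda>t. Lseq (c t))" using hcont_Lseq[of T 1 c] h2 by (simp add: numeral_2_eq_2)
  have der: "((\<lambda>r. c r n) has_vector_derivative - 1 * Lseq (c t) n) (at t within {0..T})"
    if "t \<in> {0..T}" for t n using c(2) that by (simp add: coeff_solution_def)
  have c2: "c t \<in> hseq 2" if "t \<in> {0..T}" for t by (rule hcont_seq[OF h2 that])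
  have l: "l1 (c t)" if "t \<in> {0..T}" for t using hseq_imp_l1[OF c2[OF that]] by simp
  have contRe: "continuous_on A (\<lambda>(t, x). Re (fseries (d t) x))" if "continuous_on A (\<lambda>(t, x). fseries (d t) x)" for A d
    using continuous_on_Re[OF that] by (simp add: case_prod_beta')
  show ?thesis unfolding classical_solution_def
  proof (intro conjI ballI allI)
    fix t x assume t: "t \<in> {0..T}"
    show "periodic (\<eta> t)" by (simp add: periodic_def \<eta>'[OF t] fseries_periodic)
    show "\<eta> t differentiable at x"
      unfolding real_differentiable_def using deriv_fseries(1)[OF c2[OF t] \<eta>[OF t]] by blast
  next
    show "continuous_on ({0..T} \<times> UNIV) (\<lambda>(t, x). \<eta> t x)"
      by (rule continuous_on_cong[THEN iffD1, OF refl _ contRe[OF continuous_on_fseries_curve[OF h1]]]) (auto simp: \<eta>')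
    have "continuous_on ({0..T} \<times> UNIV) (\<lambda>(t, x). Re (fseries (\<lambda>n. \<i> * of_int n * c t n) x))"
      by (rule contRe[OF continuous_on_fseries_curve[OF hcont_deriv[OF h2]]])
    moreover have "deriv (\<eta> t) x = Re (fseries (\<lambda>n. \<i> * of_int n * c t n) x)" if "t \<in> {0..T}" for t x
      using DERIV_imp_deriv[OF deriv_fseries(1)[OF c2[OF that] \<eta>[OF that]]] .
    ultimately show "continuous_on ({0..T} \<times> UNIV) (\<lambda>(t, x). deriv (\<eta> t) x)"
      by (elim continuous_on_cong[THEN iffD1, OF refl, rotated]) auto
  next
    define \<eta>t where "\<eta>t t x = - Re (fseries (Lseq (c t)) x)" for t x
    define v where "v t x = Re (fseries (velocity_coeff (c t)) x)" for t x
    have "continuous_on ({0..T} \<times> UNIV) (\<lambda>p. - (case p of (t, x) \<Rightarrow> Re (fseries (Lseq (c t)) x)))"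
      by (intro continuous_on_minus contRe continuous_on_fseries_curve[OF hL])
    hence "continuous_on ({0..T} \<times> UNIV) (\<lambda>(t, x). \<eta>t t x)" by (simp add: \<eta>t_def case_prod_beta')
    moreover have "((\<lambda>r. \<eta> r x) has_real_derivative \<eta>t t x) (at t within {0..T})" if t: "t \<in> {0..T}" for t x
    proof -
      have "((\<lambda>r. Re (fseries (c r) x)) has_real_derivative Re (fseries (\<lambda>n. - 1 * Lseq (c t) n) x)) (at t within {0..T})"
        by (rule has_field_derivative_Re[OF fseries_curve_derivative[OF h1 hcont_scale[OF hL] der t]])
      also have "Re (fseries (\<lambda>n. - 1 * Lseq (c t) n) x) = \<eta>t t x" unfolding fseries_scale \<eta>t_def by simp
      finally show ?thesis
        unfolding has_real_derivative_iff_has_vector_derivative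
        by (rule has_vector_derivative_transform[where f = "\<lambda>r. Re (fseries (c r) x)", rotated 2])
           (use t \<eta>' in auto)
    qed
    moreover have "\<eta>t t x + L_op (\<eta> t) (v t) x = 0" if t: "t \<in> {0..T}" for t x
    proof -
      have "complex_of_real (L_op (\<eta> t) (v t) x) = fseries (Lseq (c t)) x"
        by (rule L_op_fseries[OF c2[OF t] \<eta>[OF t]]) (simp add: v_def velocity_real[OF l[OF t] \<eta>[OF t]])
      hence "L_op (\<eta> t) (v t) x = Re (fseries (Lseq (c t)) x)" by (metis Re_complex_of_real)
      thus ?thesis by (simp add: \<eta>t_def)
    qed
    moreover have "(v t has_real_derivative hilbert (\<eta> t) x) (at x)" if t: "t \<in> {0..T}" for t x
      unfolding v_def[abs_def] by (rule velocity_derivative[OF c2[OF t] \<eta>[OF t]])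
    moreover have "v t 0 = 0" if t: "t \<in> {0..T}" for t
      by (simp add: v_def fseries_velocity_at_0[OF l[OF t]])
    ultimately show "\<exists>\<eta>' v. continuous_on ({0..T} \<times> UNIV) (\<lambda>(t, x). \<eta>' t x) \<and>
        (\<forall>t\<in>{0..T}. \<forall>x.
           ((\<lambda>s. \<eta> s x) has_real_derivative \<eta>' t x) (at t within {0..T}) \<and>
           \<eta>' t x + L_op (\<eta> t) (v t) x = 0 \<and>
           (v t has_real_derivative hilbert (\<eta> t) x) (at x)) \<and>
        (\<forall>t\<in>{0..T}. v t 0 = 0)"
      by (intro exI[of _ \<eta>t] exI[of _ v]) blast
  next
    show "AE x in lborel. \<eta> 0 x = \<eta>\<^sub>0 x" by (rule init)
  qed
qed

text \<open>
  The coefficients are integrals over a period that may be differentiated under the integral sign because \<open>\<partial>\<^sub>t\<eta>\<close> is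
  continuous; the equation at each point says that this derivative has the coefficients \<open>- Lseq (z t)\<close>.
  The velocity need not be given as a series: the equations for \<open>v\<close> determine it.
\<close>

theorem classical_imp_coeff_solution:
  assumes cl: "classical_solution T \<eta>\<^sub>0 \<zeta>" and reg: "\<zeta> \<in> C_sobolev 0 T m" and m: "m \<ge> 2"
  defines "z \<equiv> (\<lambda>t. fourier_coeff (\<zeta> t))"
  shows "hcont T m z" "coeff_solution T z"
    and "\<And>t x. t \<in> {0..T} \<Longrightarrow> complex_of_real (\<zeta> t x) = fseries (z t) x"
proof -
  have cont: "continuous_on UNIV (\<zeta> t)" if "t \<in> {0..T}" for t
    using cl that unfolding classical_solution_def
    by (intro continuous_at_imp_continuous_on ballI differentiable_imp_continuous_within) auto
  have sob: "\<zeta> t \<in> sobolev m" if "t \<in> {0..T}" for t using reg that by simp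
  have zseq: "z t \<in> hseq m" if "t \<in> {0..T}" for t using sob[OF that] by (simp add: sobolev_iff z_def)
  have l: "l1 (z t)" if "t \<in> {0..T}" for t using hseq_imp_l1[OF zseq[OF that]] m by simp
  show \<zeta>: "complex_of_real (\<zeta> t x) = fseries (z t) x" if "t \<in> {0..T}" for t x
    unfolding z_def by (rule continuous_sobolev_expansion[OF sob[OF that] _ cont[OF that]]) (use m in simp)
  show "hcont T m z" unfolding hcont_def
  proof (intro ballI conjI zseq)
    fix t assume t: "t \<in> {0..T}"
    have "((\<lambda>r. (sobolev_norm m (\<lambda>x. \<zeta> r x - \<zeta> t x))\<^sup>2) \<longlongrightarrow> 0\<^sup>2) (at t within {0..T})"
      using reg t by (intro tendsto_power) simp
    hence lim: "((\<lambda>r. (sobolev_norm m (\<lambda>x. \<zeta> r x - \<zeta> t x))\<^sup>2) \<longlongrightarrow> 0) (at t within {0..T})" by simp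
    show "((\<lambda>r. hsq m (\<lambda>n. z r n - z t n)) \<longlongrightarrow> 0) (at t within {0..T})"
    proof (rule Lim_transform_eventually[OF lim])
      show "\<forall>\<^sub>F r in at t within {0..T}. (sobolev_norm m (\<lambda>x. \<zeta> r x - \<zeta> t x))\<^sup>2 = hsq m (\<lambda>n. z r n - z t n)"
        using eventually_in_interval
      proof eventually_elim
        case (elim r)
        have "fourier_coeff (\<lambda>x. \<zeta> r x - \<zeta> t x) = (\<lambda>n. z r n - z t n)"
          by (rule fourier_coeff_fseries)
             (use elim t in \<open>simp_all only: l1_diff l fseries_diff of_real_diff \<zeta>\<close>)
        thus ?case by (simp add: sobolev_norm_eq)
      qed
    qed
  qed
  obtain \<zeta>' v where \<zeta>'c: "continuous_on ({0..T} \<times> UNIV) (\<lambda>(t, x). \<zeta>' t x)"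
    and eqs: "\<And>t x. t \<in> {0..T} \<Longrightarrow> ((\<lambda>s. \<zeta> s x) has_real_derivative \<zeta>' t x) (at t within {0..T})"
      "\<And>t x. t \<in> {0..T} \<Longrightarrow> \<zeta>' t x + L_op (\<zeta> t) (v t) x = 0"
      "\<And>t x. t \<in> {0..T} \<Longrightarrow> (v t has_real_derivative hilbert (\<zeta> t) x) (at x)"
    and v0: "\<And>t. t \<in> {0..T} \<Longrightarrow> v t 0 = 0"
    using cl unfolding classical_solution_def by blast
  have z2: "z t \<in> hseq 2" if "t \<in> {0..T}" for t by (rule hseq_mono[OF zseq[OF that] m])
  have z'eq: "complex_of_real (\<zeta>' t x) = - fseries (Lseq (z t)) x" if t: "t \<in> {0..T}" for t x
  proof -
    have "complex_of_real (L_op (\<zeta> t) (v t) x) = fseries (Lseq (z t)) x"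
      by (intro L_op_fseries[OF z2[OF t] \<zeta>[OF t]] velocity_unique[OF z2[OF t] \<zeta>[OF t]] eqs(3) v0 t)
    moreover have "\<zeta>' t x = - L_op (\<zeta> t) (v t) x" using eqs(2)[OF t, of x] by linarith
    ultimately show ?thesis by simp
  qed
  show "coeff_solution T z" unfolding coeff_solution_def
  proof (intro ballI allI)
    fix t n assume t: "t \<in> {0..T}"
    let ?e = "\<lambda>x. cis (- (of_int n * x))"
    let ?I = "\<lambda>r. integral (cbox (- pi) pi) (\<lambda>x. complex_of_real (\<zeta> r x) * ?e x)"
    have zI: "z r n = ?I r / (2 * pi)" if "r \<in> {0..T}" for r
    proof -
      have "set_integrable lborel {-pi..pi} (\<lambda>x. complex_of_real (\<zeta> r x) * ?e x)"
        by (intro borel_integrable_atLeastAtMost' continuous_intros continuous_on_subset[OF cont[OF that]]) auto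
      from set_borel_integral_eq_integral(2)[OF this] show ?thesis
        by (simp add: z_def fourier_coeff_def)
    qed
    have "(?I has_vector_derivative integral (cbox (- pi) pi) (\<lambda>x. complex_of_real (\<zeta>' t x) * ?e x)) (at t within {0..T})"
    proof (rule leibniz_rule_vector_derivative)
      fix r x assume r: "r \<in> {0..T}"
      have "((\<lambda>r. complex_of_real (\<zeta> r x)) has_vector_derivative complex_of_real (\<zeta>' r x)) (at r within {0..T})"
        using eqs(1)[OF r] by (simp add: has_vector_derivative_complex_iff)
      thus "((\<lambda>r. complex_of_real (\<zeta> r x) * ?e x) has_vector_derivative complex_of_real (\<zeta>' r x) * ?e x) (at r within {0..T})"
        by (rule has_vector_derivative_mult_left)
    next
      fix r assume r: "r \<in> {0..T}"
      show "(\<lambda>x. complex_of_real (\<zeta> r x) * ?e x) integrable_on cbox (- pi) pi"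
        by (intro integrable_continuous continuous_intros continuous_on_subset[OF cont[OF r]]) auto
    next
      have "continuous_on ({0..T} \<times> cbox (- pi) pi) (\<lambda>p. case p of (t, x) \<Rightarrow> \<zeta>' t x)"
        by (rule continuous_on_subset[OF \<zeta>'c]) auto
      hence "continuous_on ({0..T} \<times> cbox (- pi) pi) (\<lambda>p. complex_of_real (case p of (t, x) \<Rightarrow> \<zeta>' t x) * ?e (snd p))"
        by (intro continuous_intros)
      thus "continuous_on ({0..T} \<times> cbox (- pi) pi) (\<lambda>(t, x). complex_of_real (\<zeta>' t x) * ?e x)"
        by (simp add: case_prod_beta')
    qed (use t in auto)
    hence "((\<lambda>r. ?I r / (2 * pi)) has_vector_derivative
        integral (cbox (- pi) pi) (\<lambda>x. complex_of_real (\<zeta>' t x) * ?e x) / (2 * pi)) (at t within {0..T})"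
      by (rule has_vector_derivative_divide)
    also have "integral (cbox (- pi) pi) (\<lambda>x. complex_of_real (\<zeta>' t x) * ?e x) / (2 * pi) = - Lseq (z t) n"
    proof -
      have lL: "l1 (Lseq (z t))"
        using hseq_Lseq[of "z t" 1] z2[OF t] hseq_imp_l1 by (simp add: numeral_2_eq_2)
      have "set_integrable lborel {-pi..pi} (\<lambda>x. fseries (Lseq (z t)) x * ?e x)"
        by (intro borel_integrable_atLeastAtMost' continuous_intros continuous_fseries lL)
      from set_borel_integral_eq_integral(2)[OF this]
      have "integral {-pi..pi} (\<lambda>x. fseries (Lseq (z t)) x * ?e x) / (2 * pi) = Lseq (z t) n"
        using fseries_coeff[OF lL, of n] by simp
      thus ?thesis by (simp add: z'eq[OF t])
    qed
    finally show "((\<lambda>r. z r n) has_vector_derivative - Lseq (z t) n) (at t within {0..T})"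
      by (rule has_vector_derivative_transform[where f = "\<lambda>r. ?I r / (2 * pi)", rotated 2]) (use t zI in auto)
  qed
qed

text \<open>
  At time \<open>0\<close> two solutions agree almost everywhere, hence everywhere by continuity; so their coefficients
  have the same initial value.
\<close>

theorem classical_solution_unique:
  assumes T: "T > 0" and m: "m \<ge> 2"
    and \<zeta>: "classical_solution T \<eta>\<^sub>0 \<zeta>" "\<zeta> \<in> C_sobolev 0 T m"
    and \<eta>: "classical_solution T \<eta>\<^sub>0 \<eta>" "\<eta> \<in> C_sobolev 0 T m"
    and t: "t \<in> {0..T}"
  shows "\<zeta> t x = \<eta> t x"
proof -
  note Z = classical_imp_coeff_solution[OF \<zeta> m] and Y = classical_imp_coeff_solution[OF \<eta> m]
  have 0: "0 \<in> {0..T}" using T by simp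
  have cont: "continuous_on UNIV (u 0)" if "classical_solution T \<eta>\<^sub>0 u" for u
    using that 0 unfolding classical_solution_def
    by (intro continuous_at_imp_continuous_on ballI differentiable_imp_continuous_within) auto
  have "AE x in lborel. \<zeta> 0 x = \<eta>\<^sub>0 x" "AE x in lborel. \<eta> 0 x = \<eta>\<^sub>0 x"
    using \<zeta>(1) \<eta>(1) unfolding classical_solution_def by blast+
  hence "AE x in lborel. \<zeta> 0 x = \<eta> 0 x" by eventually_elim simp
  hence "\<zeta> 0 = \<eta> 0" by (rule continuous_AE_eq[OF cont[OF \<zeta>(1)] cont[OF \<eta>(1)]])
  hence "fourier_coeff (\<zeta> t) = fourier_coeff (\<eta> t)"
    using coeff_solution_unique[OF hcont_mono[OF Z(1) m] Z(2) hcont_mono[OF Y(1) m] Y(2) _ t] by simp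
  hence "complex_of_real (\<zeta> t x) = complex_of_real (\<eta> t x)" using Z(3)[OF t] Y(3)[OF t] by simp
  thus ?thesis by simp
qed

text \<open>
  The coefficient solution stays in the real subspace, since its reflected conjugate solves the same problem. The
  two time derivatives are \<open>- L \<eta>\<close> and \<open>L (L \<eta>)\<close>, of orders \<open>m - 1\<close> and \<open>m - 2\<close>.
\<close>

theorem classical_solution_exists:
  assumes m: "m > 3" and \<eta>\<^sub>0: "\<eta>\<^sub>0 \<in> sobolev m" and T: "T > 0"
  obtains \<eta> where "classical_solution T \<eta>\<^sub>0 \<eta>" "\<eta> \<in> C_sobolev 0 T m" "\<eta> \<in> C_sobolev 2 T (m - 2)"
proof -
  define c0 where "c0 = fourier_coeff \<eta>\<^sub>0"
  have "c0 \<in> hseq m" using \<eta>\<^sub>0 by (simp add: sobolev_iff c0_def)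
  then obtain c where c0: "c 0 = c0" and c: "hcont T m c" "coeff_solution T c"
    using coeff_solution_exists[of c0 m T] T by (metis less_imp_le)
  have sym: "cnj (c t (- n)) = c t n" if t: "t \<in> {0..T}" for t n
  proof -
    define d where "d t n = cnj (c t (- n))" for t n
    have "hcont T m d" unfolding d_def by (rule hcont_cnj_reflect[OF c(1)])
    moreover have "coeff_solution T d" unfolding coeff_solution_def
    proof (intro ballI allI)
      fix t n assume "t \<in> {0..T}"
      hence "((\<lambda>r. c r (- n)) has_vector_derivative - Lseq (c t) (- n)) (at t within {0..T})"
        using c(2) by (simp add: coeff_solution_def)
      hence "((\<lambda>r. cnj (c r (- n))) has_vector_derivative cnj (- Lseq (c t) (- n))) (at t within {0..T})"
        by (rule has_vector_derivative_cnj)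
      thus "((\<lambda>r. d r n) has_vector_derivative - Lseq (d t) n) (at t within {0..T})"
        by (simp add: d_def[abs_def] Lseq_cnj_reflect)
    qed
    moreover have "d 0 = c 0" by (simp add: d_def c0 c0_def fourier_coeff_cnj fun_eq_iff)
    ultimately have "d t = c t"
      using c m t by (intro coeff_solution_unique[of T d c t] hcont_mono[of T m _ 2]) auto
    thus ?thesis by (metis d_def)
  qed
  define \<eta> where "\<eta> t x = Re (fseries (c t) x)" for t x
  have \<eta>: "complex_of_real (\<eta> t x) = fseries (c t) x" if "t \<in> {0..T}" for t x
    unfolding \<eta>_def by (rule fseries_real) (rule sym[OF that])
  have symL: "cnj (Lseq (c t) (- n)) = Lseq (c t) n" if "t \<in> {0..T}" for t n
    using Lseq_cnj_reflect[of "c t" n] sym[OF that] by simp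
  have symLL: "cnj (Lseq (Lseq (c t)) (- n)) = Lseq (Lseq (c t)) n" if "t \<in> {0..T}" for t n
    using Lseq_cnj_reflect[of "Lseq (c t)" n] symL[OF that] by simp
  let ?s = "m - 2"
  have s: "Suc (Suc ?s) = m" "1 \<le> ?s" using m by auto
  have h0: "hcont T ?s c" by (rule hcont_mono[OF c(1)]) simp
  have hL: "hcont T (Suc ?s) (\<lambda>t. Lseq (c t))" by (rule hcont_Lseq) (use c(1) s in simp)
  have hL': "hcont T ?s (\<lambda>t. Lseq (c t))" by (rule hcont_mono[OF hL]) simp
  have hLL: "hcont T ?s (\<lambda>t. Lseq (Lseq (c t)))" by (rule hcont_Lseq[OF hL])
  define u1 where "u1 t x = - Re (fseries (Lseq (c t)) x)" for t x
  define u2 where "u2 t x = Re (fseries (Lseq (Lseq (c t))) x)" for t x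
  have u1: "complex_of_real (u1 t x) = fseries (\<lambda>n. - 1 * Lseq (c t) n) x" if "t \<in> {0..T}" for t x
  proof -
    have "complex_of_real (Re (fseries (Lseq (c t)) x)) = fseries (Lseq (c t)) x"
      by (rule fseries_real) (rule symL[OF that])
    thus ?thesis unfolding fseries_scale u1_def by simp
  qed
  have u2: "complex_of_real (u2 t x) = fseries (Lseq (Lseq (c t))) x" if "t \<in> {0..T}" for t x
    unfolding u2_def by (rule fseries_real) (rule symLL[OF that])
  have der: "((\<lambda>r. c r n) has_vector_derivative - 1 * Lseq (c t) n) (at t within {0..T})"
    if "t \<in> {0..T}" for t n using c(2) that by (simp add: coeff_solution_def)
  have derL: "((\<lambda>r. - 1 * Lseq (c r) n) has_vector_derivative Lseq (Lseq (c t)) n) (at t within {0..T})"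
    if t: "t \<in> {0..T}" for t n
  proof -
    have "((\<lambda>r. Lseq (c r) n) has_vector_derivative Lseq (\<lambda>n. - 1 * Lseq (c t) n) n) (at t within {0..T})"
      by (rule Lseq_has_vector_derivative[OF _ der _ t])
         (use hcont_seq[OF hcont_mono[OF h0, of 0]] hcont_scale[OF hcont_mono[OF hL', of 0], of "- 1"] in auto)
    from has_vector_derivative_mult_right[OF this, of "- 1"] show ?thesis by (simp only: Lseq_scale) simp
  qed
  have "u2 \<in> C_sobolev 0 T ?s" by (rule C_sobolev_0_fseries[OF hLL s(2) u2])
  have "u1 \<in> C_sobolev (Suc 0) T ?s"
  proof (rule C_sobolev_Suc_fseries[where c' = "\<lambda>t. Lseq (Lseq (c t))" and u' = u2])
    show "hcont T ?s (\<lambda>t n. - 1 * Lseq (c t) n)" by (rule hcont_scale[OF hL'])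
  qed (use hLL s(2) derL u1 u2 \<open>u2 \<in> C_sobolev 0 T ?s\<close> in auto)
  have "\<eta> \<in> C_sobolev (Suc (Suc 0)) T ?s"
  proof (rule C_sobolev_Suc_fseries[where c = c and u' = u1])
    show "hcont T ?s (\<lambda>t n. - 1 * Lseq (c t) n)" by (rule hcont_scale[OF hL'])
  qed (use h0 s(2) der \<eta> u1 \<open>u1 \<in> C_sobolev (Suc 0) T ?s\<close> in auto)
  moreover have "\<eta> \<in> C_sobolev 0 T m" by (rule C_sobolev_0_fseries[OF c(1) _ \<eta>]) (use m in simp)
  moreover have "classical_solution T \<eta>\<^sub>0 \<eta>"
  proof (rule coeff_solution_imp_classical[OF c _ \<eta>])
    have "AE x in lborel. complex_of_real (\<eta>\<^sub>0 x) = fseries (c 0) x"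
      unfolding c0 c0_def by (rule sobolev_expansion[OF \<eta>\<^sub>0]) (use m in simp)
    thus "AE x in lborel. \<eta> 0 x = \<eta>\<^sub>0 x"
    proof eventually_elim
      case (elim x)
      show ?case unfolding \<eta>_def elim [symmetric] by simp
    qed
  qed (use m in simp)
  ultimately show thesis using that by (simp add: numeral_2_eq_2)
qed

theorem theorem1:
  fixes m :: nat and \<eta>\<^sub>0 :: "real \<Rightarrow> real" and T :: real
  assumes "m > 3" and "\<eta>\<^sub>0 \<in> sobolev m" and "T > 0"
  shows "\<exists>\<eta>. (classical_solution T \<eta>\<^sub>0 \<eta> \<and> \<eta> \<in> C_sobolev 0 T m \<inter> C_sobolev 2 T (m - 2)) \<and>
    (\<forall>\<zeta>. classical_solution T \<eta>\<^sub>0 \<zeta> \<and> \<zeta> \<in> C_sobolev 0 T m \<inter> C_sobolev 2 T (m - 2) \<longrightarrow>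
      (\<forall>t\<in>{0..T}. \<forall>x. \<zeta> t x = \<eta> t x))"
proof -
  obtain \<eta> where \<eta>: "classical_solution T \<eta>\<^sub>0 \<eta>" "\<eta> \<in> C_sobolev 0 T m" "\<eta> \<in> C_sobolev 2 T (m - 2)"
    using classical_solution_exists[OF assms] by blast
  have "\<zeta> t x = \<eta> t x"
    if "classical_solution T \<eta>\<^sub>0 \<zeta>" "\<zeta> \<in> C_sobolev 0 T m" "t \<in> {0..T}" for \<zeta> t x
    using classical_solution_unique[OF assms(3) _ that(1,2) \<eta>(1,2) that(3)] assms(1) by simp
  with \<eta> show ?thesis by blast
qed

end
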